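(* Let $X$ be a Hilbert $C^*$-module over a $C^*$-algebra $B$ and let $M,N\subset X$ be complemented submodules. Then the following are equivalent: (i) $c(M,N)<1$; (ii) $M\cap N$ is complemented and $M+N$ is closed; (iii) $M^\perp\cap N^\perp$ is complemented and $M^\perp+N^\perp$ is closed.
   Context: A closed submodule $\Omega\subset X$ is complemented if $X=\Omega\oplus\Omega^\perp$, where $\Omega^\perp=\{x\in X:\langle x,y\rangle=0\ \forall y\in\Omega\}$. The (cosine of the) Friedrichs angle $c(M,N)$ of an arbitrary pair of complemented submodules is defined by localisation: for a representation $\pi:B\to\mathbb{B}(H_\pi)$ on a Hilbert space, let $X_\pi:=X\otimes_B H_\pi$ be the Hilbert space given by the interior tensor product, and for a closed submodule $\Omega\subset X$ let $\Omega_\pi:=\Omega\otimes_BH_\pi$, regarded as a closed subspace of $X_\pi$. Put $c_\pi(M,N):=\|P_{M_\pi}P_{N_\pi}-P_{M_\pi\cap N_\pi}\|$, with $P_V$ the orthogonal projection in $\mathbb{B}(X_\pi)$ onto the closed subspace $V$. This quantity is the same for all faithful representations $\pi$ of $B$, and $c(M,N):=c_\pi(M,N)$ for any faithful $\pi$. *)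

theory Defs
  imports "HOL-Analysis.Analysis" "HOL-Library.Poly_Mapping" "HOL-Library.Set_Algebras"
begin

section \<open>Complex vector spaces, Hilbert spaces and C*-algebras\<close>

class complex_vector = ab_group_add +
  fixes scaleC :: "complex \<Rightarrow> 'a \<Rightarrow> 'a" (infixr \<open>*\<^sub>C\<close> 75)
  assumes scaleC_add_right: "a *\<^sub>C (x + y) = a *\<^sub>C x + a *\<^sub>C y"
    and scaleC_add_left: "(a + b) *\<^sub>C x = a *\<^sub>C x + b *\<^sub>C x"
    and scaleC_scaleC: "a *\<^sub>C (b *\<^sub>C x) = (a * b) *\<^sub>C x"
    and scaleC_one: "1 *\<^sub>C x = x"

class complex_normed_vector = complex_vector + real_normed_vector +
  assumes scaleC_of_real: "complex_of_real r *\<^sub>C x = r *\<^sub>R x"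
    and norm_scaleC: "norm (a *\<^sub>C x) = cmod a * norm x"

text \<open>All inner products, scalar or C*-valued, are linear in the second argument.\<close>

class chilbert_space = complex_normed_vector + banach +
  fixes cinner :: "'a \<Rightarrow> 'a \<Rightarrow> complex"
  assumes cinner_add_right: "cinner x (y + z) = cinner x y + cinner x z"
    and cinner_scaleC_right: "cinner x (a *\<^sub>C y) = a * cinner x y"
    and cinner_commute: "cinner y x = cnj (cinner x y)"
    and cinner_self: "cinner x x = complex_of_real ((norm x)\<^sup>2)"

text \<open>Not assumed unital; the zero algebra is allowed.\<close>

class cstar_algebra = complex_normed_vector + real_normed_algebra + banach +
  fixes star :: "'a \<Rightarrow> 'a"
  assumes mult_scaleC_left: "(c *\<^sub>C a) * b = c *\<^sub>C (a * b)"
    and mult_scaleC_right: "a * (c *\<^sub>C b) = c *\<^sub>C (a * b)"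
    and star_add: "star (a + b) = star a + star b"
    and star_scaleC: "star (c *\<^sub>C a) = cnj c *\<^sub>C star a"
    and star_mult: "star (a * b) = star b * star a"
    and star_star: "star (star a) = a"
    and norm_star_mult_self: "norm (star a * a) = (norm a)\<^sup>2"

definition cstar_positive :: "'b::cstar_algebra \<Rightarrow> bool" where
  "cstar_positive b \<longleftrightarrow> (\<exists>a. b = star a * a)"

section \<open>Hilbert C*-modules and complemented submodules\<close>

text \<open>
  Right Hilbert modules. Definiteness of the inner product is contained in
  \<open>norm_eq\<close>, and completeness in the class \<open>banach\<close>.
\<close>

locale hilbert_cstar_module =
  fixes act :: "'x::{complex_normed_vector, banach} \<Rightarrow> 'b::cstar_algebra \<Rightarrow> 'x"
    and ip :: "'x \<Rightarrow> 'x \<Rightarrow> 'b"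
  assumes act_add_left: "act (x + y) b = act x b + act y b"
    and act_add_right: "act x (a + b) = act x a + act x b"
    and act_act: "act (act x a) b = act x (a * b)"
    and act_scaleC_left: "act (c *\<^sub>C x) b = c *\<^sub>C act x b"
    and act_scaleC_right: "act x (c *\<^sub>C b) = c *\<^sub>C act x b"
    and ip_add_right: "ip x (y + z) = ip x y + ip x z"
    and ip_scaleC_right: "ip x (c *\<^sub>C y) = c *\<^sub>C ip x y"
    and ip_act_right: "ip x (act y b) = ip x y * b"
    and star_ip: "star (ip x y) = ip y x"
    and ip_positive: "cstar_positive (ip x x)"
    and norm_eq: "norm x = sqrt (norm (ip x x))"

definition closed_submodule ::
    "('x::complex_normed_vector \<Rightarrow> 'b \<Rightarrow> 'x) \<Rightarrow> 'x set \<Rightarrow> bool" where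
  "closed_submodule act W \<longleftrightarrow>
     closed W \<and> 0 \<in> W \<and> (\<forall>x\<in>W. \<forall>y\<in>W. x + y \<in> W) \<and>
     (\<forall>c. \<forall>x\<in>W. c *\<^sub>C x \<in> W) \<and> (\<forall>b. \<forall>x\<in>W. act x b \<in> W)"

definition ortho_compl :: "('x \<Rightarrow> 'x \<Rightarrow> 'b::zero) \<Rightarrow> 'x set \<Rightarrow> 'x set" where
  "ortho_compl ip W = {x. \<forall>y\<in>W. ip x y = 0}"

text \<open>\<open>W + V\<close> is the elementwise sum of sets.\<close>

definition complemented ::
    "('x::complex_normed_vector \<Rightarrow> 'b::zero \<Rightarrow> 'x) \<Rightarrow> ('x \<Rightarrow> 'x \<Rightarrow> 'b) \<Rightarrow> 'x set \<Rightarrow> bool" where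
  "complemented act ip W \<longleftrightarrow>
     closed_submodule act W \<and> W + ortho_compl ip W = UNIV \<and> W \<inter> ortho_compl ip W = {0}"

definition representation :: "('b::cstar_algebra \<Rightarrow> 'h::chilbert_space \<Rightarrow> 'h) \<Rightarrow> bool" where
  "representation \<pi> \<longleftrightarrow>
     (\<forall>b. bounded_linear (\<pi> b) \<and> (\<forall>c h. \<pi> b (c *\<^sub>C h) = c *\<^sub>C \<pi> b h)) \<and>
     (\<forall>a b h. \<pi> (a + b) h = \<pi> a h + \<pi> b h) \<and>
     (\<forall>c b h. \<pi> (c *\<^sub>C b) h = c *\<^sub>C \<pi> b h) \<and>
     (\<forall>a b h. \<pi> (a * b) h = \<pi> a (\<pi> b h)) \<and>
     (\<forall>b h k. cinner (\<pi> (star b) h) k = cinner h (\<pi> b k))"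

definition faithful_representation ::
    "('b::cstar_algebra \<Rightarrow> 'h::chilbert_space \<Rightarrow> 'h) \<Rightarrow> bool" where
  "faithful_representation \<pi> \<longleftrightarrow> representation \<pi> \<and> inj \<pi>"

section \<open>Hausdorff completion of a semi-inner product space\<close>

text \<open>
  The interior tensor product depends on a representation, hence is not a type;
  the Hilbert spaces obtained by completion are given by an explicit carrier.
\<close>

record 'v inner_space =
  is_carrier :: "'v set"
  is_add :: "'v \<Rightarrow> 'v \<Rightarrow> 'v"
  is_scale :: "complex \<Rightarrow> 'v \<Rightarrow> 'v"
  is_inner :: "'v \<Rightarrow> 'v \<Rightarrow> complex"

definition is_diff :: "'v inner_space \<Rightarrow> 'v \<Rightarrow> 'v \<Rightarrow> 'v" where
  "is_diff K u v = is_add K u (is_scale K (- 1) v)"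

definition is_norm :: "'v inner_space \<Rightarrow> 'v \<Rightarrow> real" where
  "is_norm K u = sqrt (Re (is_inner K u u))"

definition orth_proj :: "'v inner_space \<Rightarrow> 'v set \<Rightarrow> 'v \<Rightarrow> 'v" where
  "orth_proj K V u = (THE v. v \<in> V \<and> (\<forall>w\<in>V. is_inner K w (is_diff K u v) = 0))"

definition op_norm :: "'v inner_space \<Rightarrow> ('v \<Rightarrow> 'v) \<Rightarrow> real" where
  "op_norm K T = (SUP u \<in> {u \<in> is_carrier K. is_norm K u \<le> 1}. is_norm K (T u))"

definition seminorm_of :: "('v \<Rightarrow> 'v \<Rightarrow> complex) \<Rightarrow> 'v \<Rightarrow> real" where
  "seminorm_of s v = sqrt (Re (s v v))"

definition cauchy_seqs :: "('v::complex_vector \<Rightarrow> 'v \<Rightarrow> complex) \<Rightarrow> (nat \<Rightarrow> 'v) set" where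
  "cauchy_seqs s = {z. \<forall>e>0. \<exists>n0. \<forall>m\<ge>n0. \<forall>n\<ge>n0. seminorm_of s (z m - z n) < e}"

definition null_rel ::
    "('v::complex_vector \<Rightarrow> 'v \<Rightarrow> complex) \<Rightarrow> ((nat \<Rightarrow> 'v) \<times> (nat \<Rightarrow> 'v)) set" where
  "null_rel s = {(z, w). z \<in> cauchy_seqs s \<and> w \<in> cauchy_seqs s \<and>
                   (\<lambda>n. seminorm_of s (z n - w n)) \<longlonglongrightarrow> 0}"

definition completion ::
    "('v::complex_vector \<Rightarrow> 'v \<Rightarrow> complex) \<Rightarrow> (nat \<Rightarrow> 'v) set inner_space" where
  "completion s =
     \<lparr> is_carrier = cauchy_seqs s // null_rel s,
       is_add = (\<lambda>Z W. null_rel s `` {\<lambda>n. z n + w n | z w. z \<in> Z \<and> w \<in> W}),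
       is_scale = (\<lambda>c Z. null_rel s `` {\<lambda>n. c *\<^sub>C z n | z. z \<in> Z}),
       is_inner = (\<lambda>Z W. THE l. \<exists>z\<in>Z. \<exists>w\<in>W. (\<lambda>n. s (z n) (w n)) \<longlonglongrightarrow> l) \<rparr>"

section \<open>Interior tensor product and Friedrichs angle\<close>

instantiation complex :: complex_vector
begin
definition scaleC_complex :: "complex \<Rightarrow> complex \<Rightarrow> complex" where
  "scaleC_complex a x = a * x"
instance
  by standard (simp_all add: scaleC_complex_def algebra_simps)
end

lemma complex_vector_scaleC_zero_right [simp]: "a *\<^sub>C (0::'a::complex_vector) = 0"
  using scaleC_add_right[of a 0 "0::'a"] by simp

instantiation poly_mapping :: (type, complex_vector) complex_vector
begin
definition scaleC_poly_mapping :: "complex \<Rightarrow> ('a \<Rightarrow>\<^sub>0 'b) \<Rightarrow> 'a \<Rightarrow>\<^sub>0 'b" where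
  "scaleC_poly_mapping a f = Poly_Mapping.map ((*\<^sub>C) a) f"

lemma lookup_scaleC: "Poly_Mapping.lookup (a *\<^sub>C f) k = a *\<^sub>C Poly_Mapping.lookup f k"
  for f :: "'a \<Rightarrow>\<^sub>0 'b"
  by (simp add: scaleC_poly_mapping_def Poly_Mapping.map.rep_eq when_def)

instance
  by standard
     (rule poly_mapping_eqI,
      simp add: lookup_scaleC lookup_add scaleC_add_right scaleC_add_left scaleC_scaleC scaleC_one)+
end

text \<open>
  \<open>'x \<times> 'h \<Rightarrow>\<^sub>0 complex\<close> is the free complex vector space on the symbols
  \<open>x \<otimes> h\<close>. The form below is the sesquilinear extension of
  \<open>\<langle>x \<otimes> h, y \<otimes> k\<rangle> = \<langle>h, \<pi>(\<langle>x, y\<rangle>) k\<rangle>\<close>. The relations defining the algebraic tensor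
  product, and the balancing relations \<open>xb \<otimes> h = x \<otimes> \<pi>(b)h\<close>, are null vectors of this
  form, so its Hausdorff completion is the interior tensor product.
\<close>

definition tensor_form ::
    "('x \<Rightarrow> 'x \<Rightarrow> 'b) \<Rightarrow> ('b \<Rightarrow> 'h::chilbert_space \<Rightarrow> 'h) \<Rightarrow>
     ('x \<times> 'h \<Rightarrow>\<^sub>0 complex) \<Rightarrow> ('x \<times> 'h \<Rightarrow>\<^sub>0 complex) \<Rightarrow> complex" where
  "tensor_form ip \<pi> s t =
     (\<Sum>(x, h) \<in> Poly_Mapping.keys s. \<Sum>(y, k) \<in> Poly_Mapping.keys t.
        cnj (Poly_Mapping.lookup s (x, h)) * Poly_Mapping.lookup t (y, k) *
        cinner h (\<pi> (ip x y) k))"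

definition interior_tensor ::
    "('x \<Rightarrow> 'x \<Rightarrow> 'b) \<Rightarrow> ('b \<Rightarrow> 'h::chilbert_space \<Rightarrow> 'h) \<Rightarrow>
     (nat \<Rightarrow> 'x \<times> 'h \<Rightarrow>\<^sub>0 complex) set inner_space" where
  "interior_tensor ip \<pi> = completion (tensor_form ip \<pi>)"

text \<open>
  \<open>W \<otimes> H\<close> inside \<open>X \<otimes> H\<close>: the classes of Cauchy sequences of finite sums of
  symbols \<open>x \<otimes> h\<close> with \<open>x \<in> W\<close>.
\<close>

definition localised_submodule ::
    "('x \<Rightarrow> 'x \<Rightarrow> 'b) \<Rightarrow> ('b \<Rightarrow> 'h::chilbert_space \<Rightarrow> 'h) \<Rightarrow> 'x set \<Rightarrow>
     (nat \<Rightarrow> 'x \<times> 'h \<Rightarrow>\<^sub>0 complex) set set" where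
  "localised_submodule ip \<pi> W =
     {Z \<in> is_carrier (interior_tensor ip \<pi>).
        \<exists>z\<in>Z. \<forall>n. Poly_Mapping.keys (z n) \<subseteq> W \<times> UNIV}"

text \<open>
  The localised cosine with respect to \<open>\<pi>\<close>. Its value is the same for all faithful
  representations, and the Friedrichs angle of \<open>M\<close> and \<open>N\<close> is this common value.
\<close>

definition friedrichs_angle ::
    "('x \<Rightarrow> 'x \<Rightarrow> 'b) \<Rightarrow> ('b \<Rightarrow> 'h::chilbert_space \<Rightarrow> 'h) \<Rightarrow> 'x set \<Rightarrow> 'x set \<Rightarrow> real" where
  "friedrichs_angle ip \<pi> M N =
     (let K = interior_tensor ip \<pi>;
          M' = localised_submodule ip \<pi> M;
          N' = localised_submodule ip \<pi> N
      in op_norm K (\<lambda>u. is_diff K (orth_proj K M' (orth_proj K N' u))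
                                   (orth_proj K (M' \<inter> N') u)))"

end

(*
  Let P, Q be the projections onto M, N and T = (1 - P) Q. Then M + N is closed iff T has closed
  range. In that case T T* is self-adjoint and bounded below on ran T, hence invertible there,
  which yields a bounded self-adjoint J such that T* J T is a projection E; both Q - E, the
  projection onto the intersection of M and N, and the closedness of the sum of the orthogonal
  complements (ran T* = ran E) come out of this, and the bound |E f|^2 <= |J| |T f|^2 survives
  localisation and gives c(M, N) < 1.

  Conversely, c(M, N) = c < 1 makes the alternating products (P Q)^n converge geometrically on
  the localised space. A faithful representation is isometric, so (P Q)^n is uniformly Cauchy on
  X; the limit is the projection onto the intersection, and 1 - P is bounded below on the rest
  of N.

  No order theory or functional calculus is used: a self-adjoint y of norm at most 1 has a square
  root of 1 - y by iteration, and norm estimates come from the triangle inequality applied to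
  x + y and x - y when the cross terms of the inner product cancel.
*)
theory Submission
  imports Defs "HOL-Library.Function_Algebras"
begin

text \<open>The obstacle is that a closed submodule need not be complemented and a bounded module
  map need not have an adjoint. Projections on \<open>X\<close> are therefore never found by
  minimising distances; they are assembled from maps whose adjoints are explicit. This is why
  \<open>J\<close> is built on all of \<open>X\<close> although the inverse it encodes lives only on
  ran T.

  Localisation respects each single projection but not, a priori, intersections: the localisation of
  \<open>M \<inter> N\<close> could be smaller than the intersection of the two localisations, and
  the angle refers to the latter. A closed sum must therefore also yield that both agree, which
  again comes out of the bound on |E f|. In the converse the projection onto the localised
  intersection is not known to come from \<open>X\<close>; it serves only as an intermediate point
  between (P Q)^n and (P Q)^m, whose difference does live on \<open>X\<close>.

  Completed spaces are treated through Cauchy sequences and a seminorm; classes appear only where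
  the definitions force them to.\<close>

section \<open>Arithmetic of complex scalars\<close>

lemma scaleC_zero_left [simp]: "0 *\<^sub>C x = (0::'a::complex_vector)"
  using scaleC_add_left[of 0 0 x] by simp

lemma scaleC_minus_one [simp]: "(- 1) *\<^sub>C x = - (x::'a::complex_vector)"
  using scaleC_add_left[of "-1" 1 x] by (simp add: scaleC_one add_eq_0_iff2)

lemma scaleC_minus_left: "(- a) *\<^sub>C x = - (a *\<^sub>C (x::'a::complex_vector))"
  using scaleC_scaleC[of "-1" a x] by simp

lemma scaleC_minus_right: "a *\<^sub>C (- x) = - (a *\<^sub>C (x::'a::complex_vector))"
  using scaleC_scaleC[of a "-1" x] by (simp add: scaleC_minus_left scaleC_one)

lemma scaleC_diff_right: "a *\<^sub>C (x - y) = a *\<^sub>C x - a *\<^sub>C (y::'a::complex_vector)"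
  using scaleC_add_right[of a x "- y"] by (simp add: scaleC_minus_right)

lemma scaleC_sum_right: "a *\<^sub>C (\<Sum>i\<in>I. f i) = (\<Sum>i\<in>I. a *\<^sub>C (f i :: 'a::complex_vector))"
  by (induction I rule: infinite_finite_induct) (simp_all add: scaleC_add_right)

text \<open>Sequences become vectors under pointwise operations, so that Cauchy sequences can carry
  a semi-inner product themselves.\<close>

instantiation "fun" :: (type, complex_vector) complex_vector
begin
definition scaleC_fun :: "complex \<Rightarrow> ('a \<Rightarrow> 'b) \<Rightarrow> 'a \<Rightarrow> 'b" where
  "scaleC_fun c f = (\<lambda>x. c *\<^sub>C f x)"
instance
  by standard (simp_all add: scaleC_fun_def fun_eq_iff scaleC_add_right scaleC_add_left
      scaleC_scaleC scaleC_one)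
end

section \<open>Semi-inner product spaces\<close>

text \<open>Null vectors are allowed, since the tensor form has many. The carrier is a set because
  one instance lives on the Cauchy sequences, outside of which the limit form has no
  meaning.\<close>

locale semi_inner =
  fixes C :: "'v::complex_vector set" and S :: "'v \<Rightarrow> 'v \<Rightarrow> complex"
  assumes zero_closed: "0 \<in> C"
    and add_closed: "x \<in> C \<Longrightarrow> y \<in> C \<Longrightarrow> x + y \<in> C"
    and scale_closed: "x \<in> C \<Longrightarrow> c *\<^sub>C x \<in> C"
    and S_add_right: "x \<in> C \<Longrightarrow> y \<in> C \<Longrightarrow> z \<in> C \<Longrightarrow> S x (y + z) = S x y + S x z"
    and S_scale_right: "x \<in> C \<Longrightarrow> y \<in> C \<Longrightarrow> S x (c *\<^sub>C y) = c * S x y"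
    and S_commute: "x \<in> C \<Longrightarrow> y \<in> C \<Longrightarrow> S y x = cnj (S x y)"
    and S_nonneg: "x \<in> C \<Longrightarrow> 0 \<le> Re (S x x)"
begin

abbreviation nrm :: "'v \<Rightarrow> real" where "nrm \<equiv> seminorm_of S"

lemma minus_closed: "x \<in> C \<Longrightarrow> - x \<in> C"
  using scale_closed[of x "-1"] by simp

lemma diff_closed: "x \<in> C \<Longrightarrow> y \<in> C \<Longrightarrow> x - y \<in> C"
  using add_closed[of x "-y"] minus_closed[of y] by simp

lemma S_minus_right: "x \<in> C \<Longrightarrow> y \<in> C \<Longrightarrow> S x (- y) = - S x y"
  using S_scale_right[of x y "-1"] by simp

lemma S_diff_right: "x \<in> C \<Longrightarrow> y \<in> C \<Longrightarrow> z \<in> C \<Longrightarrow> S x (y - z) = S x y - S x z"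
  using S_add_right[of x y "-z"] by (simp add: S_minus_right minus_closed)

lemma S_add_left: "x \<in> C \<Longrightarrow> y \<in> C \<Longrightarrow> z \<in> C \<Longrightarrow> S (x + y) z = S x z + S y z"
  using S_commute[of z "x + y"] S_commute[of z x] S_commute[of z y]
  by (simp add: S_add_right add_closed)

lemma S_scale_left: "x \<in> C \<Longrightarrow> y \<in> C \<Longrightarrow> S (c *\<^sub>C x) y = cnj c * S x y"
  using S_commute[of y "c *\<^sub>C x"] S_commute[of y x]
  by (simp add: S_scale_right scale_closed)

lemma S_minus_left: "x \<in> C \<Longrightarrow> y \<in> C \<Longrightarrow> S (- x) y = - S x y"
  using S_scale_left[of x y "-1"] by simp

lemma S_diff_left: "x \<in> C \<Longrightarrow> y \<in> C \<Longrightarrow> z \<in> C \<Longrightarrow> S (x - y) z = S x z - S y z"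
  using S_add_left[of x "-y" z] by (simp add: S_minus_left minus_closed)

lemmas S_simps = S_add_right S_scale_right S_add_left S_scale_left S_diff_right S_diff_left
  add_closed diff_closed scale_closed

lemma S_self: "x \<in> C \<Longrightarrow> S x x = complex_of_real ((nrm x)\<^sup>2)"
  using S_commute[of x x] S_nonneg[of x]
  by (auto simp: seminorm_of_def complex_eq_iff)

lemma nrm_ge0 [simp]: "x \<in> C \<Longrightarrow> 0 \<le> nrm x"
  by (simp add: seminorm_of_def S_nonneg)

lemma nrm_sq: "x \<in> C \<Longrightarrow> (nrm x)\<^sup>2 = Re (S x x)"
  by (simp add: seminorm_of_def S_nonneg)

lemma nrm_scale: "x \<in> C \<Longrightarrow> nrm (c *\<^sub>C x) = cmod c * nrm x"
proof -
  assume x: "x \<in> C"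
  have "S (c *\<^sub>C x) (c *\<^sub>C x) = c * cnj c * S x x"
    using x by (simp add: S_simps)
  also have "\<dots> = complex_of_real ((cmod c * nrm x)\<^sup>2)"
    using x by (simp add: S_self power_mult_distrib complex_norm_square del: of_real_power)
  finally have "Re (S (c *\<^sub>C x) (c *\<^sub>C x)) = (cmod c * nrm x)\<^sup>2" by simp
  then have "(nrm (c *\<^sub>C x))\<^sup>2 = (cmod c * nrm x)\<^sup>2"
    using x by (simp add: nrm_sq scale_closed)
  then show ?thesis using x by (simp add: scale_closed)
qed

lemma nrm_minus: "x \<in> C \<Longrightarrow> nrm (- x) = nrm x"
  using nrm_scale[of x "-1"] by simp

lemma nrm_commute: "x \<in> C \<Longrightarrow> y \<in> C \<Longrightarrow> nrm (x - y) = nrm (y - x)"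
  using nrm_minus[of "x - y"] by (simp add: diff_closed)

lemma nrm_zero [simp]: "nrm 0 = 0"
  using nrm_scale[of 0 0] zero_closed by simp

lemma nrm_add_sq:
  assumes "x \<in> C" "y \<in> C"
  shows "(nrm (x + y))\<^sup>2 = (nrm x)\<^sup>2 + 2 * Re (S x y) + (nrm y)\<^sup>2"
  using assms S_commute[of x y] by (simp add: nrm_sq S_simps)

lemma cauchy_schwarz:
  assumes x: "x \<in> C" and y: "y \<in> C"
  shows "cmod (S x y) \<le> nrm x * nrm y"
proof (cases "S x y = 0")
  case True
  then show ?thesis using x y by simp
next
  case False
  define a where "a = S x y"
  \<comment> \<open>Positivity of |x - t conj(a) y|^2 for real t; the factor conj(a) makes the cross
    term real.\<close>
  have *: "0 \<le> (nrm x)\<^sup>2 - 2 * t * (cmod a)\<^sup>2 + t\<^sup>2 * (cmod a)\<^sup>2 * (nrm y)\<^sup>2" for t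
  proof -
    define c where "c = - (of_real t * cnj a)"
    have aa: "a * cnj a = of_real ((cmod a)\<^sup>2)" by (rule complex_norm_square [symmetric])
    have "0 \<le> (nrm (x + c *\<^sub>C y))\<^sup>2" by simp
    also have "\<dots> = (nrm x)\<^sup>2 + 2 * Re (c * a) + (cmod c * nrm y)\<^sup>2"
      using x y by (simp add: nrm_add_sq S_simps nrm_scale a_def)
    also have "c * a = - of_real (t * (cmod a)\<^sup>2)"
      using aa by (simp add: c_def mult.commute mult.left_commute)
    also have "cmod c = \<bar>t\<bar> * cmod a" by (simp add: c_def norm_mult)
    finally show ?thesis by (simp add: power_mult_distrib)
  qed
  have apos: "cmod a > 0" using False by (simp add: a_def)
  have "nrm y \<noteq> 0"
  proof
    assume "nrm y = 0"
    then have "0 \<le> (nrm x)\<^sup>2 - 2 * t * (cmod a)\<^sup>2" for t using *[of t] by simp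
    \<comment> \<open>For a null vector \<open>y\<close> the bound is affine in \<open>t\<close>,
      and this \<open>t\<close> makes it negative.\<close>
    from this[of "((nrm x)\<^sup>2 + 1) / (cmod a)\<^sup>2"]
    have "0 \<le> (nrm x)\<^sup>2 - 2 * (((nrm x)\<^sup>2 + 1) / (cmod a)\<^sup>2) * (cmod a)\<^sup>2" .
    also have "\<dots> = (nrm x)\<^sup>2 - 2 * ((nrm x)\<^sup>2 + 1)" using apos by simp
    finally have "0 \<le> (nrm x)\<^sup>2 - 2 * ((nrm x)\<^sup>2 + 1)" .
    then show False using zero_le_power2[of "nrm x"] by (simp add: algebra_simps del: zero_le_power2)
  qed
  then have ypos: "0 < (nrm y)\<^sup>2" using y by simp
  define t where "t = 1 / (nrm y)\<^sup>2"
  have t: "t * (nrm y)\<^sup>2 = 1" using ypos by (simp add: t_def)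
  have "0 \<le> (nrm x)\<^sup>2 - 2 * t * (cmod a)\<^sup>2 + t * (cmod a)\<^sup>2 * (t * (nrm y)\<^sup>2)"
    using *[of t] by (simp add: power2_eq_square[of t] mult_ac)
  then have "t * (cmod a)\<^sup>2 \<le> (nrm x)\<^sup>2" unfolding t by simp
  then have "(cmod a)\<^sup>2 / (nrm y)\<^sup>2 \<le> (nrm x)\<^sup>2" by (simp add: t_def)
  then have "(cmod a)\<^sup>2 \<le> (nrm x * nrm y)\<^sup>2"
    using ypos by (simp add: pos_divide_le_eq power_mult_distrib)
  then show ?thesis unfolding a_def by (rule power2_le_imp_le) (use x y in simp)
qed

lemma nrm_triangle:
  assumes x: "x \<in> C" and y: "y \<in> C"
  shows "nrm (x + y) \<le> nrm x + nrm y"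
proof (rule power2_le_imp_le)
  have "Re (S x y) \<le> nrm x * nrm y"
    using cauchy_schwarz[OF x y] complex_Re_le_cmod order_trans by blast
  then show "(nrm (x + y))\<^sup>2 \<le> (nrm x + nrm y)\<^sup>2"
    using x y by (simp add: nrm_add_sq power2_sum)
  show "0 \<le> nrm x + nrm y" using x y by simp
qed

lemma nrm_triangle_diff:
  assumes "x \<in> C" "y \<in> C"
  shows "nrm (x - y) \<le> nrm x + nrm y"
  using nrm_triangle[of x "-y"] assms by (simp add: minus_closed nrm_minus)

lemma nrm_triangle3:
  assumes "x \<in> C" "y \<in> C" "z \<in> C"
  shows "nrm (x - z) \<le> nrm (x - y) + nrm (y - z)"
  using nrm_triangle[of "x - y" "y - z"] assms by (simp add: diff_closed)

lemma nrm_diff_abs: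
  assumes "x \<in> C" "y \<in> C"
  shows "\<bar>nrm x - nrm y\<bar> \<le> nrm (x - y)"
  using nrm_triangle[of "x - y" y] nrm_triangle[of "y - x" x] nrm_commute[of x y] assms
  by (auto simp: diff_closed)

lemma nrm_sum:
  assumes "\<And>i. i \<in> I \<Longrightarrow> f i \<in> C"
  shows "nrm (\<Sum>i\<in>I. f i) \<le> (\<Sum>i\<in>I. nrm (f i)) \<and> (\<Sum>i\<in>I. f i) \<in> C"
  using assms
proof (induction I rule: infinite_finite_induct)
  case (insert a I)
  then have "nrm (f a + (\<Sum>i\<in>I. f i)) \<le> nrm (f a) + nrm (\<Sum>i\<in>I. f i)"
    by (intro nrm_triangle) auto
  moreover have "nrm (\<Sum>i\<in>I. f i) \<le> (\<Sum>i\<in>I. nrm (f i))" "(\<Sum>i\<in>I. f i) \<in> C"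
    using insert.IH insert.prems by auto
  moreover have "f a \<in> C" using insert.prems by simp
  ultimately show ?case using insert.hyps by (simp add: add_closed)
qed (simp_all add: zero_closed)

lemma nrm_eq_if_null:
  assumes "x \<in> C" "y \<in> C" "nrm (x - y) = 0"
  shows "nrm x = nrm y"
  using nrm_diff_abs[OF assms(1,2)] assms(3) by simp

lemma S_eq_if_null:
  assumes "x \<in> C" "y \<in> C" "w \<in> C" "nrm (x - y) = 0"
  shows "S w x = S w y" "S x w = S y w"
  using cauchy_schwarz[of w "x - y"] cauchy_schwarz[of "x - y" w] assms
  by (auto simp: S_simps)

lemma parallelogram:
  assumes "x \<in> C" "y \<in> C"
  shows "(nrm (x + y))\<^sup>2 + (nrm (x - y))\<^sup>2 = 2 * (nrm x)\<^sup>2 + 2 * (nrm y)\<^sup>2"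
  using assms by (simp add: nrm_sq S_simps)

text \<open>The classical argument with a minimising sequence, valid for a seminorm. Completeness
  and closedness are sequential hypotheses, so that it serves both for Hilbert spaces and for Cauchy
  sequences of the completion.\<close>

theorem projection_exists:
  assumes complete: "\<And>Z. (\<And>n. Z n \<in> C) \<Longrightarrow> \<forall>e>0. \<exists>n0. \<forall>m\<ge>n0. \<forall>n\<ge>n0. nrm (Z m - Z n) < e
              \<Longrightarrow> \<exists>z\<in>C. (\<lambda>n. nrm (Z n - z)) \<longlonglongrightarrow> 0"
    and V0: "0 \<in> V" and VC: "V \<subseteq> C"
    and Vadd: "\<And>x y. x \<in> V \<Longrightarrow> y \<in> V \<Longrightarrow> x + y \<in> V"
    and Vscale: "\<And>c x. x \<in> V \<Longrightarrow> c *\<^sub>C x \<in> V"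
    and Vclosed: "\<And>Z z. (\<And>n. Z n \<in> V) \<Longrightarrow> z \<in> C \<Longrightarrow> (\<lambda>n. nrm (Z n - z)) \<longlonglongrightarrow> 0 \<Longrightarrow> z \<in> V"
    and z: "z \<in> C"
  shows "\<exists>v\<in>V. \<forall>w\<in>V. S w (z - v) = 0"
proof -
  define d where "d = (INF v\<in>V. (nrm (z - v))\<^sup>2)"
  have bdd: "bdd_below ((\<lambda>v. (nrm (z - v))\<^sup>2) ` V)" by (rule bdd_belowI[of _ 0]) auto
  have dle: "d \<le> (nrm (z - v))\<^sup>2" if "v \<in> V" for v
    unfolding d_def by (rule cINF_lower[OF bdd that])
  have "\<exists>v\<in>V. (nrm (z - v))\<^sup>2 < d + inverse (real (Suc n))" for n
    using cINF_less_iff[OF _ bdd, of "d + inverse (real (Suc n))"] V0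
    by (auto simp: d_def)
  then obtain Z where ZV: "\<And>n. Z n \<in> V" and Zd: "\<And>n. (nrm (z - Z n))\<^sup>2 < d + inverse (real (Suc n))"
    by metis
  have ZC: "Z n \<in> C" for n using ZV VC by auto
  \<comment> \<open>Parallelogram law for \<open>z - Z n\<close> and \<open>z - Z m\<close>: their
    sum is twice the distance vector from \<open>z\<close> to the midpoint, which lies in
    \<open>V\<close>, so it contributes at least 4 d.\<close>
  have est: "(nrm (Z m - Z n))\<^sup>2 \<le> 2 * inverse (real (Suc m)) + 2 * inverse (real (Suc n))" for m n
  proof -
    have "(1/2) *\<^sub>C (Z m + Z n) \<in> V" using ZV Vadd Vscale by auto
    from dle[OF this] have "4 * d \<le> (2 * nrm (z - (1/2) *\<^sub>C (Z m + Z n)))\<^sup>2"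
      by (simp add: power_mult_distrib)
    also have "2 * nrm (z - (1/2) *\<^sub>C (Z m + Z n)) = nrm (2 *\<^sub>C (z - (1/2) *\<^sub>C (Z m + Z n)))"
      using z ZC by (subst nrm_scale) (auto simp: diff_closed add_closed scale_closed)
    also have "2 *\<^sub>C (z - (1/2) *\<^sub>C (Z m + Z n)) = (z - Z n) + (z - Z m)"
      using scaleC_add_left[of 1 1 z]
      by (simp add: scaleC_diff_right scaleC_scaleC scaleC_one)
    finally have "4 * d + (nrm ((z - Z n) - (z - Z m)))\<^sup>2 \<le> 2 * (nrm (z - Z n))\<^sup>2 + 2 * (nrm (z - Z m))\<^sup>2"
      using parallelogram[of "z - Z n" "z - Z m"] z ZC by (simp add: diff_closed)
    then show ?thesis using Zd[of m] Zd[of n] by simp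
  qed
  have "\<forall>e>0. \<exists>n0. \<forall>m\<ge>n0. \<forall>n\<ge>n0. nrm (Z m - Z n) < e"
  proof (intro allI impI)
    fix e :: real assume e: "e > 0"
    then have "e\<^sup>2 / 4 > 0" by simp
    then obtain N where N: "inverse (real (Suc N)) < e\<^sup>2 / 4" using reals_Archimedean by blast
    have "nrm (Z m - Z n) < e" if "m \<ge> N" "n \<ge> N" for m n
    proof (rule power2_less_imp_less)
      have "inverse (real (Suc m)) \<le> inverse (real (Suc N))"
        "inverse (real (Suc n)) \<le> inverse (real (Suc N))"
        using that by (auto simp: field_simps)
      then show "(nrm (Z m - Z n))\<^sup>2 < e\<^sup>2" using est[of m n] N by linarith
    qed (use e in simp)
    then show "\<exists>n0. \<forall>m\<ge>n0. \<forall>n\<ge>n0. nrm (Z m - Z n) < e" by blast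
  qed
  then obtain v where vC: "v \<in> C" and lim: "(\<lambda>n. nrm (Z n - v)) \<longlonglongrightarrow> 0"
    using complete ZC by blast
  have v: "v \<in> V" by (rule Vclosed[OF ZV vC lim])
  have "(nrm (z - v))\<^sup>2 \<le> d"
  proof -
    have "nrm (z - v) \<le> nrm (Z n - v) + sqrt (d + inverse (real (Suc n)))" for n
    proof -
      have "nrm (z - Z n) \<le> sqrt (d + inverse (real (Suc n)))"
        using Zd[of n] by (simp add: real_le_rsqrt)
      then show ?thesis using nrm_triangle3[of z "Z n" v] z ZC vC by simp
    qed
    moreover have "(\<lambda>n. nrm (Z n - v) + sqrt (d + inverse (real (Suc n)))) \<longlonglongrightarrow> 0 + sqrt (d + 0)"
      by (intro tendsto_intros lim LIMSEQ_inverse_real_of_nat)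
    ultimately have "nrm (z - v) \<le> sqrt d"
      by (intro LIMSEQ_le_const[of _ "sqrt d"]) auto
    moreover have "d \<ge> 0" unfolding d_def by (rule cINF_greatest) (use V0 in auto)
    ultimately show ?thesis using z vC
      by (metis diff_closed nrm_ge0 power_mono real_sqrt_pow2)
  qed
  then have min: "(nrm (z - v))\<^sup>2 \<le> (nrm (z - u))\<^sup>2" if "u \<in> V" for u
    using dle[OF that] by simp
  have "S w (z - v) = 0" if w: "w \<in> V" for w
  proof (rule ccontr)
    assume ne: "S w (z - v) \<noteq> 0"
    define a where "a = S (z - v) w"
    have wC: "w \<in> C" using w VC by auto
    have a0: "cmod a > 0" using ne S_commute[of w "z - v"] wC z vC by (simp add: a_def diff_closed)
    have "0 \<le> - 2 * t * (cmod a)\<^sup>2 + t\<^sup>2 * (cmod a)\<^sup>2 * (nrm w)\<^sup>2" for t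
    proof -
      define c where "c = - (of_real t * cnj a)"
      have aa: "a * cnj a = of_real ((cmod a)\<^sup>2)" by (rule complex_norm_square [symmetric])
      have "(nrm (z - v))\<^sup>2 \<le> (nrm (z - (v + (-c) *\<^sub>C w)))\<^sup>2"
        using w v by (intro min Vadd Vscale)
      also have "z - (v + (-c) *\<^sub>C w) = (z - v) + c *\<^sub>C w" by (simp add: scaleC_minus_left)
      also have "(nrm \<dots>)\<^sup>2 = (nrm (z - v))\<^sup>2 + 2 * Re (c * a) + (cmod c * nrm w)\<^sup>2"
        using z vC wC by (simp add: nrm_add_sq S_simps nrm_scale a_def)
      also have "c * a = - of_real (t * (cmod a)\<^sup>2)"
        using aa by (simp add: c_def mult.commute mult.left_commute)
      also have "cmod c = \<bar>t\<bar> * cmod a" by (simp add: c_def norm_mult)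
      finally show ?thesis by (simp add: power_mult_distrib)
    qed
    \<comment> \<open>The minimiser of the quadratic would be 1 / |w|^2; adding 1 in the denominator
      also covers a null vector \<open>w\<close> and still gives a negative value.\<close>
    from this[of "1 / ((nrm w)\<^sup>2 + 1)"]
    have "0 \<le> (cmod a)\<^sup>2 * (- 2 * (1 / ((nrm w)\<^sup>2 + 1)) + (1 / ((nrm w)\<^sup>2 + 1))\<^sup>2 * (nrm w)\<^sup>2)"
      by (simp add: algebra_simps)
    moreover have "- 2 * (1 / (q + 1)) + (1 / (q + 1))\<^sup>2 * q < 0" if "q \<ge> 0" for q :: real
    proof -
      define t where "t = 1 / (q + 1)"
      have t: "t > 0" "t * q = 1 - t" using that by (simp_all add: t_def field_simps)
      have "- 2 * t + t\<^sup>2 * q = t * (- 2 + t * q)" by (simp add: power2_eq_square algebra_simps)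
      also have "\<dots> < 0" unfolding t(2) using t(1) by (intro mult_pos_neg) auto
      finally show ?thesis by (simp add: t_def)
    qed
    from this[of "(nrm w)\<^sup>2"] have "- 2 * (1 / ((nrm w)\<^sup>2 + 1)) + (1 / ((nrm w)\<^sup>2 + 1))\<^sup>2 * (nrm w)\<^sup>2 < 0"
      by simp
    ultimately show False using a0 by (simp add: zero_le_mult_iff)
  qed
  then show ?thesis using v by blast
qed

end

section \<open>C*-algebras and their representations\<close>

text \<open>Stands in for monotonicity of the norm on positive elements: when the cross terms of
  \<open>a\<close> and \<open>b\<close> cancel, \<open>a + b\<close> and \<open>a - b\<close> have
  the same norm, and \<open>a\<close> is their average.\<close>

lemma norm_le_if_norm_add_eq_norm_diff:
  fixes a b :: "'a::real_normed_vector"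
  assumes "norm (a + b) = norm (a - b)"
  shows "norm a \<le> norm (a + b)"
proof -
  have "2 * norm a = norm ((a + b) + (a - b))" by (simp add: scaleR_2[symmetric])
  also have "\<dots> \<le> norm (a + b) + norm (a - b)" by (rule norm_triangle_ineq)
  finally show ?thesis using assms by simp
qed

section \<open>The involution and square roots in algebras without unit\<close>

lemma star_zero [simp]: "star 0 = (0::'b::cstar_algebra)"
  using star_add[of 0 "0::'b"] by simp

lemma star_minus: "star (- a) = - star (a::'b::cstar_algebra)"
  using star_add[of a "- a"] by (simp add: add_eq_0_iff2)

lemma star_diff: "star (a - b) = star a - star (b::'b::cstar_algebra)"
  using star_add[of a "- b"] by (simp add: star_minus)

lemma star_scaleR: "star (r *\<^sub>R a) = r *\<^sub>R star (a::'b::cstar_algebra)"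
  by (simp add: scaleC_of_real[symmetric] star_scaleC)

lemma norm_star: "norm (star a) = norm (a::'b::cstar_algebra)"
proof -
  have le: "norm a \<le> norm (star a)" for a :: 'b
  proof (cases "norm a = 0")
    case False
    have "norm a * norm a \<le> norm (star a) * norm a"
      using norm_mult_ineq[of "star a" a] by (simp add: norm_star_mult_self power2_eq_square)
    then show ?thesis using False by (simp add: mult_le_cancel_right)
  qed simp
  show ?thesis using le[of a] le[of "star a"] by (simp add: star_star)
qed

lemma bounded_linear_star: "bounded_linear (star :: 'b::cstar_algebra \<Rightarrow> 'b)"
  by (rule bounded_linear_intro[where K=1]) (simp_all add: star_add star_scaleR norm_star)

text \<open>Iterates the fixed point equation b = (y + b b) / 2, which says (1 - b)^2 = 1 - y. The
  unknown is \<open>b\<close> rather than 1 - b because there may be no unit.\<close>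

primrec sqrt_iter :: "'a::real_normed_algebra \<Rightarrow> nat \<Rightarrow> 'a" where
  "sqrt_iter y 0 = 0"
| "sqrt_iter y (Suc n) = (1/2) *\<^sub>R (y + sqrt_iter y n * sqrt_iter y n)"

lemma sqrt_iter_real:
  "0 \<le> sqrt_iter (1::real) n \<and> sqrt_iter (1::real) n \<le> 1 \<and>
   sqrt_iter (1::real) n \<le> sqrt_iter 1 (Suc n)"
proof (induction n)
  case (Suc n)
  let ?r = "sqrt_iter (1::real) n" and ?s = "sqrt_iter (1::real) (Suc n)"
  have s: "?s = (1 + ?r * ?r) / 2" by simp
  have "?r * ?r \<le> 1 * 1" using Suc by (intro mult_mono) auto
  then have s1: "?s \<le> 1" "0 \<le> ?s" using Suc s by auto
  have "?r * ?r \<le> ?s * ?s" using Suc s1 by (intro mult_mono) auto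
  then show ?case using s1 by (simp add: s)
qed simp

text \<open>The iterates are polynomials in \<open>y\<close> with nonnegative coefficients, so that the
  scalar case \<open>y = 1\<close> majorises all others; this gives convergence up to the boundary.\<close>

lemma sqrt_iter_majorised:
  fixes y :: "'a::real_normed_algebra"
  assumes y: "norm y \<le> 1"
  shows "norm (sqrt_iter y n) \<le> sqrt_iter 1 n \<and>
    norm (sqrt_iter y (Suc n) - sqrt_iter y n) \<le> sqrt_iter 1 (Suc n) - sqrt_iter 1 n"
proof (induction n)
  case 0
  then show ?case using y by simp
next
  case (Suc n)
  let ?a = "sqrt_iter y n" and ?b = "sqrt_iter y (Suc n)"
  let ?r = "sqrt_iter (1::real) n" and ?s = "sqrt_iter (1::real) (Suc n)"
  have r0: "0 \<le> ?r" "?r \<le> ?s" using sqrt_iter_real[of n] by auto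
  have IH: "norm ?a \<le> ?r" "norm (?b - ?a) \<le> ?s - ?r" using Suc by auto
  have b: "norm ?b \<le> ?s"
  proof -
    have "norm ?b \<le> norm (?b - ?a) + norm ?a" using norm_triangle_ineq[of "?b - ?a" ?a] by simp
    then show ?thesis using IH by linarith
  qed
  \<comment> \<open>The difference of squares is split in this order so that the two iterates need
    not commute.\<close>
  have "sqrt_iter y (Suc (Suc n)) - ?b = (1/2) *\<^sub>R (?b * (?b - ?a) + (?b - ?a) * ?a)"
    by (simp only: sqrt_iter.simps(2)[of y "Suc n"] sqrt_iter.simps(2)[of y n, symmetric])
       (simp add: algebra_simps)
  also have "norm \<dots> \<le> (norm ?b * norm (?b - ?a) + norm (?b - ?a) * norm ?a) / 2"
    using norm_triangle_ineq[of "?b * (?b - ?a)" "(?b - ?a) * ?a"]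
      norm_mult_ineq[of ?b "?b - ?a"] norm_mult_ineq[of "?b - ?a" ?a] by (simp del: sqrt_iter.simps)
  also have "\<dots> \<le> (?s * (?s - ?r) + (?s - ?r) * ?r) / 2"
    using b IH r0 by (intro divide_right_mono add_mono mult_mono) auto
  also have "\<dots> = (?s * ?s - ?r * ?r) / 2" by (simp add: algebra_simps del: sqrt_iter.simps)
  also have "\<dots> = sqrt_iter 1 (Suc (Suc n)) - ?s"
    by (simp only: sqrt_iter.simps(2)[of 1 "Suc n"] sqrt_iter.simps(2)[of 1 n, symmetric])
       (simp add: field_simps)
  finally show ?case using b by blast
qed

text \<open>Increments telescope, so every difference is dominated by the corresponding difference
  of the bounded increasing sequence for y = 1.\<close>

lemma sqrt_iter_Cauchy:
  fixes y :: "'a::real_normed_algebra"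
  assumes y: "norm y \<le> 1"
  shows "Cauchy (sqrt_iter y)"
proof -
  have mono: "incseq (sqrt_iter (1::real))" by (rule incseq_SucI) (use sqrt_iter_real in auto)
  have "convergent (sqrt_iter (1::real))"
  proof (rule Bseq_mono_convergent)
    show "Bseq (sqrt_iter (1::real))"
      by (rule BseqI'[of _ 1]) (simp add: sqrt_iter_real)
    show "\<forall>m. \<forall>n\<ge>m. sqrt_iter (1::real) m \<le> sqrt_iter 1 n"
      using mono by (simp add: incseq_def)
  qed
  then have cauchy: "Cauchy (sqrt_iter (1::real))" by (rule convergent_Cauchy)
  have le: "norm (sqrt_iter y (n + k) - sqrt_iter y n) \<le> sqrt_iter 1 (n + k) - sqrt_iter 1 n" for n k
  proof (induction k)
    case (Suc k)
    have "norm (sqrt_iter y (Suc (n + k)) - sqrt_iter y n)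
      \<le> norm (sqrt_iter y (Suc (n + k)) - sqrt_iter y (n + k)) + norm (sqrt_iter y (n + k) - sqrt_iter y n)"
      using norm_triangle_ineq[of "sqrt_iter y (Suc (n + k)) - sqrt_iter y (n + k)"
         "sqrt_iter y (n + k) - sqrt_iter y n"] by (simp del: sqrt_iter.simps)
    then show ?case using Suc sqrt_iter_majorised[OF y, of "n + k"]
      by (simp del: sqrt_iter.simps)
  qed simp
  show ?thesis
    unfolding Cauchy_altdef dist_norm
  proof (intro allI impI)
    fix e :: real assume "e > 0"
    then obtain M where M: "\<forall>m\<ge>M. \<forall>n>m. norm (sqrt_iter (1::real) m - sqrt_iter 1 n) < e"
      using cauchy unfolding Cauchy_altdef dist_norm by blast
    show "\<exists>M. \<forall>m\<ge>M. \<forall>n>m. norm (sqrt_iter y m - sqrt_iter y n) < e"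
    proof (intro exI allI impI)
      fix m n assume mn: "m \<ge> M" "n > m"
      then obtain k where k: "n = m + k" by (metis less_imp_add_positive)
      have "norm (sqrt_iter y m - sqrt_iter y n) \<le> sqrt_iter 1 n - sqrt_iter 1 m"
        using le[of m k] k by (simp add: norm_minus_commute)
      also have "\<dots> \<le> norm (sqrt_iter (1::real) m - sqrt_iter 1 n)" by simp
      also have "\<dots> < e" using M mn by blast
      finally show "norm (sqrt_iter y m - sqrt_iter y n) < e" .
    qed
  qed
qed

text \<open>The equation for \<open>b\<close> says (1 - b)^2 = 1 - y. Being self-adjoint and
  commuting with whatever commutes with \<open>y\<close> hold for each iterate and pass to the
  limit.\<close>

lemma sqrt_one_minus:
  fixes y :: "'b::cstar_algebra"
  assumes ys: "star y = y" and y: "norm y \<le> 1"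
  obtains b where "star b = b" "norm b \<le> 1" "b + b - b * b = y"
    "\<And>d. d * y = y * d \<Longrightarrow> d * b = b * d"
proof -
  obtain b where lim: "sqrt_iter y \<longlonglongrightarrow> b"
    using sqrt_iter_Cauchy[OF y] Cauchy_convergent_iff convergent_def by blast
  have "(\<lambda>n. star (sqrt_iter y n)) \<longlonglongrightarrow> star b"
    by (rule bounded_linear.tendsto[OF bounded_linear_star lim])
  moreover have "star (sqrt_iter y n) = sqrt_iter y n" for n
    by (induction n) (simp_all add: star_add star_scaleR star_mult ys)
  ultimately have "star b = b" using lim LIMSEQ_unique by simp
  moreover have "norm b \<le> 1"
    by (rule Lim_norm_ubound[OF _ lim])
       (auto intro!: always_eventually order_trans[OF conjunct1[OF sqrt_iter_majorised[OF y]]]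
          simp: sqrt_iter_real)
  moreover have "b + b - b * b = y"
  proof -
    have "(\<lambda>n. sqrt_iter y (Suc n)) \<longlonglongrightarrow> (1/2) *\<^sub>R (y + b * b)"
      unfolding sqrt_iter.simps by (intro tendsto_intros lim)
    then have "b = (1/2) *\<^sub>R (y + b * b)" using LIMSEQ_Suc[OF lim] LIMSEQ_unique by blast
    then have "2 *\<^sub>R b = 2 *\<^sub>R ((1/2) *\<^sub>R (y + b * b))" by simp
    then show ?thesis by (simp add: scaleR_2)
  qed
  moreover have "d * b = b * d" if d: "d * y = y * d" for d
  proof -
    have "d * sqrt_iter y n = sqrt_iter y n * d" for n
    proof (induction n)
      case (Suc n)
      have "d * (sqrt_iter y n * sqrt_iter y n) = sqrt_iter y n * sqrt_iter y n * d"
        using Suc by (metis mult.assoc)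
      then show ?case using d by (simp add: distrib_left distrib_right)
    qed simp
    moreover have "(\<lambda>n. d * sqrt_iter y n) \<longlonglongrightarrow> d * b" "(\<lambda>n. sqrt_iter y n * d) \<longlonglongrightarrow> b * d"
      by (intro tendsto_intros lim)+
    ultimately show ?thesis using LIMSEQ_unique by simp
  qed
  ultimately show thesis by (rule that)
qed

section \<open>Contractivity and isometry of representations\<close>

interpretation hilbert: semi_inner UNIV "cinner :: 'h::chilbert_space \<Rightarrow> 'h \<Rightarrow> complex"
  by standard (simp_all add: cinner_add_right cinner_scaleC_right cinner_self, rule cinner_commute)

lemma seminorm_of_cinner [simp]: "seminorm_of cinner h = norm h"
  by (simp add: seminorm_of_def cinner_self)

lemmas cinner_simps = hilbert.S_simps(1-6)[simplified]

lemma cinner_zero_right: "cinner h 0 = 0"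
  using hilbert.S_scale_right[of h 0 0] by simp

lemma cinner_eq_norm_sq: "Re (cinner h h) = (norm h)\<^sup>2"
  by (simp add: cinner_self)

lemma cinner_Re_le: "Re (cinner h k) \<le> norm h * norm k"
  using hilbert.cauchy_schwarz[of h k] complex_Re_le_cmod[of "cinner h k"] by simp

locale cstar_representation =
  fixes \<pi> :: "'b::cstar_algebra \<Rightarrow> 'h::chilbert_space \<Rightarrow> 'h"
  assumes rep: "representation \<pi>"
begin

lemma rep_linear: "bounded_linear (\<pi> b)"
  and rep_scale_right: "\<pi> b (c *\<^sub>C h) = c *\<^sub>C \<pi> b h"
  and rep_add_left: "\<pi> (a + b) h = \<pi> a h + \<pi> b h"
  and rep_scale_left: "\<pi> (c *\<^sub>C b) h = c *\<^sub>C \<pi> b h"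
  and rep_mult: "\<pi> (a * b) h = \<pi> a (\<pi> b h)"
  and rep_star: "cinner (\<pi> (star b) h) k = cinner h (\<pi> b k)"
  using rep by (simp_all add: representation_def)

lemma rep_add_right: "\<pi> b (h + k) = \<pi> b h + \<pi> b k"
  by (rule bounded_linear.linear[OF rep_linear, THEN linear_add])

lemma rep_diff_right: "\<pi> b (h - k) = \<pi> b h - \<pi> b k"
  by (rule bounded_linear.linear[OF rep_linear, THEN linear_diff])

lemma rep_zero_right [simp]: "\<pi> b 0 = 0"
  by (rule bounded_linear.linear[OF rep_linear, THEN linear_0])

lemma rep_zero_left [simp]: "\<pi> 0 h = 0"
  using rep_add_left[of 0 0 h] by simp

lemma rep_minus_left: "\<pi> (- a) h = - \<pi> a h"
  using rep_add_left[of a "- a" h] by (simp add: add_eq_0_iff2)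

lemma rep_diff_left: "\<pi> (a - b) h = \<pi> a h - \<pi> b h"
  using rep_add_left[of a "- b" h] by (simp add: rep_minus_left)

lemma rep_scaleR_left: "\<pi> (r *\<^sub>R a) h = r *\<^sub>R \<pi> a h"
  by (simp add: scaleC_of_real[symmetric] rep_scale_left)

lemma rep_norm_sq: "(norm (\<pi> b h))\<^sup>2 = Re (cinner h (\<pi> (star b * b) h))"
  using rep_star[of "star b" h "\<pi> b h"]
  by (simp add: star_star rep_mult cinner_eq_norm_sq[symmetric])

text \<open>For c = b / |b| the square root gives 1 - c* c = (1 - e)^2 with \<open>e\<close>
  self-adjoint, hence |h|^2 - |\<pi>(c) h|^2 = |h - \<pi>(e) h|^2, which is nonnegative.\<close>

theorem rep_contractive: "norm (\<pi> b h) \<le> norm b * norm h"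
proof (cases "b = 0")
  case False
  define c where "c = (1 / norm b) *\<^sub>R b"
  have c1: "norm c = 1" using False by (simp add: c_def)
  have ss: "star (star c * c) = star c * c" by (simp add: star_mult star_star)
  have n1: "norm (star c * c) \<le> 1" by (simp add: norm_star_mult_self c1)
  obtain e where e: "star e = e" "e + e - e * e = star c * c"
    using sqrt_one_minus[OF ss n1] by metis
  have "0 \<le> Re (cinner (h - \<pi> e h) (h - \<pi> e h))"
    by (rule hilbert.S_nonneg) simp
  also have "\<dots> = Re (cinner h h) - Re (cinner h (\<pi> (e + e - e * e) h))"
    using rep_star[of e h h] rep_star[of e h "\<pi> e h"] e(1)
    by (simp add: cinner_simps rep_diff_left rep_add_left rep_mult)
  also have "\<dots> = (norm h)\<^sup>2 - (norm (\<pi> c h))\<^sup>2"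
    unfolding e(2) rep_norm_sq cinner_eq_norm_sq ..
  finally have "(norm (\<pi> c h))\<^sup>2 \<le> (norm h)\<^sup>2" by linarith
  then have "norm (\<pi> c h) \<le> norm h" by (rule power2_le_imp_le) simp
  then have "norm (\<pi> b h) / norm b \<le> norm h" using False by (simp add: c_def rep_scaleR_left)
  then show ?thesis using False by (simp add: pos_divide_le_eq mult.commute)
qed simp

text \<open>Put a = c^2 and y = 2 a - a^2, so that 1 - a is one square root of 1 - y. The iteration
  supplies another root 1 - b with |b| at most 1. Faithfulness forces a = b, which bounds |a|. The
  hypothesis on |c|^2 places \<open>a\<close> between 0 and 2, the range in which |y| is at most
  1.\<close>

lemma rep_norm_le_one_aux:
  assumes inj: "inj \<pi>" and cs: "star c = c" and c2: "(norm c)\<^sup>2 \<le> 2"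
    and le: "\<And>h. norm (\<pi> c h) \<le> norm h"
  shows "norm c \<le> 1"
proof -
  define a where "a = c * c"
  have as: "star a = a" by (simp add: a_def star_mult cs)
  have na: "norm a = (norm c)\<^sup>2" using norm_star_mult_self[of c] by (simp add: a_def cs)
  define y where "y = a + a - a * a"
  have ys: "star y = y" by (simp add: y_def star_add star_diff star_mult as)
  have y1: "norm y \<le> 1"
  proof -
    have "star ((1/2) *\<^sub>R a) = (1/2) *\<^sub>R a" by (simp add: star_scaleR as)
    moreover have "norm ((1/2) *\<^sub>R a) \<le> 1" using na c2 by simp
    ultimately obtain b where b: "star b = b" "b + b - b * b = (1/2) *\<^sub>R a"
      "\<And>d. d * ((1/2) *\<^sub>R a) = ((1/2) *\<^sub>R a) * d \<Longrightarrow> d * b = b * d"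
      using sqrt_one_minus by metis
    have cb: "c * b = b * c" by (rule b(3)) (simp add: a_def mult.assoc)
    \<comment> \<open>With (1 - b)^2 = 1 - a / 2 and \<open>b\<close> commuting with
      \<open>c\<close>, the square of \<open>w\<close> is 2 c^2 (1 - a / 2) = y.\<close>
    define w where "w = sqrt 2 *\<^sub>R (c - c * b)"
    have ws: "star w = w" by (simp add: w_def star_scaleR star_diff star_mult cs b(1) cb)
    have rb: "b * c = c * b" "b * (c * t) = c * (b * t)" for t
      by (simp_all add: cb mult.assoc[symmetric])
    have "(c - c * b) * (c - c * b) = c * c - c * (c * (b + b - b * b))"
      by (simp add: algebra_simps rb)
    also have "\<dots> = a - (1/2) *\<^sub>R (a * a)" by (simp add: b(2)) (simp add: a_def mult.assoc)
    finally have "2 *\<^sub>R ((c - c * b) * (c - c * b)) = y"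
      by (simp add: y_def scaleR_diff_right scaleR_2)
    then have ww: "w * w = y" by (simp add: w_def del: scaleR_left_diff_distrib scaleR_right_diff_distrib)
    have aw: "a * w = w * a"
      by (simp add: w_def a_def algebra_simps rb)
    have wx: "norm (w * x) \<le> norm x" for x
    proof -
      \<comment> \<open>Here \<open>z\<close> is (1 - a) x, and (1 - a)^2 + w^2 = 1, so the squares
        of \<open>z\<close> and \<open>v\<close> add up to that of \<open>x\<close>. The factor i in
        \<open>v\<close> cancels the cross terms, because \<open>a\<close> and \<open>w\<close> are
        self-adjoint and commute.\<close>
      define z where "z = x - a * x"
      define v where "v = \<i> *\<^sub>C (w * x)"
      have sz: "star z = star x - star x * a" by (simp add: z_def star_diff star_mult as)
      have sv: "star v = - (\<i> *\<^sub>C (star x * w))" by (simp add: v_def star_scaleC star_mult ws scaleC_minus_left)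
      have zv: "star z * v + star v * z = 0"
      proof -
        have "star z * (w * x) = star x * w * z"
        proof -
          have "star x * a * (w * x) = star x * (a * w) * x" by (simp add: mult.assoc)
          also have "\<dots> = star x * w * (a * x)" by (simp add: aw mult.assoc)
          finally show ?thesis
            by (simp only: sz) (simp add: z_def left_diff_distrib right_diff_distrib mult.assoc)
        qed
        then show ?thesis
          by (simp add: sv) (simp add: v_def mult_scaleC_left mult_scaleC_right)
      qed
      have vv: "star v * v = star x * y * x"
        by (simp add: sv) (simp add: v_def mult_scaleC_left mult_scaleC_right scaleC_scaleC
            scaleC_minus_left scaleC_one ww[symmetric] mult.assoc)
      have zz: "star z * z + star v * v = star x * x"
        unfolding vv by (simp add: sz) (simp add: z_def y_def algebra_simps)
      have "star (z + v) * (z + v) = (star z * z + star v * v) + (star z * v + star v * z)"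
        by (simp add: star_add algebra_simps)
      then have "star (z + v) * (z + v) = star x * x" by (simp add: zv zz)
      then have 1: "(norm (z + v))\<^sup>2 = (norm x)\<^sup>2" by (metis norm_star_mult_self)
      have "star (z - v) * (z - v) = (star z * z + star v * v) - (star z * v + star v * z)"
        by (simp add: star_diff algebra_simps)
      then have "star (z - v) * (z - v) = star x * x" by (simp add: zv zz)
      then have 2: "(norm (z - v))\<^sup>2 = (norm x)\<^sup>2" by (metis norm_star_mult_self)
      have "norm (v + z) = norm (v - z)" "norm (v + z) = norm x" using 1 2
        by (simp_all add: add.commute norm_minus_commute)
      then have "norm v \<le> norm x" using norm_le_if_norm_add_eq_norm_diff[of v z] by simp
      then show ?thesis by (simp add: v_def norm_scaleC)
    qed
    have "norm w * norm w \<le> 1 * norm w" using wx[of w] norm_star_mult_self[of w]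
      by (simp add: ws power2_eq_square)
    then have "norm w \<le> 1" by (metis mult_le_cancel_right norm_eq_zero norm_ge_zero not_le zero_le_one order.trans)
    then show ?thesis using norm_star_mult_self[of w] ws ww
      by (simp add: power_le_one)
  qed
  obtain b where b: "star b = b" "norm b \<le> 1" "b + b - b * b = y"
    "\<And>d. d * y = y * d \<Longrightarrow> d * b = b * d"
    using sqrt_one_minus[OF ys y1] by metis
  have ab: "a * b = b * a" by (rule b(4)) (simp add: y_def algebra_simps)
  \<comment> \<open>Both \<open>1 - a\<close> and \<open>1 - b\<close> are square roots of \<open>1 - y\<close>, and both are positive in the
    representation, hence equal there.\<close>
  define d where "d = b - a"
  have ds: "star d = d" by (simp add: d_def star_diff as b(1))
  \<comment> \<open>This is the difference of the two expressions for \<open>y\<close>, factored as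
    (2 - b - a) (b - a) = 0.\<close>
  have dd: "d + d - b * d - a * d = 0"
    using b(3) ab by (simp add: d_def y_def algebra_simps)
  have "\<pi> d h = 0" for h
  proof -
    define v where "v = \<pi> d h"
    have bv: "norm (\<pi> b v) \<le> norm v"
      using rep_contractive[of b v] b(2) mult_right_mono[OF b(2), of "norm v"] by simp
    have av: "norm (\<pi> a v) \<le> norm v"
      using le[of v] le[of "\<pi> c v"] by (simp add: a_def rep_mult)
    have "v + v - \<pi> b v - \<pi> a v = \<pi> (d + d - b * d - a * d) h"
      by (simp add: v_def rep_add_left rep_diff_left rep_mult)
    then have "v + v - \<pi> b v - \<pi> a v = 0" by (simp add: dd)
    then have s0: "\<pi> b v = (v - \<pi> a v) + v" by (simp add: algebra_simps)
    have "2 * (norm v)\<^sup>2 - Re (cinner v (\<pi> b v)) - Re (cinner v (\<pi> a v)) = 0"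
      by (simp add: s0 cinner_simps cinner_eq_norm_sq)
    moreover have "Re (cinner v (\<pi> b v)) \<le> (norm v)\<^sup>2" "Re (cinner v (\<pi> a v)) \<le> (norm v)\<^sup>2"
      using cinner_Re_le[of v "\<pi> b v"] cinner_Re_le[of v "\<pi> a v"]
        mult_left_mono[OF bv, of "norm v"] mult_left_mono[OF av, of "norm v"]
      by (simp_all add: power2_eq_square)
    \<comment> \<open>Two numbers of size at most |v|^2 add up to 2 |v|^2, so each attains its
      bound; equality in Cauchy-Schwarz then makes \<open>v\<close> a fixed vector of \<pi>(a), and
      by \<open>s0\<close> also of \<pi>(b).\<close>
    ultimately have eq: "Re (cinner v (\<pi> a v)) = (norm v)\<^sup>2" by linarith
    have "(norm (v - \<pi> a v))\<^sup>2 = (norm v)\<^sup>2 - 2 * Re (cinner v (\<pi> a v)) + (norm (\<pi> a v))\<^sup>2"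
      using hilbert.nrm_add_sq[of v "- \<pi> a v"] by (simp add: hilbert.S_minus_right)
    also have "\<dots> \<le> 0" using eq av by (simp add: power_mono)
    finally have "\<pi> a v = v" by simp
    with s0 have "\<pi> d v = 0" by (simp add: d_def rep_diff_left)
    moreover have "(norm (\<pi> d h))\<^sup>2 = Re (cinner h (\<pi> d v))"
      unfolding rep_norm_sq by (simp add: ds rep_mult v_def)
    ultimately show ?thesis by (simp add: cinner_zero_right)
  qed
  then have "\<pi> d = \<pi> 0" by auto
  then have "d = 0" using inj by (simp add: inj_eq)
  then have "(norm c)\<^sup>2 \<le> 1" using na b(2) by (simp add: d_def)
  then show ?thesis by (simp add: power2_le_imp_le abs_square_le_1)
qed

text \<open>An element too large for the auxiliary bound is scaled down to norm
  \<open>sqrt 2\<close>. Scaling by a factor at most 1 keeps its image contractive, and the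
  auxiliary bound is then contradicted.\<close>

lemma rep_norm_le_one:
  assumes inj: "inj \<pi>" and cs: "star c = c" and le: "\<And>h. norm (\<pi> c h) \<le> norm h"
  shows "norm c \<le> 1"
proof (rule ccontr)
  assume n: "\<not> norm c \<le> 1"
  then have n0: "norm c > 1" by simp
  show False
  proof (cases "norm c \<le> sqrt 2")
    case True
    then have "(norm c)\<^sup>2 \<le> 2" by (simp add: sqrt_ge_absD)
    then show False using rep_norm_le_one_aux[OF inj cs _ le] n by simp
  next
    case False
    define t where "t = sqrt 2 / norm c"
    have cpos: "0 < norm c" "sqrt 2 \<le> norm c" using False n0 by linarith+
    have t: "0 \<le> t" "t \<le> 1" "t * norm c = sqrt 2"
      using cpos by (simp_all add: t_def divide_le_eq_1_pos del: norm_eq_zero zero_less_norm_iff)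
    have "norm (\<pi> (t *\<^sub>R c) h) \<le> norm h" for h
    proof -
      have "norm (\<pi> (t *\<^sub>R c) h) = t * norm (\<pi> c h)" using t(1) by (simp add: rep_scaleR_left)
      also have "\<dots> \<le> 1 * norm h" using t le[of h] by (intro mult_mono) auto
      finally show ?thesis by simp
    qed
    moreover have "norm (t *\<^sub>R c) = sqrt 2" using t by simp
    ultimately have "sqrt 2 \<le> (1::real)"
      using rep_norm_le_one_aux[OF inj, of "t *\<^sub>R c"] cs by (simp add: star_scaleR)
    then show False by simp
  qed
qed

theorem rep_norm_le_if_positive:
  assumes inj: "inj \<pi>" and k: "0 \<le> k" and pos: "cstar_positive a"
    and le: "\<And>h. Re (cinner h (\<pi> a h)) \<le> (k * norm h)\<^sup>2"
  shows "norm a \<le> k\<^sup>2"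
proof -
  obtain e where e: "a = star e * e" using pos by (auto simp: cstar_positive_def)
  have eh: "norm (\<pi> e h) \<le> k * norm h" for h
  proof (rule power2_le_imp_le)
    show "(norm (\<pi> e h))\<^sup>2 \<le> (k * norm h)\<^sup>2"
      unfolding rep_norm_sq using le[of h] by (simp only: e)
  qed (use k in simp)
  show ?thesis
  proof (cases "k = 0")
    case True
    then have "\<pi> e = \<pi> 0" using eh by auto
    then show ?thesis using inj by (simp add: inj_eq e)
  next
    case False
    then have k0: "k > 0" using k by simp
    \<comment> \<open>The usual norm equality of an operator and its adjoint: |e* h|^2 = <h, e e*
      h>, which is at most |h| k |e* h|.\<close>
    have sh: "norm (\<pi> (star e) h) \<le> k * norm h" for h
    proof (cases "\<pi> (star e) h = 0")
      case True
      then show ?thesis using k by simp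
    next
      case False
      let ?g = "\<pi> (star e) h"
      have "norm ?g * norm ?g = Re (cinner h (\<pi> e ?g))"
        using rep_norm_sq[of "star e" h] unfolding power2_eq_square by (simp only: star_star rep_mult)
      also have "\<dots> \<le> norm h * (k * norm ?g)"
        using cinner_Re_le[of h "\<pi> e ?g"] mult_left_mono[OF eh[of ?g], of "norm h"] by simp
      finally have "norm ?g * norm ?g \<le> (k * norm h) * norm ?g" by (simp add: mult_ac)
      then show ?thesis using False by (simp add: mult_le_cancel_right)
    qed
    have "norm ((1 / k\<^sup>2) *\<^sub>R a) \<le> 1"
    proof (rule rep_norm_le_one[OF inj])
      show "star ((1 / k\<^sup>2) *\<^sub>R a) = (1 / k\<^sup>2) *\<^sub>R a" by (simp add: star_scaleR e star_mult star_star)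
      show "norm (\<pi> ((1 / k\<^sup>2) *\<^sub>R a) h) \<le> norm h" for h
      proof -
        have "norm (\<pi> a h) \<le> k * (k * norm h)"
          using sh[of "\<pi> e h"] mult_left_mono[OF eh[of h], of k] k by (simp add: e rep_mult)
        then show ?thesis using k0 by (simp add: rep_scaleR_left field_simps power2_eq_square)
      qed
    qed
    then show ?thesis using k0 by (simp add: field_simps)
  qed
qed

end

section \<open>Bounded linear maps with closed range\<close>

text \<open>The category half of the open mapping theorem. The range is not a type, so Baire's
  theorem is applied to its subspace topology, which is completely metrizable because the range is
  closed.\<close>

lemma approx_preimage_if_closed_range:
  fixes f :: "'a::banach \<Rightarrow> 'b::banach"
  assumes f: "bounded_linear f" and cl: "closed (range f)"
  obtains K where "K > 0"
    "\<And>y e. y \<in> range f \<Longrightarrow> e > 0 \<Longrightarrow> \<exists>x. norm x \<le> K * norm y \<and> norm (y - f x) < e"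
proof -
  interpret f: bounded_linear f by (rule f)
  define V where "V = range f"
  define F where "F n = V \<inter> closure (f ` ball 0 (real n))" for n
  have "\<exists>n. top_of_set V interior_of F n \<noteq> {}"
  proof (rule ccontr)
    assume "\<not> ?thesis"
    then have emp: "top_of_set V interior_of F n = {}" for n by blast
    have "top_of_set V interior_of \<Union>(range F) = {}"
    proof (rule Baire_category_alt)
      show "completely_metrizable_space (top_of_set V) \<or>
        locally_compact_space (top_of_set V) \<and> regular_space (top_of_set V)"
        using cl completely_metrizable_space_closedin[OF completely_metrizable_space_euclidean]
        by (auto simp: V_def)
      show "closedin (top_of_set V) T \<and> top_of_set V interior_of T = {}" if "T \<in> range F" for T
        using that emp by (auto simp: F_def intro!: closedin_closed_Int)
    qed simp
    moreover have "\<Union>(range F) = V"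
    proof -
      have "y \<in> \<Union>(range F)" if y: "y \<in> V" for y
      proof -
        obtain x where x: "y = f x" using y by (auto simp: V_def)
        obtain n where "norm x < real n" using reals_Archimedean2 by blast
        then have "y \<in> f ` ball 0 (real n)" by (auto simp: x)
        then show ?thesis using y closure_subset by (force simp: F_def)
      qed
      then show ?thesis by (auto simp: F_def)
    qed
    moreover have "top_of_set V interior_of V = V" by (simp add: interior_of_openin)
    moreover have "f 0 \<in> V" unfolding V_def by (rule rangeI)
    ultimately show False by auto
  qed
  then obtain n y0 where "y0 \<in> top_of_set V interior_of F n" by auto
  then obtain U where U: "openin (top_of_set V) U" "y0 \<in> U" "U \<subseteq> F n"
    by (auto simp: interior_of_def)
  then obtain r where r: "r > 0" "ball y0 r \<inter> V \<subseteq> F n" and y0: "y0 \<in> V"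
    unfolding openin_contains_ball by (metis subset_trans in_mono)
  have approx: "\<exists>x. norm x < real n \<and> norm (y - f x) < e" if "y \<in> F n" "e > 0" for y e
  proof -
    from that have "y \<in> closure (f ` ball 0 (real n))" by (simp add: F_def)
    then obtain z where "z \<in> f ` ball 0 (real n)" "dist z y < e"
      using \<open>e > 0\<close> unfolding closure_approachable by blast
    then show ?thesis by (auto simp: dist_norm norm_minus_commute)
  qed
  \<comment> \<open>The ball found by Baire is centred at \<open>y0\<close>; subtracting approximate
    preimages of \<open>y0 + y\<close> and \<open>y0\<close> moves it to the origin at the price of
    a factor 2.\<close>
  have small: "\<exists>x. norm x \<le> 2 * real n \<and> norm (y - f x) < e"
    if yV: "y \<in> V" and yr: "norm y < r" and e: "e > 0" for y e
  proof -
    have "y0 + y \<in> V"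
      using y0 yV by (auto simp: V_def image_iff intro: f.add[symmetric])
    then have "y0 + y \<in> F n" using r yr by (auto simp: dist_norm)
    moreover have "y0 \<in> F n" using r y0 by auto
    ultimately obtain x1 x2 where x: "norm x1 < real n" "norm (y0 + y - f x1) < e / 2"
      "norm x2 < real n" "norm (y0 - f x2) < e / 2"
      using approx[of "y0 + y" "e/2"] approx[of y0 "e/2"] e by auto
    have "y - f (x1 - x2) = (y0 + y - f x1) - (y0 - f x2)" by (simp add: f.diff)
    then have "norm (y - f (x1 - x2)) \<le> norm (y0 + y - f x1) + norm (y0 - f x2)"
      by (simp only: norm_triangle_ineq4)
    then have "norm (y - f (x1 - x2)) < e" using x by simp
    moreover have "norm (x1 - x2) \<le> 2 * real n"
      using x norm_triangle_ineq4[of x1 x2] by simp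
    ultimately show ?thesis by blast
  qed
  \<comment> \<open>Scaling \<open>y\<close> to norm r / 2 and back turns the bound 2 n into 4 n / r
    times |y|; the summand 1 makes \<open>K\<close> positive without a case distinction on
    \<open>n\<close>.\<close>
  define K where "K = 4 * real n / r + 1"
  have K: "K > 0" using r by (simp add: K_def add_nonneg_pos)
  have main: "\<exists>x. norm x \<le> K * norm y \<and> norm (y - f x) < e" if y: "y \<in> range f" and e: "e > 0" for y e
  proof (cases "y = 0")
    case True
    then show ?thesis using e by (intro exI[of _ 0]) (simp add: f.zero)
  next
    case False
    define t where "t = r / (2 * norm y)"
    have t: "t > 0" using r False by (simp add: t_def)
    have tn: "norm (t *\<^sub>R y) < r" using r False by (simp add: t_def)
    have tV: "t *\<^sub>R y \<in> V" using y by (auto simp: V_def image_iff intro: f.scaleR[symmetric])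
    obtain x where x: "norm x \<le> 2 * real n" "norm (t *\<^sub>R y - f x) < t * e"
      using small[OF tV tn, of "t * e"] t e by auto
    have "y - f ((1/t) *\<^sub>R x) = (1/t) *\<^sub>R (t *\<^sub>R y - f x)"
      using t by (simp add: f.scaleR scaleR_diff_right)
    then have "norm (y - f ((1/t) *\<^sub>R x)) < e" using x(2) t by (simp add: pos_divide_less_eq mult.commute)
    moreover have "norm ((1/t) *\<^sub>R x) \<le> K * norm y"
    proof -
      have "norm ((1/t) *\<^sub>R x) \<le> (1/t) * (2 * real n)" using x(1) t by (simp add: divide_right_mono)
      also have "\<dots> = (4 * real n / r) * norm y" using r by (simp add: t_def field_simps)
      also have "\<dots> \<le> K * norm y" by (simp add: K_def distrib_right)
      finally show ?thesis .
    qed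
    ultimately show ?thesis by blast
  qed
  show thesis using that[OF K] main by blast
qed

text \<open>Successive approximation: each approximate preimage leaves a residue of at most half the
  previous bound, and the corrections form a geometric series, whence the constant 2 K.\<close>

theorem open_mapping_closed_range:
  fixes f :: "'a::banach \<Rightarrow> 'b::banach"
  assumes f: "bounded_linear f" and cl: "closed (range f)"
  shows "\<exists>K>0. \<forall>y\<in>range f. \<exists>x. f x = y \<and> norm x \<le> K * norm y"
proof -
  interpret f: bounded_linear f by (rule f)
  obtain K where K: "K > 0"
    and ap: "\<And>y e. y \<in> range f \<Longrightarrow> e > 0 \<Longrightarrow> \<exists>x. norm x \<le> K * norm y \<and> norm (y - f x) < e"
    using approx_preimage_if_closed_range[OF f cl] by metis
  have "\<exists>x. f x = y \<and> norm x \<le> (2 * K) * norm y" if y: "y \<in> range f" for y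
  proof (cases "y = 0")
    case True
    then show ?thesis by (intro exI[of _ 0]) (simp add: f.zero)
  next
    case False
    define g where "g z e = (SOME x. norm x \<le> K * norm z \<and> norm (z - f x) < e)" for z e
    have g: "norm (g z e) \<le> K * norm z \<and> norm (z - f (g z e)) < e" if "z \<in> range f" "e > 0" for z e
      unfolding g_def by (rule someI_ex[OF ap[OF that]])
    \<comment> \<open>The tolerance at stage k bounds the residue of stage k + 1, hence the exponent
      \<open>Suc k\<close>.\<close>
    define e where "e k = norm y * (1/2) ^ Suc k" for k
    define u where "u = rec_nat y (\<lambda>k z. z - f (g z (e k)))"
    have u: "u 0 = y" "u (Suc k) = u k - f (g (u k) (e k))" for k by (simp_all add: u_def)
    have e: "e k > 0" for k using False by (simp add: e_def)
    have ur: "u k \<in> range f" for k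
    proof (induction k)
      case (Suc k)
      then obtain w where "u k = f w" by auto
      then show ?case by (simp add: u f.diff[symmetric])
    qed (simp add: u y)
    have un: "norm (u k) \<le> norm y * (1/2) ^ k" for k
    proof (cases k)
      case (Suc m)
      then show ?thesis using g[OF ur e, of m m] by (simp add: u e_def)
    qed (simp add: u)
    define x where "x k = g (u k) (e k)" for k
    have xn: "norm (x k) \<le> (K * norm y) * (1/2) ^ k" for k
    proof -
      have "norm (x k) \<le> K * norm (u k)" unfolding x_def using g[OF ur e] by blast
      also have "\<dots> \<le> K * (norm y * (1/2) ^ k)" using un K by (intro mult_left_mono) auto
      finally show ?thesis by (simp add: mult.assoc)
    qed
    have sgeo: "summable (\<lambda>k. (K * norm y) * (1/2::real) ^ k)"
      by (intro summable_mult summable_geometric) simp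
    have sx: "summable (\<lambda>k. norm (x k))"
      by (rule summable_comparison_test'[OF sgeo, of 0]) (use xn in simp)
    have "norm (suminf x) \<le> suminf (\<lambda>k. norm (x k))" by (rule summable_norm[OF sx])
    also have "\<dots> \<le> suminf (\<lambda>k. (K * norm y) * (1/2) ^ k)" by (rule suminf_le[OF xn sx sgeo])
    also have "\<dots> = (2 * K) * norm y"
      by (subst suminf_mult) (simp_all add: suminf_geometric)
    finally have nx: "norm (suminf x) \<le> (2 * K) * norm y" .
    have "(\<lambda>n. \<Sum>k<n. x k) \<longlonglongrightarrow> suminf x"
      by (rule summable_LIMSEQ[OF summable_norm_cancel[OF sx]])
    then have "(\<lambda>n. f (\<Sum>k<n. x k)) \<longlonglongrightarrow> f (suminf x)" by (rule f.tendsto)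
    moreover have "f (\<Sum>k<n. x k) = y - u n" for n
      by (induction n) (simp_all add: u f.zero f.add x_def)
    moreover have "u \<longlonglongrightarrow> 0"
    proof (rule Lim_null_comparison)
      show "\<forall>\<^sub>F k in sequentially. norm (u k) \<le> norm y * (1/2) ^ k" using un by simp
      show "(\<lambda>k. norm y * (1/2::real) ^ k) \<longlonglongrightarrow> 0"
        by (intro tendsto_mult_right_zero LIMSEQ_power_zero) simp
    qed
    then have "(\<lambda>n. y - u n) \<longlonglongrightarrow> y - 0" by (intro tendsto_intros)
    ultimately have "f (suminf x) = y" using LIMSEQ_unique by simp
    then show ?thesis using nx by blast
  qed
  then show ?thesis using K by (intro exI[of _ "2 * K"]) auto
qed

section \<open>Adjointable operators on Hilbert modules\<close>

context hilbert_cstar_module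
begin

lemma ip_add_left: "ip (x + y) z = ip x z + ip y z"
  using star_ip[of z "x + y"] star_ip[of z x] star_ip[of z y]
  by (metis ip_add_right star_add)

lemma ip_scaleC_left: "ip (c *\<^sub>C x) y = cnj c *\<^sub>C ip x y"
  using star_ip[of y "c *\<^sub>C x"] star_ip[of y x] by (metis ip_scaleC_right star_scaleC)

lemma ip_minus_right: "ip x (- y) = - ip x y"
  using ip_scaleC_right[of x "-1" y] by simp

lemma ip_minus_left: "ip (- x) y = - ip x y"
  using ip_scaleC_left[of "-1" x y] by simp

lemma ip_diff_right: "ip x (y - z) = ip x y - ip x z"
  using ip_add_right[of x y "- z"] by (simp add: ip_minus_right)

lemma ip_diff_left: "ip (x - y) z = ip x z - ip y z"
  using ip_add_left[of x "- y" z] by (simp add: ip_minus_left)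

lemma ip_zero_right [simp]: "ip x 0 = 0"
  using ip_diff_right[of x 0 0] by simp

lemma ip_zero_left [simp]: "ip 0 x = 0"
  using ip_diff_left[of 0 0 x] by simp

lemma ip_act_left: "ip (act x b) y = star b * ip x y"
  using star_ip[of y "act x b"] star_ip[of y x] by (metis ip_act_right star_mult)

lemmas ip_simps = ip_add_right ip_add_left ip_diff_right ip_diff_left
  ip_minus_right ip_minus_left ip_scaleC_right ip_scaleC_left

lemma ip_sum_right: "ip x (\<Sum>i\<in>I. f i) = (\<Sum>i\<in>I. ip x (f i))"
  by (induction I rule: infinite_finite_induct) (simp_all add: ip_add_right)

lemma ip_sum_left: "ip (\<Sum>i\<in>I. f i) x = (\<Sum>i\<in>I. ip (f i) x)"
  by (induction I rule: infinite_finite_induct) (simp_all add: ip_add_left)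

lemma norm_sq_ip: "(norm x)\<^sup>2 = norm (ip x x)"
  by (simp add: norm_eq)

lemma ip_self_eq_zero: "ip x x = 0 \<longleftrightarrow> x = 0"
  using norm_sq_ip[of x] by auto

lemma ip_eqI: "(\<And>w. ip w x = ip w y) \<Longrightarrow> x = y"
  using ip_self_eq_zero[of "x - y"] by (simp add: ip_diff_right)

text \<open>Polarisation instead of the sharp Cauchy-Schwarz inequality, whose proof uses the order
  of the algebra. For unit vectors each of four terms has norm at most 4 and the sum is divided by
  4. The constant affects only continuity and lower bounds.\<close>

lemma norm_ip_le: "norm (ip x y) \<le> 4 * norm x * norm y"
proof -
  have unit: "norm (ip x y) \<le> 4" if x: "norm x = 1" and y: "norm y = 1" for x y
  proof -
    have sq: "norm (ip (x + c *\<^sub>C y) (x + c *\<^sub>C y)) \<le> 4" if "cmod c = 1" for c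
    proof -
      have "norm (x + c *\<^sub>C y) \<le> 2"
        using norm_triangle_ineq[of x "c *\<^sub>C y"] that x y by (simp add: norm_scaleC)
      then have "(norm (x + c *\<^sub>C y))\<^sup>2 \<le> 2\<^sup>2" by (intro power_mono) auto
      then show ?thesis by (simp add: norm_sq_ip)
    qed
    \<comment> \<open>Expanding \<open>q c\<close> for |c| = 1 gives \<open>ip x y\<close> with
      coefficient 1 and the other terms with coefficient c or c^2; both cancel over the fourth roots
      of unity.\<close>
    define q where "q c = c *\<^sub>C ip (x + cnj c *\<^sub>C y) (x + cnj c *\<^sub>C y)" for c
    have qn: "norm (q c) \<le> 4" if "cmod c = 1" for c
      using sq[of "cnj c"] that by (simp add: q_def norm_scaleC)
    have "q 1 + q (-1) + q (- \<i>) + q \<i> = 4 *\<^sub>C ip x y"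
    proof -
      have four: "4 *\<^sub>C ip x y = ip x y + ip x y + ip x y + ip x y"
        using scaleC_add_left[of 2 2 "ip x y"] scaleC_add_left[of 1 1 "ip x y"] by (simp add: scaleC_one)
      show ?thesis unfolding four q_def
        by (simp add: ip_simps scaleC_add_right scaleC_scaleC scaleC_one scaleC_diff_right
            scaleC_minus_left scaleC_minus_right)
    qed
    then have "norm (4 *\<^sub>C ip x y) \<le> norm (q 1) + norm (q (-1)) + norm (q (- \<i>)) + norm (q \<i>)"
      by (metis norm_triangle_ineq norm_triangle_mono order_refl)
    also have "\<dots> \<le> 16" using qn[of 1] qn[of "-1"] qn[of "-\<i>"] qn[of \<i>] by simp
    finally show ?thesis by (simp add: norm_scaleC)
  qed
  show ?thesis
  proof (cases "x = 0 \<or> y = 0")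
    case False
    define a where "a = complex_of_real (1 / norm x)"
    define b where "b = complex_of_real (1 / norm y)"
    have "norm (ip (a *\<^sub>C x) (b *\<^sub>C y)) \<le> 4"
      using False by (intro unit) (simp_all add: a_def b_def norm_scaleC norm_divide)
    then have "norm (ip x y) / (norm x * norm y) \<le> 4"
      using False by (simp add: a_def b_def ip_simps norm_scaleC norm_divide mult.commute)
    then show ?thesis using False by (simp add: pos_divide_le_eq mult.assoc)
  qed auto
qed

lemma tendsto_ip_right: "z \<longlonglongrightarrow> w \<Longrightarrow> (\<lambda>n. ip x (z n)) \<longlonglongrightarrow> ip x w"
proof -
  assume z: "z \<longlonglongrightarrow> w"
  have "(\<lambda>n. ip x (z n - w)) \<longlonglongrightarrow> 0"
  proof (rule Lim_null_comparison)
    show "\<forall>\<^sub>F n in sequentially. norm (ip x (z n - w)) \<le> 4 * norm x * norm (z n - w)"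
      by (simp add: norm_ip_le)
    have "(\<lambda>n. z n - w) \<longlonglongrightarrow> 0" using z by (simp add: LIM_zero_iff)
    then show "(\<lambda>n. 4 * norm x * norm (z n - w)) \<longlonglongrightarrow> 0"
      by (intro tendsto_mult_right_zero tendsto_norm_zero)
  qed
  then show ?thesis by (simp add: ip_diff_right LIM_zero_iff)
qed

text \<open>Takes the place of Pythagoras, which for algebra-valued inner products would require
  comparing norms of positive elements.\<close>

lemma norm_le_if_cross_cancel:
  assumes "ip x y + ip y x = 0"
  shows "norm x \<le> norm (x + y)"
proof (rule norm_le_if_norm_add_eq_norm_diff)
  have "ip (x + y) (x + y) = ip x x + (ip x y + ip y x) + ip y y" by (simp add: ip_simps)
  moreover have "ip (x - y) (x - y) = ip x x - (ip x y + ip y x) + ip y y" by (simp add: ip_simps)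
  ultimately show "norm (x + y) = norm (x - y)" using assms by (simp add: norm_eq)
qed

text \<open>A relation on plain functions suffices: having an adjoint already forces linearity over
  the scalars and over the algebra, because the inner product separates points. Bounds are carried
  separately.\<close>

definition adj :: "('x \<Rightarrow> 'x) \<Rightarrow> ('x \<Rightarrow> 'x) \<Rightarrow> bool" where
  "adj A A' \<longleftrightarrow> (\<forall>x y. ip (A x) y = ip x (A' y))"

lemma adjD: "adj A A' \<Longrightarrow> ip (A x) y = ip x (A' y)"
  by (simp add: adj_def)

lemma adj_sym: "adj A A' \<Longrightarrow> adj A' A"
  unfolding adj_def by (metis star_ip)

lemma adj_comp: "adj A A' \<Longrightarrow> adj B B' \<Longrightarrow> adj (\<lambda>x. A (B x)) (\<lambda>x. B' (A' x))"
  by (simp add: adj_def)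

lemma adj_diff: "adj A A' \<Longrightarrow> adj B B' \<Longrightarrow> adj (\<lambda>x. A x - B x) (\<lambda>x. A' x - B' x)"
  by (simp add: adj_def ip_simps)

lemma adj_id: "adj (\<lambda>x. x) (\<lambda>x. x)"
  by (simp add: adj_def)

lemma adj_unique: "adj A A' \<Longrightarrow> adj A A'' \<Longrightarrow> A' x = A'' x"
  by (rule ip_eqI) (metis adjD)

lemma adj_add: "adj A A' \<Longrightarrow> A (x + y) = A x + A y"
  by (rule ip_eqI) (simp add: adjD[OF adj_sym, symmetric] ip_simps)

lemma adj_scaleC: "adj A A' \<Longrightarrow> A (c *\<^sub>C x) = c *\<^sub>C A x"
  by (rule ip_eqI) (simp add: adjD[OF adj_sym, symmetric] ip_simps)

lemma adj_act: "adj A A' \<Longrightarrow> A (act x b) = act (A x) b"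
  by (rule ip_eqI) (simp add: adjD[OF adj_sym, symmetric] ip_act_right)

lemma adj_map_diff: "adj A A' \<Longrightarrow> A (x - y) = A x - A y"
  by (rule ip_eqI) (simp add: adjD[OF adj_sym, symmetric] ip_simps)

lemma adj_map_zero: "adj A A' \<Longrightarrow> A 0 = 0"
  by (rule ip_eqI) (simp add: adjD[OF adj_sym, symmetric])

lemma adj_bounded_linear:
  assumes "adj A A'" and "\<And>x. norm (A x) \<le> B * norm x"
  shows "bounded_linear A"
  using assms
  by (intro bounded_linear_intro[where K=B])
     (simp_all add: adj_add scaleC_of_real[symmetric] adj_scaleC mult.commute)

text \<open>Without functional calculus, invertibility of \<open>S\<close> is reached along the segment
  \<open>S + i \<mu>\<close>: self-adjointness keeps these maps uniformly bounded below.\<close>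

lemma selfadjoint_bounded_below_onto:
  assumes S: "adj S S" and SB: "\<And>x. norm (S x) \<le> B * norm x"
    and Vcl: "closed V" and V0: "0 \<in> V"
    and Vadd: "\<And>x y. x \<in> V \<Longrightarrow> y \<in> V \<Longrightarrow> x + y \<in> V"
    and Vscale: "\<And>c x. x \<in> V \<Longrightarrow> c *\<^sub>C x \<in> V"
    and SV: "\<And>x. x \<in> V \<Longrightarrow> S x \<in> V"
    and c: "c > 0" and below: "\<And>x. x \<in> V \<Longrightarrow> c * norm x \<le> norm (S x)"
    and w: "w \<in> V"
  shows "\<exists>v\<in>V. S v = w"
proof -
  have Vdiff: "x - y \<in> V" if "x \<in> V" "y \<in> V" for x y
    using Vadd[OF that(1) Vscale[OF that(2), of "-1"]] by simp
  define A where "A \<mu> v = S v + (\<i> * complex_of_real \<mu>) *\<^sub>C v" for \<mu> v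
  have Adiff: "A \<mu> (u - v) = A \<mu> u - A \<mu> v" for \<mu> u v
    by (simp add: A_def adj_map_diff[OF S] scaleC_diff_right)
  have Abelow: "c * norm x \<le> norm (A \<mu> x)" if "x \<in> V" for x \<mu>
  proof -
    have "norm (S x) \<le> norm (A \<mu> x)" unfolding A_def
      by (rule norm_le_if_cross_cancel) (simp add: ip_simps adjD[OF S] scaleC_minus_left)
    then show ?thesis using below[OF that] by simp
  qed
  define onto where "onto \<mu> \<longleftrightarrow> (\<forall>w\<in>V. \<exists>v\<in>V. A \<mu> v = w)" for \<mu>
  have complete: "complete V" using Vcl by (simp add: complete_eq_closed)
  \<comment> \<open>\<open>A \<mu>' v = w\<close> means \<open>A \<mu> v = w + k v\<close>. Since
    the inverse of \<open>A \<mu>\<close> has norm at most 1 / c and |k| is at most c / 2, solving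
    for \<open>v\<close> is a contraction with factor 1 / 2.\<close>
  have step: "onto \<mu>'" if on: "onto \<mu>" and d: "\<bar>\<mu> - \<mu>'\<bar> \<le> c / 2" for \<mu> \<mu>'
    unfolding onto_def
  proof
    fix w assume w: "w \<in> V"
    define k where "k = \<i> * complex_of_real (\<mu> - \<mu>')"
    have kn: "cmod k = \<bar>\<mu> - \<mu>'\<bar>" by (simp add: k_def norm_mult del: of_real_diff)
    have "\<forall>v\<in>V. \<exists>u\<in>V. A \<mu> u = w + k *\<^sub>C v"
      using on w Vadd Vscale unfolding onto_def by blast
    then obtain g where g: "\<And>v. v \<in> V \<Longrightarrow> g v \<in> V \<and> A \<mu> (g v) = w + k *\<^sub>C v" by metis
    have "\<exists>!x\<in>V. g x = x"
    proof (rule Banach_fix[OF complete, of "1/2"])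
      fix x y assume xy: "x \<in> V" "y \<in> V"
      have "c * norm (g x - g y) \<le> norm (A \<mu> (g x - g y))"
        using g xy Vdiff by (intro Abelow) auto
      also have "A \<mu> (g x - g y) = k *\<^sub>C (x - y)"
        using g xy by (simp add: Adiff scaleC_diff_right)
      also have "norm \<dots> \<le> (c / 2) * norm (x - y)"
        unfolding norm_scaleC kn using d by (intro mult_right_mono) auto
      finally have "c * norm (g x - g y) \<le> c * (norm (x - y) / 2)" by simp
      then show "dist (g x) (g y) \<le> 1 / 2 * dist x y"
        using c by (simp add: dist_norm)
    qed (use V0 g in auto)
    then obtain v where v: "v \<in> V" "g v = v" by blast
    then have "A \<mu> v = w + k *\<^sub>C v" using g[of v] by simp
    moreover have "A \<mu> v = A \<mu>' v + k *\<^sub>C v"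
      by (simp add: A_def k_def scaleC_add_left[symmetric] algebra_simps)
    ultimately show "\<exists>v\<in>V. A \<mu>' v = w" using v(1) by auto
  qed
  obtain n where n: "real n > (2 * \<bar>B\<bar> + 1) / (c / 2)" using reals_Archimedean2 by blast
  \<comment> \<open>The starting point exceeds 2 |B|, where v -> (w - S v) / (i \<mu>0) is a
    contraction with factor 1 / 2; being a multiple of the step length c / 2, it reaches 0 after
    exactly \<open>n\<close> steps.\<close>
  define \<mu>0 where "\<mu>0 = real n * (c / 2)"
  have \<mu>0: "\<mu>0 > 2 * \<bar>B\<bar> + 1" using n c by (simp add: \<mu>0_def field_simps)
  have start: "onto \<mu>0" unfolding onto_def
  proof
    fix w assume w: "w \<in> V"
    define k where "k = 1 / (\<i> * complex_of_real \<mu>0)"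
    have k: "cmod k = 1 / \<mu>0" using \<mu>0 by (simp add: k_def norm_divide norm_mult)
    have "\<exists>!x\<in>V. k *\<^sub>C (w - S x) = x"
    proof (rule Banach_fix[OF complete, of "1/2"])
      fix x y assume "x \<in> V" "y \<in> V"
      have "k *\<^sub>C (w - S x) - k *\<^sub>C (w - S y) = k *\<^sub>C S (y - x)"
        by (simp add: scaleC_diff_right adj_map_diff[OF S])
      then have "dist (k *\<^sub>C (w - S x)) (k *\<^sub>C (w - S y)) = norm (S (y - x)) / \<mu>0"
        using k by (simp add: dist_norm norm_scaleC)
      also have "\<dots> \<le> (\<bar>B\<bar> * norm (y - x)) / \<mu>0"
      proof (rule divide_right_mono)
        show "norm (S (y - x)) \<le> \<bar>B\<bar> * norm (y - x)"
          by (rule order_trans[OF SB]) (intro mult_right_mono, auto)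
      qed (use \<mu>0 in simp)
      also have "\<dots> = (\<bar>B\<bar> / \<mu>0) * dist x y" by (simp add: dist_norm norm_minus_commute)
      also have "\<dots> \<le> 1 / 2 * dist x y"
      proof (rule mult_right_mono)
        have "\<mu>0 > 0" using \<mu>0 by simp
        then show "\<bar>B\<bar> / \<mu>0 \<le> 1 / 2" using \<mu>0 by (simp add: pos_divide_le_eq)
      qed simp
      finally show "dist (k *\<^sub>C (w - S x)) (k *\<^sub>C (w - S y)) \<le> 1 / 2 * dist x y" .
    qed (use V0 w SV Vdiff Vscale in auto)
    then obtain v where v: "v \<in> V" "k *\<^sub>C (w - S v) = v" by blast
    have "(\<i> * complex_of_real \<mu>0) * k = 1" using \<mu>0 by (simp add: k_def)
    then have "(\<i> * complex_of_real \<mu>0) *\<^sub>C v = w - S v"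
      using v(2) by (metis scaleC_one scaleC_scaleC)
    then show "\<exists>v\<in>V. A \<mu>0 v = w" using v(1) by (intro bexI[of _ v]) (simp_all add: A_def)
  qed
  have "onto (\<mu>0 - real k * (c / 2))" for k
  proof (induction k)
    case (Suc k)
    show ?case by (rule step[OF Suc]) (use c in \<open>simp add: algebra_simps\<close>)
  qed (simp add: start)
  from this[of n] have "onto 0" by (simp add: \<mu>0_def)
  then show ?thesis using w by (simp add: onto_def A_def)
qed

text \<open>\<open>V\<close> is not known to be complemented, so the inverse of \<open>S\<close> on
  \<open>V\<close> cannot simply be extended by 0. Instead \<open>J\<close> applies \<open>S\<close>
  first and then inverts \<open>S\<close> twice inside \<open>V\<close>: it is defined everywhere,
  self-adjoint, and inverts \<open>S\<close> on \<open>V\<close>.\<close>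

lemma selfadjoint_bounded_below_inverse:
  assumes S: "adj S S" and SB: "\<And>x. norm (S x) \<le> B * norm x"
    and Vcl: "closed V" and V0: "0 \<in> V"
    and Vadd: "\<And>x y. x \<in> V \<Longrightarrow> y \<in> V \<Longrightarrow> x + y \<in> V"
    and Vscale: "\<And>c x. x \<in> V \<Longrightarrow> c *\<^sub>C x \<in> V"
    and SV: "\<And>x. S x \<in> V"
    and c: "c > 0" and below: "\<And>x. x \<in> V \<Longrightarrow> c * norm x \<le> norm (S x)"
  shows "\<exists>J j. adj J J \<and> (\<forall>x. norm (J x) \<le> j * norm x) \<and> (\<forall>v\<in>V. S (J v) = v)"
proof -
  have Vdiff: "x - y \<in> V" if "x \<in> V" "y \<in> V" for x y
    using Vadd[OF that(1) Vscale[OF that(2), of "-1"]] by simp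
  have onto: "\<exists>v\<in>V. S v = w" if "w \<in> V" for w
    by (rule selfadjoint_bounded_below_onto[OF S SB Vcl V0 Vadd Vscale SV c below that])
  have inj: "u = v" if "u \<in> V" "v \<in> V" "S u = S v" for u v
  proof -
    have "c * norm (u - v) \<le> 0"
      using below[OF Vdiff[OF that(1,2)]] that(3) by (simp add: adj_map_diff[OF S])
    then show ?thesis using c by (simp add: mult_le_0_iff)
  qed
  have "\<exists>u\<in>V. S (S u) = S y" for y
    using onto[OF SV[of y]] onto by metis
  then obtain J where JV: "\<And>y. J y \<in> V" and J: "\<And>y. S (S (J y)) = S y" by metis
  show ?thesis
  proof (intro exI[of _ J] exI[of _ "B / (c * c)"] conjI allI ballI)
    show "adj J J" unfolding adj_def
    proof (intro allI)
      fix y z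
      \<comment> \<open>Writing the values of \<open>J\<close> as values of \<open>S\<close> allows
        \<open>S\<close> to be moved across; both sides become
        \<open>ip (S (J y)) (J z)\<close>.\<close>
      obtain w where w: "w \<in> V" "S w = J y" using onto[OF JV] by blast
      obtain w' where w': "w' \<in> V" "S w' = J z" using onto[OF JV] by blast
      have "ip (J y) z = ip w (S z)" by (simp add: w(2)[symmetric] adjD[OF S])
      also have "\<dots> = ip (S w) (S (J z))" by (simp add: adjD[OF S] J)
      finally have 1: "ip (J y) z = ip (S (J y)) (J z)" by (simp add: w(2) adjD[OF S])
      have "ip y (J z) = ip (S y) w'" by (simp add: w'(2)[symmetric] adjD[OF S])
      also have "\<dots> = ip (S (J y)) (S w')" by (simp add: adjD[OF S, symmetric] J)
      finally show "ip (J y) z = ip y (J z)" using 1 by (simp add: w'(2))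
    qed
    show "norm (J x) \<le> B / (c * c) * norm x" for x
    proof -
      have "c * (c * norm (J x)) \<le> c * norm (S (J x))"
        using below[OF JV[of x]] c by (intro mult_left_mono) auto
      also have "\<dots> \<le> norm (S (S (J x)))" by (rule below[OF SV])
      also have "\<dots> \<le> B * norm x" by (simp add: J SB)
      finally show ?thesis using c by (simp add: field_simps)
    qed
    show "S (J v) = v" if "v \<in> V" for v
      by (rule inj[OF SV that J])
  qed
qed

section \<open>Complemented submodules as ranges of projections\<close>

definition proj_onto :: "('x \<Rightarrow> 'x) \<Rightarrow> 'x set \<Rightarrow> bool" where
  "proj_onto P W \<longleftrightarrow> adj P P \<and> (\<forall>x. P x \<in> W) \<and> (\<forall>x\<in>W. P x = x)"

lemma proj_ontoD:
  assumes "proj_onto P W"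
  shows "adj P P" "P x \<in> W" "x \<in> W \<Longrightarrow> P x = x" "P (P x) = P x" "x \<in> W \<longleftrightarrow> P x = x"
  using assms unfolding proj_onto_def by (blast, blast, blast, blast, metis)

lemma proj_onto_norm: "proj_onto P W \<Longrightarrow> norm (P x) \<le> norm x"
proof -
  assume P: "proj_onto P W"
  have "norm (P x) \<le> norm (P x + (x - P x))"
    by (rule norm_le_if_cross_cancel)
       (simp add: ip_simps adjD[OF proj_ontoD(1)[OF P]] proj_ontoD(4)[OF P])
  then show ?thesis by simp
qed

lemma proj_onto_bounded_linear: "proj_onto P W \<Longrightarrow> bounded_linear P"
  by (rule adj_bounded_linear[where B=1, OF proj_ontoD(1)]) (auto dest: proj_onto_norm)

lemma proj_onto_ortho_compl:
  assumes P: "proj_onto P W"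
  shows "proj_onto (\<lambda>x. x - P x) (ortho_compl ip W)"
  unfolding proj_onto_def
proof (intro conjI allI ballI)
  show "adj (\<lambda>x. x - P x) (\<lambda>x. x - P x)" by (intro adj_diff adj_id proj_ontoD(1)[OF P])
  show "x - P x \<in> ortho_compl ip W" for x
    using proj_ontoD[OF P] by (auto simp: ortho_compl_def ip_simps adjD)
  show "x - P x = x" if x: "x \<in> ortho_compl ip W" for x
  proof -
    have "ip (P x) (P x) = ip x (P x)" using proj_ontoD[OF P] by (simp add: adjD)
    also have "\<dots> = 0" using x proj_ontoD(2)[OF P] by (simp add: ortho_compl_def)
    finally show ?thesis by (simp add: ip_self_eq_zero)
  qed
qed

lemma ortho_compl_ortho_compl:
  assumes P: "proj_onto P W"
  shows "ortho_compl ip (ortho_compl ip W) = W"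
  using proj_ontoD(5)[OF proj_onto_ortho_compl[OF proj_onto_ortho_compl[OF P]]] proj_ontoD(5)[OF P]
  by auto

lemma proj_onto_closed: "proj_onto P W \<Longrightarrow> closed W"
proof -
  assume P: "proj_onto P W"
  have "closed {x. P x = x}"
    by (intro closed_Collect_eq continuous_intros linear_continuous_on proj_onto_bounded_linear[OF P])
  also have "{x. P x = x} = W" using proj_ontoD(5)[OF P] by auto
  finally show ?thesis .
qed

lemma complemented_iff: "complemented act ip W \<longleftrightarrow> (\<exists>P. proj_onto P W)"
proof
  assume W: "complemented act ip W"
  have int: "x = 0" if "x \<in> W" "x \<in> ortho_compl ip W" for x
    using W that by (auto simp: complemented_def)
  have "\<exists>v\<in>W. x - v \<in> ortho_compl ip W" for x
  proof -
    have "x \<in> W + ortho_compl ip W" using W by (simp add: complemented_def)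
    then obtain v u where "x = v + u" "v \<in> W" "u \<in> ortho_compl ip W" by (rule set_plus_elim)
    then show ?thesis by (intro bexI[of _ v]) auto
  qed
  then obtain P where PW: "\<And>x. P x \<in> W" and P: "\<And>x. x - P x \<in> ortho_compl ip W" by metis
  have oL: "ip (x - P x) y = 0" if "y \<in> W" for x y
    using P[of x] that by (simp add: ortho_compl_def)
  then have oR: "ip y (x - P x) = 0" if "y \<in> W" for x y
    using star_ip[of "x - P x" y] that by simp
  have "adj P P" unfolding adj_def
  proof (intro allI)
    fix x y
    show "ip (P x) y = ip x (P y)"
      using oL[OF PW[of y], of x] oR[OF PW[of x], of y] by (simp add: ip_simps)
  qed
  moreover have "P x = x" if x: "x \<in> W" for x
  proof -
    have "- P x \<in> W"
      using W PW[of x] unfolding complemented_def closed_submodule_def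
      by (metis scaleC_minus_one)
    then have "x - P x \<in> W"
      using W x unfolding complemented_def closed_submodule_def by (metis diff_conv_add_uminus)
    then show ?thesis using int[OF _ P] by fastforce
  qed
  ultimately show "\<exists>P. proj_onto P W" using PW by (auto simp: proj_onto_def)
next
  assume "\<exists>P. proj_onto P W"
  then obtain P where P: "proj_onto P W" by blast
  note mem = proj_ontoD(5)[OF P]
  note S = proj_ontoD(1)[OF P]
  have "closed_submodule act W"
    unfolding closed_submodule_def
    by (auto simp: proj_onto_closed[OF P] mem adj_map_zero[OF S] adj_add[OF S] adj_scaleC[OF S]
        adj_act[OF S])
  moreover have "x \<in> W + ortho_compl ip W" for x
    using set_plus_intro[OF proj_ontoD(2)[OF P, of x] proj_ontoD(2)[OF proj_onto_ortho_compl[OF P], of x]]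
    by simp
  moreover have "W \<inter> ortho_compl ip W = {0}"
  proof -
    have "x = 0" if "x \<in> W" "x \<in> ortho_compl ip W" for x
      using that by (auto simp: ortho_compl_def ip_self_eq_zero)
    moreover have "0 \<in> W" "0 \<in> ortho_compl ip W"
      by (simp_all add: mem adj_map_zero[OF S] ortho_compl_def)
    ultimately show ?thesis by blast
  qed
  ultimately show "complemented act ip W" unfolding complemented_def by blast
qed

section \<open>Closed sums of complemented submodules\<close>

text \<open>For \<open>T = (1 - P) Q\<close> the operator \<open>T\<^sup>* J T\<close> obtained here is the projection onto the
  complement of \<open>M \<inter> N\<close> in \<open>N\<close>.\<close>

lemma closed_sum_pseudoinverse:
  assumes P: "proj_onto P M" and Q: "proj_onto Q N" and cl: "closed (M + N)"
    and T_def: "\<And>x. T x = Q x - P (Q x)" and T'_def: "\<And>x. T' x = Q x - Q (P x)"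
  shows "\<exists>J j. adj J J \<and> (\<forall>x. norm (J x) \<le> j * norm x) \<and> (\<forall>x. T (T' (J (T x))) = T x)"
proof -
  note P1 = proj_ontoD(1)[OF P] and Q1 = proj_ontoD(1)[OF Q]
  have TT: "adj T T'"
    using adj_diff[OF Q1 adj_comp[OF P1 Q1]] by (simp add: T_def[abs_def] T'_def[abs_def])
  have Tn: "norm (T x) \<le> norm x" for x
    using proj_onto_norm[OF proj_onto_ortho_compl[OF P], of "Q x"] proj_onto_norm[OF Q, of x]
    by (simp add: T_def)
  have T'n: "norm (T' x) \<le> norm x" for x
    using proj_onto_norm[OF Q, of "x - P x"] proj_onto_norm[OF proj_onto_ortho_compl[OF P], of x]
    by (simp add: T'_def adj_map_diff[OF Q1])
  have Tbl: "bounded_linear T"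
    by (rule adj_bounded_linear[OF TT, of 1]) (simp add: Tn)
  \<comment> \<open>The point where closedness of the sum enters: it is intersected with the closed
    submodule \<open>ortho_compl ip M\<close>.\<close>
  have "range T = ortho_compl ip M \<inter> (M + N)"
  proof (intro set_eqI iffI)
    fix y assume "y \<in> range T"
    then obtain x where x: "y = T x" by blast
    have "- P (Q x) \<in> M"
      using adj_scaleC[OF P1, of "-1" "Q x"] proj_ontoD(2)[OF P, of "- Q x"] by simp
    then have "- P (Q x) + Q x \<in> M + N" by (rule set_plus_intro) (rule proj_ontoD(2)[OF Q])
    then show "y \<in> ortho_compl ip M \<inter> (M + N)"
      using proj_ontoD(2)[OF proj_onto_ortho_compl[OF P], of "Q x"] by (simp add: x T_def)
  next
    fix y assume y: "y \<in> ortho_compl ip M \<inter> (M + N)"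
    then obtain m n where mn: "y = m + n" "m \<in> M" "n \<in> N" by (auto elim: set_plus_elim)
    have "y - P y = y" using y proj_ontoD(3)[OF proj_onto_ortho_compl[OF P]] by blast
    then have "y = T n" using proj_ontoD(3)[OF P mn(2)] proj_ontoD(3)[OF Q mn(3)]
      by (simp add: T_def mn(1) adj_add[OF P1])
    then show "y \<in> range T" by blast
  qed
  then have clT: "closed (range T)"
    using cl proj_onto_closed[OF proj_onto_ortho_compl[OF P]] by auto
  obtain K where K: "K > 0" "\<forall>y\<in>range T. \<exists>x. T x = y \<and> norm x \<le> K * norm y"
    using open_mapping_closed_range[OF Tbl clT] by blast
  define S where "S x = T (T' x)" for x
  have S: "adj S S" using adj_comp[OF TT adj_sym[OF TT]] by (simp add: S_def[abs_def])
  \<comment> \<open>A preimage of controlled norm bounds |y| by 4 K |T' y|; inserting this into |T'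
    y|^2 = |<y, S y>| bounds |T' y| by 16 K |S y|. The product of the constants is 64 K^2.\<close>
  have below: "1 / (64 * K * K) * norm y \<le> norm (S y)" if y: "y \<in> range T" for y
  proof -
    obtain x where x: "T x = y" "norm x \<le> K * norm y" using K(2) y by blast
    have "(norm y)\<^sup>2 = norm (ip y (T x))" by (simp add: norm_sq_ip x)
    also have "\<dots> = norm (ip (T' y) x)" by (simp add: adjD[OF adj_sym[OF TT]])
    also have "\<dots> \<le> 4 * norm (T' y) * norm x" by (rule norm_ip_le)
    also have "\<dots> \<le> 4 * norm (T' y) * (K * norm y)" using x(2) by (intro mult_left_mono) auto
    finally have "norm y * norm y \<le> (4 * K * norm (T' y)) * norm y"
      by (simp add: power2_eq_square mult_ac)
    then have 1: "norm y \<le> 4 * K * norm (T' y)"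
      using K(1) by (cases "norm y = 0") (simp_all add: mult_le_cancel_right)
    have "(norm (T' y))\<^sup>2 = norm (ip y (S y))" by (simp add: norm_sq_ip S_def adjD[OF adj_sym[OF TT]])
    also have "\<dots> \<le> 4 * norm y * norm (S y)" by (rule norm_ip_le)
    also have "\<dots> \<le> 4 * (4 * K * norm (T' y)) * norm (S y)" using 1 by (intro mult_right_mono mult_left_mono) auto
    finally have "norm (T' y) * norm (T' y) \<le> (16 * K * norm (S y)) * norm (T' y)"
      by (simp add: power2_eq_square mult_ac)
    then have 2: "norm (T' y) \<le> 16 * K * norm (S y)"
      using K(1) by (cases "norm (T' y) = 0") (simp_all add: mult_le_cancel_right)
    have "norm y \<le> 4 * K * (16 * K * norm (S y))"
      using K(1) by (intro order_trans[OF 1] mult_left_mono[OF 2]) simp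
    then show ?thesis using K(1) by (simp add: pos_divide_le_eq mult_ac)
  qed
  have Sn: "norm (S x) \<le> 1 * norm x" for x
    using Tn[of "T' x"] T'n[of x] by (simp add: S_def)
  have "\<exists>J j. adj J J \<and> (\<forall>x. norm (J x) \<le> j * norm x) \<and> (\<forall>v\<in>range T. S (J v) = v)"
  proof (rule selfadjoint_bounded_below_inverse[OF S Sn clT _ _ _ _ _ below])
    show "0 \<in> range T" using adj_map_zero[OF TT] by (metis rangeI)
    show "x + y \<in> range T" if "x \<in> range T" "y \<in> range T" for x y
      using that by (auto simp: adj_add[OF TT, symmetric])
    show "c *\<^sub>C x \<in> range T" if "x \<in> range T" for c x
      using that by (auto simp: adj_scaleC[OF TT, symmetric])
    show "S x \<in> range T" for x by (simp add: S_def)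
    show "1 / (64 * K * K) > 0" using K(1) by simp
  qed
  then show ?thesis by (simp add: S_def)
qed

text \<open>\<open>T E = T\<close> and its adjoint \<open>E T' = T'\<close> make \<open>E\<close>
  the projection onto ran T', which lies in \<open>N\<close>. Values of \<open>R = Q - E\<close> are
  fixed by \<open>Q\<close> and killed by \<open>T\<close>, hence fixed by \<open>P\<close>. The
  formula for Q - R is recorded because an identity between adjointable maps can be carried over to
  the tensor product.\<close>

theorem closed_sum_consequences:
  assumes P: "proj_onto P M" and Q: "proj_onto Q N" and cl: "closed (M + N)"
  shows "\<exists>R J j. proj_onto R (M \<inter> N) \<and> adj J J \<and> (\<forall>x. norm (J x) \<le> j * norm x) \<and>
    (\<forall>x. Q x - R x = Q (J (Q x - P (Q x))) - Q (P (J (Q x - P (Q x)))))"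
    and "closed (ortho_compl ip M + ortho_compl ip N)"
proof -
  define T where "T x = Q x - P (Q x)" for x
  define T' where "T' x = Q x - Q (P x)" for x
  note P1 = proj_ontoD(1)[OF P] and Q1 = proj_ontoD(1)[OF Q]
  note Pc = proj_onto_ortho_compl[OF P] and Qc = proj_onto_ortho_compl[OF Q]
  obtain J j where J: "adj J J" "\<forall>x. norm (J x) \<le> j * norm x"
    and TJ: "\<forall>x. T (T' (J (T x))) = T x"
    using closed_sum_pseudoinverse[OF P Q cl T_def T'_def] by blast
  have TT: "adj T T'"
    using adj_diff[OF Q1 adj_comp[OF P1 Q1]] by (simp add: T_def[abs_def] T'_def[abs_def])
  define E where "E x = T' (J (T x))" for x
  have E: "adj E E"
    using adj_comp[OF adj_sym[OF TT] adj_comp[OF J(1) TT]] by (simp add: E_def[abs_def])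
  have TE: "T (E x) = T x" for x by (simp add: E_def TJ)
  \<comment> \<open>Both sides are adjoint to \<open>T\<close>, since \<open>E\<close> is
    self-adjoint and \<open>T E = T\<close>.\<close>
  have ET': "E (T' x) = T' x" for x
    using adj_unique[OF adj_comp[OF TT E], of T'] TT by (simp add: TE)
  have QT': "Q (T' x) = T' x" for x
    by (simp add: T'_def adj_map_diff[OF Q1] proj_ontoD(4)[OF Q])
  have QE: "Q (E x) = E x" for x by (simp add: E_def QT')
  have TQ: "T (Q x) = T x" for x by (simp add: T_def proj_ontoD(4)[OF Q])
  have EQ: "E (Q x) = E x" for x by (simp add: E_def TQ)
  define R where "R x = Q x - E x" for x
  have "proj_onto R (M \<inter> N)" unfolding proj_onto_def
  proof (intro conjI allI ballI)
    show "adj R R" using adj_diff[OF Q1 E] by (simp add: R_def[abs_def])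
    show "R x \<in> M \<inter> N" for x
    proof -
      have QR: "Q (R x) = R x" by (simp add: R_def adj_map_diff[OF Q1] QE proj_ontoD(4)[OF Q])
      have "T (R x) = 0" by (simp add: R_def adj_map_diff[OF TT] TQ TE)
      then have "P (R x) = R x" by (simp add: T_def QR)
      then show ?thesis using QR proj_ontoD(5)[OF P] proj_ontoD(5)[OF Q] by blast
    qed
    show "R x = x" if x: "x \<in> M \<inter> N" for x
    proof -
      have "Q x = x" "P x = x" using x proj_ontoD(3)[OF P] proj_ontoD(3)[OF Q] by auto
      then show ?thesis
        by (simp add: R_def E_def T_def adj_map_zero[OF J(1)] adj_map_zero[OF adj_sym[OF TT]])
    qed
  qed
  moreover have "Q x - R x = Q (J (Q x - P (Q x))) - Q (P (J (Q x - P (Q x))))" for x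
    by (simp add: R_def E_def T_def T'_def)
  ultimately show "\<exists>R J j. proj_onto R (M \<inter> N) \<and> adj J J \<and> (\<forall>x. norm (J x) \<le> j * norm x) \<and>
    (\<forall>x. Q x - R x = Q (J (Q x - P (Q x))) - Q (P (J (Q x - P (Q x)))))"
    using J by blast
  show "closed (ortho_compl ip M + ortho_compl ip N)"
  proof -
    \<comment> \<open>Membership depends only on \<open>Q x\<close>, as the kernel of
      \<open>Q\<close> is \<open>ortho_compl ip N\<close>; and \<open>Q\<close> maps
      \<open>ortho_compl ip M\<close> onto ran T', the range of \<open>E\<close>. The result is an
      equaliser of bounded maps, hence closed.\<close>
    have "ortho_compl ip M + ortho_compl ip N = {x. E x = Q x}"
    proof (intro set_eqI iffI)
      fix x assume "x \<in> ortho_compl ip M + ortho_compl ip N"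
      then obtain m n where x: "x = m + n" "m \<in> ortho_compl ip M" "n \<in> ortho_compl ip N"
        by (rule set_plus_elim)
      have "P m = 0" "Q n = 0" using proj_ontoD(3)[OF Pc x(2)] proj_ontoD(3)[OF Qc x(3)] by auto
      then have "Q x = T' m" by (simp add: x(1) adj_add[OF Q1] T'_def adj_map_zero[OF Q1])
      then show "x \<in> {x. E x = Q x}" using ET' EQ[of x] by simp
    next
      fix x assume "x \<in> {x. E x = Q x}"
      then have x: "E x = Q x" by simp
      define w where "w = J (T x) - P (J (T x))"
      have "Q x = Q w" using x by (simp add: E_def T'_def w_def adj_map_diff[OF Q1])
      then have "x = w + ((x - w) - Q (x - w))" by (simp add: adj_map_diff[OF Q1])
      moreover have "w \<in> ortho_compl ip M" unfolding w_def by (rule proj_ontoD(2)[OF Pc])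
      ultimately show "x \<in> ortho_compl ip M + ortho_compl ip N"
        using proj_ontoD(2)[OF Qc] by (metis set_plus_intro)
    qed
    also have "closed \<dots>"
    proof -
      note Pb = proj_onto_bounded_linear[OF P] and Qb = proj_onto_bounded_linear[OF Q]
      have "bounded_linear T"
        using bounded_linear_sub[OF Qb bounded_linear_compose[OF Pb Qb]] by (simp add: T_def[abs_def])
      moreover have "bounded_linear T'"
        using bounded_linear_sub[OF Qb bounded_linear_compose[OF Qb Pb]] by (simp add: T'_def[abs_def])
      moreover have "bounded_linear J" using adj_bounded_linear[OF J(1)] J(2) by blast
      ultimately have "bounded_linear (\<lambda>x. T' (J (T x)))"
        by (intro bounded_linear_compose[of T', OF _ bounded_linear_compose[of J]])
      then have "bounded_linear E" by (simp add: E_def[abs_def])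
      then show ?thesis
        by (intro closed_Collect_eq linear_continuous_on proj_onto_bounded_linear[OF Q])
    qed
    finally show ?thesis .
  qed
qed

text \<open>A closed sum yields a closed sum of the complements and a complemented intersection;
  applying this to the complements, whose complements are \<open>M\<close> and \<open>N\<close>
  again, gives the way back.\<close>

theorem closed_sum_iff_ortho_compl:
  assumes M: "complemented act ip M" and N: "complemented act ip N"
  shows "complemented act ip (M \<inter> N) \<and> closed (M + N) \<longleftrightarrow>
    complemented act ip (ortho_compl ip M \<inter> ortho_compl ip N) \<and>
    closed (ortho_compl ip M + ortho_compl ip N)"
proof -
  obtain P Q where P: "proj_onto P M" and Q: "proj_onto Q N"
    using M N by (auto simp: complemented_iff)
  note Pc = proj_onto_ortho_compl[OF P] and Qc = proj_onto_ortho_compl[OF Q]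
  have "closed (ortho_compl ip M + ortho_compl ip N)" "complemented act ip (M \<inter> N)"
    if "closed (M + N)"
    using closed_sum_consequences[OF P Q that] unfolding complemented_iff by blast+
  moreover have "closed (M + N)" "complemented act ip (ortho_compl ip M \<inter> ortho_compl ip N)"
    if "closed (ortho_compl ip M + ortho_compl ip N)"
    using closed_sum_consequences[OF Pc Qc that] unfolding complemented_iff
      ortho_compl_ortho_compl[OF P] ortho_compl_ortho_compl[OF Q] by blast+
  ultimately show ?thesis by blast
qed

end

section \<open>Linear extension from the free vector space\<close>

definition lin_ext :: "('k \<Rightarrow> 'v::complex_vector) \<Rightarrow> ('k \<Rightarrow>\<^sub>0 complex) \<Rightarrow> 'v" where
  "lin_ext \<phi> t = (\<Sum>q\<in>Poly_Mapping.keys t. Poly_Mapping.lookup t q *\<^sub>C \<phi> q)"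

lemma lin_ext_superset:
  assumes "finite A" "Poly_Mapping.keys t \<subseteq> A"
  shows "lin_ext \<phi> t = (\<Sum>q\<in>A. Poly_Mapping.lookup t q *\<^sub>C \<phi> q)"
  unfolding lin_ext_def
  by (rule sum.mono_neutral_left) (use assms in \<open>auto simp: in_keys_iff\<close>)

lemma lin_ext_add: "lin_ext \<phi> (t + u) = lin_ext \<phi> t + lin_ext \<phi> u"
proof -
  let ?A = "Poly_Mapping.keys t \<union> Poly_Mapping.keys u"
  have "lin_ext \<phi> (t + u) = (\<Sum>q\<in>?A. Poly_Mapping.lookup (t + u) q *\<^sub>C \<phi> q)"
    by (rule lin_ext_superset) (use Poly_Mapping.keys_add[of t u] in auto)
  also have "\<dots> = (\<Sum>q\<in>?A. Poly_Mapping.lookup t q *\<^sub>C \<phi> q) + (\<Sum>q\<in>?A. Poly_Mapping.lookup u q *\<^sub>C \<phi> q)"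
    by (simp add: lookup_add scaleC_add_left sum.distrib)
  also have "\<dots> = lin_ext \<phi> t + lin_ext \<phi> u"
    by (simp add: lin_ext_superset[of ?A t] lin_ext_superset[of ?A u])
  finally show ?thesis .
qed

lemma lin_ext_scaleC: "lin_ext \<phi> (c *\<^sub>C t) = c *\<^sub>C lin_ext \<phi> t"
proof -
  have "lin_ext \<phi> (c *\<^sub>C t) = (\<Sum>q\<in>Poly_Mapping.keys t. Poly_Mapping.lookup (c *\<^sub>C t) q *\<^sub>C \<phi> q)"
    by (rule lin_ext_superset) (auto simp: in_keys_iff lookup_scaleC scaleC_complex_def)
  also have "\<dots> = (\<Sum>q\<in>Poly_Mapping.keys t. c *\<^sub>C (Poly_Mapping.lookup t q *\<^sub>C \<phi> q))"
    by (simp add: lookup_scaleC scaleC_complex_def scaleC_scaleC)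
  finally show ?thesis by (simp add: lin_ext_def scaleC_sum_right)
qed

lemma lin_ext_diff: "lin_ext \<phi> (t - u) = lin_ext \<phi> t - lin_ext \<phi> u"
  using lin_ext_add[of \<phi> t "(-1) *\<^sub>C u"] by (simp add: lin_ext_scaleC del: scaleC_minus_one)
    (simp add: scaleC_minus_one)

lemma lin_ext_single: "lin_ext \<phi> (Poly_Mapping.single q c) = c *\<^sub>C \<phi> q"
  by (simp add: lin_ext_def)

lemma lin_ext_comp:
  fixes \<phi> :: "'k \<Rightarrow> 'v::complex_vector" and \<Lambda> :: "'v \<Rightarrow> 'w::complex_vector"
  assumes add: "\<And>v w. \<Lambda> (v + w) = \<Lambda> v + \<Lambda> w" and scale: "\<And>c v. \<Lambda> (c *\<^sub>C v) = c *\<^sub>C \<Lambda> v"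
  shows "\<Lambda> (lin_ext \<phi> t) = lin_ext (\<lambda>q. \<Lambda> (\<phi> q)) t"
proof -
  have z: "\<Lambda> 0 = 0" using scale[of 0 0] by simp
  have "\<Lambda> (\<Sum>q\<in>A. f q) = (\<Sum>q\<in>A. \<Lambda> (f q))" for f and A :: "'k set"
    by (induction A rule: infinite_finite_induct) (simp_all add: z add)
  then show ?thesis by (simp add: lin_ext_def scale)
qed

lemma lin_ext_cong: "(\<And>q. q \<in> Poly_Mapping.keys t \<Longrightarrow> \<phi> q = \<psi> q) \<Longrightarrow> lin_ext \<phi> t = lin_ext \<psi> t"
  by (simp add: lin_ext_def)

lemma lin_ext_basis: "lin_ext (\<lambda>q. Poly_Mapping.single q 1) t = t"
  for t :: "'k \<Rightarrow>\<^sub>0 complex"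
proof (rule poly_mapping_eqI)
  fix k
  have *: "Poly_Mapping.lookup (\<Sum>q\<in>A. f q) k = (\<Sum>q\<in>A. Poly_Mapping.lookup (f q) k)"
    for f :: "'k \<Rightarrow> 'k \<Rightarrow>\<^sub>0 complex" and A
    by (induction A rule: infinite_finite_induct) (simp_all add: lookup_add)
  show "Poly_Mapping.lookup (lin_ext (\<lambda>q. Poly_Mapping.single q 1) t) k = Poly_Mapping.lookup t k"
    by (simp add: lin_ext_def * lookup_scaleC scaleC_complex_def lookup_single when_def
        if_distrib[of "\<lambda>x. _ * x"] in_keys_iff cong: if_cong)
qed

text \<open>\<open>L\<close> tensored with the identity, before passing to the quotient. Symbols are
  formal, so this is linear in the vector but additive in \<open>L\<close> only up to null vectors
  of the form.\<close>

definition tmap :: "('x \<Rightarrow> 'x) \<Rightarrow> ('x \<times> 'h \<Rightarrow>\<^sub>0 complex) \<Rightarrow> 'x \<times> 'h \<Rightarrow>\<^sub>0 complex" where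
  "tmap L = lin_ext (\<lambda>p. Poly_Mapping.single (L (fst p), snd p) 1)"

lemma tmap_add: "tmap L (f + g) = tmap L f + tmap L g"
  by (simp add: tmap_def lin_ext_add)

lemma tmap_scaleC: "tmap L (c *\<^sub>C f) = c *\<^sub>C tmap L f"
  by (simp add: tmap_def lin_ext_scaleC)

lemma tmap_diff: "tmap L (f - g) = tmap L f - tmap L g"
  by (simp add: tmap_def lin_ext_diff)

lemma tmap_single: "tmap L (Poly_Mapping.single (x, h) 1) = Poly_Mapping.single (L x, h) 1"
  by (simp add: tmap_def lin_ext_single scaleC_one)

lemma tmap_tmap: "tmap L (tmap L' f) = tmap (\<lambda>x. L (L' x)) f"
proof -
  have "tmap L (tmap L' f) = lin_ext (\<lambda>p. tmap L (Poly_Mapping.single (L' (fst p), snd p) 1)) f"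
    unfolding tmap_def[of L'] by (rule lin_ext_comp) (simp_all add: tmap_add tmap_scaleC)
  then show ?thesis unfolding tmap_single by (simp add: tmap_def)
qed

lemma tmap_fixed:
  assumes "\<And>p. p \<in> Poly_Mapping.keys f \<Longrightarrow> L (fst p) = fst p"
  shows "tmap L f = f"
proof -
  have "tmap L f = lin_ext (\<lambda>p. Poly_Mapping.single p 1) f"
    unfolding tmap_def by (rule lin_ext_cong) (use assms in simp)
  then show ?thesis by (simp add: lin_ext_basis)
qed

lemma keys_tmap: "Poly_Mapping.keys (tmap L f) \<subseteq> (\<lambda>p. (L (fst p), snd p)) ` Poly_Mapping.keys f"
  for L :: "'x \<Rightarrow> 'x" and f :: "'x \<times> 'h \<Rightarrow>\<^sub>0 complex"
proof -
  have keys_scale: "Poly_Mapping.keys (c *\<^sub>C t) \<subseteq> Poly_Mapping.keys t" for c and t :: "'x \<times> 'h \<Rightarrow>\<^sub>0 complex"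
    by (auto simp: in_keys_iff lookup_scaleC)
  let ?u = "\<lambda>p. Poly_Mapping.lookup f p *\<^sub>C Poly_Mapping.single (L (fst p), snd p) (1::complex)"
  have u: "Poly_Mapping.keys (?u p) \<subseteq> {(L (fst p), snd p)}" for p
    using keys_scale[of "Poly_Mapping.lookup f p" "Poly_Mapping.single (L (fst p), snd p) 1"] by simp
  have "Poly_Mapping.keys (\<Sum>p\<in>A. ?u p) \<subseteq> (\<lambda>p. (L (fst p), snd p)) ` A" if "finite A" for A
    using that
  proof induction
    case (insert p A)
    have "Poly_Mapping.keys (\<Sum>p\<in>insert p A. ?u p) \<subseteq> Poly_Mapping.keys (?u p) \<union> Poly_Mapping.keys (\<Sum>p\<in>A. ?u p)"
      unfolding sum.insert[OF insert.hyps] by (rule Poly_Mapping.keys_add)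
    then show ?case using u[of p] insert.IH unfolding image_insert by blast
  qed simp
  then show ?thesis by (simp add: tmap_def lin_ext_def)
qed

section \<open>The interior tensor product form\<close>

lemma bounded_bilinear_cinner: "bounded_bilinear (cinner :: 'h::chilbert_space \<Rightarrow> 'h \<Rightarrow> complex)"
proof
  show "\<exists>K. \<forall>a b::'h. norm (cinner a b) \<le> norm a * norm b * K"
    by (rule exI[of _ 1]) (use hilbert.cauchy_schwarz in auto)
qed (simp_all add: cinner_simps scaleC_of_real[symmetric] scaleR_conv_of_real)

lemmas tendsto_cinner = bounded_bilinear.tendsto[OF bounded_bilinear_cinner]

lemma hilbert_projection:
  fixes V :: "'h::chilbert_space set"
  assumes "closed V" "0 \<in> V" "\<And>x y. x \<in> V \<Longrightarrow> y \<in> V \<Longrightarrow> x + y \<in> V"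
    "\<And>c x. x \<in> V \<Longrightarrow> c *\<^sub>C x \<in> V"
  shows "\<exists>v\<in>V. \<forall>w\<in>V. cinner w (z - v) = 0"
proof (rule hilbert.projection_exists)
  fix Z :: "nat \<Rightarrow> 'h"
  assume "\<forall>e>0. \<exists>n0. \<forall>m\<ge>n0. \<forall>n\<ge>n0. seminorm_of cinner (Z m - Z n) < e"
  then have "Cauchy Z" by (simp add: Cauchy_def dist_norm)
  then obtain z where "Z \<longlonglongrightarrow> z" using Cauchy_convergent_iff convergent_def by blast
  then have "(\<lambda>n. Z n - z) \<longlonglongrightarrow> 0" by (simp add: LIM_zero_iff)
  then show "\<exists>z\<in>UNIV. (\<lambda>n. seminorm_of cinner (Z n - z)) \<longlonglongrightarrow> 0"
    using tendsto_norm_zero by auto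
next
  fix Z and z :: 'h
  assume Z: "\<And>n. Z n \<in> V" and "(\<lambda>n. seminorm_of cinner (Z n - z)) \<longlonglongrightarrow> 0"
  then have "(\<lambda>n. Z n - z) \<longlonglongrightarrow> 0" by (simp add: tendsto_norm_zero_iff)
  then have "Z \<longlonglongrightarrow> z" by (simp add: LIM_zero_iff)
  then show "z \<in> V" using Z assms(1) closed_sequentially by blast
qed (use assms in auto)

locale hilbert_module_rep =
  hilbert_cstar_module act ip + cstar_representation \<pi>
  for act :: "'x::{complex_normed_vector, banach} \<Rightarrow> 'b::cstar_algebra \<Rightarrow> 'x"
    and ip :: "'x \<Rightarrow> 'x \<Rightarrow> 'b" and \<pi> :: "'b \<Rightarrow> 'h::chilbert_space \<Rightarrow> 'h"
begin

lemma rep_sum_left: "\<pi> (\<Sum>i\<in>I. a i) h = (\<Sum>i\<in>I. \<pi> (a i) h)"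
  by (induction I rule: infinite_finite_induct) (simp_all add: rep_add_left)

lemma cinner_sum_right: "cinner h (\<Sum>i\<in>I. f i) = (\<Sum>i\<in>I. cinner (h::'h) (f i))"
  by (induction I rule: infinite_finite_induct) (simp_all add: cinner_add_right cinner_zero_right)

text \<open>The coefficients can be absorbed into the module: the double sum is <z, \<pi>(<y, y>) z>
  for the single vector \<open>y\<close>, and <y, y> is positive.\<close>

lemma cyclic_form_nonneg:
  assumes I: "finite I"
  shows "0 \<le> Re (\<Sum>i\<in>I. \<Sum>j\<in>I. cinner (\<pi> (b i) z) (\<pi> (ip (x i) (x j)) (\<pi> (b j) z)))"
proof -
  define y where "y = (\<Sum>i\<in>I. act (x i) (b i))"
  obtain a where a: "ip y y = star a * a" using ip_positive[of y] by (auto simp: cstar_positive_def)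
  have "ip y y = (\<Sum>i\<in>I. \<Sum>j\<in>I. star (b i) * (ip (x i) (x j) * b j))"
    unfolding y_def ip_sum_left
    unfolding ip_sum_right ip_act_left ip_act_right by (simp only: mult.assoc)
  then have "cinner z (\<pi> (ip y y) z) =
      (\<Sum>i\<in>I. \<Sum>j\<in>I. cinner (\<pi> (b i) z) (\<pi> (ip (x i) (x j)) (\<pi> (b j) z)))"
    using rep_star[of "star _"]
    by (simp add: rep_sum_left cinner_sum_right rep_mult star_star)
  moreover have "Re (cinner z (\<pi> (ip y y) z)) = (norm (\<pi> a z))\<^sup>2"
    by (simp only: a rep_norm_sq)
  ultimately show ?thesis by simp
qed

text \<open>Induction on the number of symbols: projecting all \<open>h i\<close> onto the cyclic subspace of
  \<open>h n\<close> splits the form into a cyclic part and a part to which index \<open>n\<close> no longer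
  contributes.\<close>

lemma form_nonneg:
  assumes "finite I"
  shows "0 \<le> Re (\<Sum>i\<in>I. \<Sum>j\<in>I. cinner (h i) (\<pi> (ip (x i) (x j)) (h j)))"
  using assms
proof (induction I arbitrary: h rule: finite_induct)
  case (insert n I)
  let ?G = "\<lambda>A f. (\<Sum>i\<in>A. \<Sum>j\<in>A. cinner (f i) (\<pi> (ip (x i) (x j)) (f j)))"
  define R where "R = range (\<lambda>b. \<pi> b (h n))"
  define V where "V = closure R"
  have R0: "0 \<in> R" unfolding R_def using rep_zero_left by (metis rangeI)
  have Radd: "a + b \<in> R" if "a \<in> R" "b \<in> R" for a b
    using that by (auto simp: R_def rep_add_left[symmetric])
  have Rscale: "c *\<^sub>C a \<in> R" if "a \<in> R" for a c
    using that by (auto simp: R_def rep_scale_left[symmetric])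
  have V0: "0 \<in> V" using R0 closure_subset by (auto simp: V_def)
  have Vadd: "a + b \<in> V" if "a \<in> V" "b \<in> V" for a b
  proof -
    from that obtain f g where "\<And>k. f k \<in> R" "f \<longlonglongrightarrow> a" "\<And>k. g k \<in> R" "g \<longlonglongrightarrow> b"
      unfolding V_def closure_sequential by metis
    then show ?thesis unfolding V_def closure_sequential
      by (intro exI[of _ "\<lambda>k. f k + g k"]) (auto intro: Radd tendsto_add)
  qed
  have bl: "bounded_linear ((*\<^sub>C) c :: 'h \<Rightarrow> 'h)" for c
    by (rule bounded_linear_intro[where K="cmod c"])
       (simp_all add: scaleC_add_right scaleC_of_real[symmetric] scaleC_scaleC norm_scaleC mult.commute)
  have Vscale: "c *\<^sub>C a \<in> V" if a: "a \<in> V" for a c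
  proof -
    have "(*\<^sub>C) c ` closure R \<subseteq> closure ((*\<^sub>C) c ` R)"
      by (rule closure_bounded_linear_image_subset[OF bl])
    also have "\<dots> \<subseteq> V" unfolding V_def by (rule closure_mono) (auto intro: Rscale)
    finally show ?thesis using a by (auto simp: V_def)
  qed
  have Vrep: "\<pi> b a \<in> V" if a: "a \<in> V" for a b
  proof -
    have "\<pi> b ` closure R \<subseteq> closure (\<pi> b ` R)"
      by (rule closure_bounded_linear_image_subset[OF rep_linear])
    also have "\<dots> \<subseteq> V" unfolding V_def by (rule closure_mono) (auto simp: R_def rep_mult[symmetric])
    finally show ?thesis using a by (auto simp: V_def)
  qed
  have "\<exists>v\<in>V. \<forall>w\<in>V. cinner w (h i - v) = 0" for i
    by (rule hilbert_projection) (use V0 Vadd Vscale in \<open>auto simp: V_def\<close>)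
  then obtain p where pV: "\<And>i. p i \<in> V" and p: "\<And>i w. w \<in> V \<Longrightarrow> cinner w (h i - p i) = 0"
    by metis
  define g where "g i = h i - p i" for i
  have gr: "cinner w (\<pi> b (g i)) = 0" if "w \<in> V" for w b i
    using rep_star[of b w "g i"] p[OF Vrep[OF that]] by (simp add: g_def)
  have gl: "cinner (g i) w = 0" if "w \<in> V" for w i
    using hilbert.S_commute[of w "g i"] p[OF that] by (simp add: g_def)
  \<comment> \<open>Without a unit \<open>h n\<close> itself may lie outside \<open>V\<close>. Still
    \<pi>(b) (h n) lies in \<open>V\<close>, so \<pi>(b) (g n) is in \<open>V\<close> and orthogonal
    to it.\<close>
  have gn: "\<pi> b (g n) = 0" for b
  proof -
    have "\<pi> b (h n) \<in> V" using closure_subset[of R] unfolding V_def R_def by blast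
    then have "\<pi> b (h n) + (-1) *\<^sub>C \<pi> b (p n) \<in> V" by (rule Vadd[OF _ Vscale[OF Vrep[OF pV]]])
    then have "\<pi> b (g n) \<in> V" by (simp add: g_def rep_diff_right)
    from gr[OF this] show ?thesis using cinner_eq_norm_sq[of "\<pi> b (g n)"] by simp
  qed
  have gn': "cinner (g n) (\<pi> b k) = 0" for b k
    using rep_star[of b "g n" k] gn hilbert.S_scale_left[of 0 k 0] by simp
  have split: "cinner (h i) (\<pi> a (h j)) = cinner (p i) (\<pi> a (p j)) + cinner (g i) (\<pi> a (g j))" for i j a
  proof -
    have h: "h i = p i + g i" for i by (simp add: g_def)
    have "cinner (p i) (\<pi> a (g j)) = 0" by (rule gr[OF pV])
    moreover have "cinner (g i) (\<pi> a (p j)) = 0" by (rule gl[OF Vrep[OF pV]])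
    ultimately show ?thesis by (simp only: h rep_add_right cinner_simps) simp
  qed
  have "?G (insert n I) h = ?G (insert n I) p + ?G (insert n I) g"
    by (simp only: split sum.distrib)
  moreover have "?G (insert n I) g = ?G I g"
    using insert.hyps by (simp add: gn gn' cinner_zero_right)
  moreover have "0 \<le> Re (?G I g)" by (rule insert.IH)
  moreover have "0 \<le> Re (?G (insert n I) p)"
  proof -
    \<comment> \<open>Vectors of \<open>V\<close> are limits of \<pi>(b k) (h n), which reduces the
      projected part to the cyclic case.\<close>
    have "\<exists>b. (\<lambda>k::nat. \<pi> (b k) (h n)) \<longlonglongrightarrow> p i" for i
    proof -
      obtain f where "\<And>k. f k \<in> R" and f: "f \<longlonglongrightarrow> p i"
        using pV[of i] unfolding V_def closure_sequential by metis
      then have "\<forall>k. \<exists>b. f k = \<pi> b (h n)" by (auto simp: R_def)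
      then obtain b where "\<And>k. f k = \<pi> (b k) (h n)" by metis
      then have "f = (\<lambda>k. \<pi> (b k) (h n))" by auto
      then show ?thesis using f by auto
    qed
    then obtain b where b: "\<And>i. (\<lambda>k::nat. \<pi> (b i k) (h n)) \<longlonglongrightarrow> p i" by metis
    have "(\<lambda>k. Re (?G (insert n I) (\<lambda>i. \<pi> (b i k) (h n)))) \<longlonglongrightarrow> Re (?G (insert n I) p)"
      by (intro tendsto_intros tendsto_cinner bounded_linear.tendsto[OF rep_linear] b)
    moreover have "0 \<le> Re (?G (insert n I) (\<lambda>i. \<pi> (b i k) (h n)))" for k
      by (rule cyclic_form_nonneg) (use insert.hyps in simp)
    ultimately show ?thesis by (intro LIMSEQ_le_const) auto
  qed
  ultimately show ?case by simp
qed simp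

section \<open>The semi-inner product on the free space and operators acting on it\<close>

abbreviation symbol_form :: "'x \<times> 'h \<Rightarrow> 'x \<times> 'h \<Rightarrow> complex" where
  "symbol_form p q \<equiv> cinner (snd p) (\<pi> (ip (fst p) (fst q)) (snd q))"

abbreviation tform :: "('x \<times> 'h \<Rightarrow>\<^sub>0 complex) \<Rightarrow> ('x \<times> 'h \<Rightarrow>\<^sub>0 complex) \<Rightarrow> complex" where
  "tform \<equiv> tensor_form ip \<pi>"

lemma tform_eq: "tform s t = (\<Sum>p\<in>Poly_Mapping.keys s. \<Sum>q\<in>Poly_Mapping.keys t.
    cnj (Poly_Mapping.lookup s p) * Poly_Mapping.lookup t q * symbol_form p q)"
  by (simp add: tensor_form_def case_prod_unfold)

lemma tform_lin_ext: "tform s t = lin_ext (\<lambda>q. \<Sum>p\<in>Poly_Mapping.keys s.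
    cnj (Poly_Mapping.lookup s p) * symbol_form p q) t"
  unfolding tform_eq lin_ext_def scaleC_complex_def
  by (subst sum.swap) (simp add: sum_distrib_left mult_ac)

lemma symbol_form_commute: "symbol_form q p = cnj (symbol_form p q)"
  using hilbert.S_commute[of "snd p" "\<pi> (ip (fst p) (fst q)) (snd q)"]
    rep_star[of "ip (fst q) (fst p)" "snd q" "snd p"] by (simp add: star_ip)

lemma tform_commute: "tform t s = cnj (tform s t)"
  unfolding tform_eq
  by (subst sum.swap) (simp add: symbol_form_commute[symmetric] mult_ac)

lemma tform_nonneg: "0 \<le> Re (tform s s)"
proof -
  let ?h = "\<lambda>p. Poly_Mapping.lookup s p *\<^sub>C snd p"
  have "tform s s = (\<Sum>p\<in>Poly_Mapping.keys s. \<Sum>q\<in>Poly_Mapping.keys s.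
      cinner (?h p) (\<pi> (ip (fst p) (fst q)) (?h q)))"
    unfolding tform_eq by (simp add: rep_scale_right cinner_simps mult_ac)
  then show ?thesis using form_nonneg[of "Poly_Mapping.keys s" ?h fst] by simp
qed

sublocale tensor: semi_inner UNIV tform
proof
  show "tform s (t + u) = tform s t + tform s u" for s t u
    unfolding tform_lin_ext by (rule lin_ext_add)
  show "tform s (c *\<^sub>C t) = c * tform s t" for s t c
    unfolding tform_lin_ext lin_ext_scaleC by (rule scaleC_complex_def)
qed (simp_all add: tform_nonneg, rule tform_commute)

text \<open>\<open>L\<close> may identify different symbols, so the keys of \<open>tmap L g\<close>
  are hard to describe; linearity keeps the sum over the keys of \<open>g\<close>.\<close>

lemma tform_tmap_right:
  "tform f (tmap L g) = (\<Sum>p\<in>Poly_Mapping.keys f. \<Sum>q\<in>Poly_Mapping.keys g.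
     cnj (Poly_Mapping.lookup f p) * Poly_Mapping.lookup g q *
     cinner (snd p) (\<pi> (ip (fst p) (L (fst q))) (snd q)))"
proof -
  have "tform f (tmap L g) = lin_ext (\<lambda>q. tform f (Poly_Mapping.single (L (fst q), snd q) 1)) g"
    unfolding tmap_def
    by (rule lin_ext_comp) (simp_all add: tensor.S_add_right tensor.S_scale_right scaleC_complex_def)
  also have "\<dots> = lin_ext (\<lambda>q. \<Sum>p\<in>Poly_Mapping.keys f. cnj (Poly_Mapping.lookup f p) *
      cinner (snd p) (\<pi> (ip (fst p) (L (fst q))) (snd q))) g"
    by (simp add: tform_lin_ext[of f "Poly_Mapping.single _ _"] lin_ext_single scaleC_one)
  also have "\<dots> = (\<Sum>p\<in>Poly_Mapping.keys f. \<Sum>q\<in>Poly_Mapping.keys g.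
     cnj (Poly_Mapping.lookup f p) * Poly_Mapping.lookup g q *
     cinner (snd p) (\<pi> (ip (fst p) (L (fst q))) (snd q)))"
    unfolding lin_ext_def scaleC_complex_def
    by (subst sum.swap) (simp add: sum_distrib_left mult_ac)
  finally show ?thesis .
qed

lemma tform_tmap_adj: "adj A A' \<Longrightarrow> tform (tmap A f) g = tform f (tmap A' g)"
proof -
  assume A: "adj A A'"
  have *: "cnj (cinner h (\<pi> (ip y (A x)) k)) = cinner k (\<pi> (ip x (A' y)) h)" for h k x y
    using symbol_form_commute[of "(y, h)" "(A x, k)"] by (simp add: adjD[OF A])
  have "tform (tmap A f) g = cnj (tform g (tmap A f))" by (rule tform_commute)
  also have "\<dots> = tform f (tmap A' g)"
    unfolding tform_tmap_right
    by (subst sum.swap) (simp add: * mult_ac)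
  finally show ?thesis .
qed

lemma tform_tmap_diff: "tform f (tmap (\<lambda>x. A x - B x) g) = tform f (tmap A g) - tform f (tmap B g)"
  unfolding tform_tmap_right
  by (simp add: ip_diff_right rep_diff_left cinner_simps right_diff_distrib sum_subtractf)

lemma tensor_norm_single_sq:
  "(tensor.nrm (Poly_Mapping.single (x, h) 1))\<^sup>2 = Re (cinner h (\<pi> (ip x x) h))"
  by (simp add: tensor.nrm_sq tform_eq)

lemma tensor_norm_single: "tensor.nrm (Poly_Mapping.single (x, h) 1) \<le> norm x * norm h"
proof (rule power2_le_imp_le)
  have "Re (cinner h (\<pi> (ip x x) h)) \<le> norm h * norm (\<pi> (ip x x) h)" by (rule cinner_Re_le)
  also have "\<dots> \<le> norm h * (norm (ip x x) * norm h)"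
    by (intro mult_left_mono rep_contractive) simp
  also have "\<dots> = (norm x * norm h)\<^sup>2"
    by (simp add: norm_sq_ip[symmetric] power_mult_distrib) (simp add: power2_eq_square)
  finally show "(tensor.nrm (Poly_Mapping.single (x, h) 1))\<^sup>2 \<le> (norm x * norm h)\<^sup>2"
    by (simp only: tensor_norm_single_sq)
qed simp

lemma tensor_norm_tmap_le_sum:
  "tensor.nrm (tmap L f) \<le> (\<Sum>p\<in>Poly_Mapping.keys f.
     cmod (Poly_Mapping.lookup f p) * (norm (L (fst p)) * norm (snd p)))"
proof -
  have "tensor.nrm (tmap L f) \<le> (\<Sum>p\<in>Poly_Mapping.keys f.
      tensor.nrm (Poly_Mapping.lookup f p *\<^sub>C Poly_Mapping.single (L (fst p), snd p) 1))"
    unfolding tmap_def lin_ext_def using tensor.nrm_sum by simp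
  also have "\<dots> \<le> (\<Sum>p\<in>Poly_Mapping.keys f.
     cmod (Poly_Mapping.lookup f p) * (norm (L (fst p)) * norm (snd p)))"
    by (intro sum_mono) (simp add: tensor.nrm_scale mult_left_mono tensor_norm_single)
  finally show ?thesis .
qed

text \<open>Iterating \<open>|J f|\<^sup>2 \<le> |f| |J\<^sup>2 f|\<close> recovers the operator norm of \<open>J\<close> on \<open>X\<close> from
  the crude growth of \<open>|J\<^sup>m f|\<close>.\<close>

lemma tensor_norm_tmap_selfadjoint:
  assumes J: "adj J J" and bd: "\<And>x. norm (J x) \<le> j * norm x" and j: "0 \<le> j"
  shows "tensor.nrm (tmap J f) \<le> j * tensor.nrm f"
proof -
  have Jk: "adj (J ^^ k) (J ^^ k)" for k
  proof (induction k)
    case (Suc k)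
    have "adj (\<lambda>x. J ((J ^^ k) x)) (\<lambda>x. (J ^^ k) (J x))" by (rule adj_comp[OF J Suc])
    then show ?case by (simp add: adj_def funpow_swap1)
  qed (simp add: adj_def)
  have Jn: "norm ((J ^^ k) x) \<le> j ^ k * norm x" for k x
  proof (induction k)
    case (Suc k)
    have "norm (J ((J ^^ k) x)) \<le> j * (j ^ k * norm x)"
      using bd[of "(J ^^ k) x"] mult_left_mono[OF Suc j] by linarith
    then show ?case by (simp add: mult.assoc)
  qed simp
  define D where "D = (\<Sum>p\<in>Poly_Mapping.keys f. cmod (Poly_Mapping.lookup f p) * (norm (fst p) * norm (snd p)))"
  define b where "b k = tensor.nrm (tmap (J ^^ (2 ^ k)) f)" for k
  have bD: "b k \<le> D * j ^ (2 ^ k)" for k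
  proof -
    have "b k \<le> (\<Sum>p\<in>Poly_Mapping.keys f. cmod (Poly_Mapping.lookup f p) * (norm ((J ^^ (2 ^ k)) (fst p)) * norm (snd p)))"
      unfolding b_def by (rule tensor_norm_tmap_le_sum)
    also have "\<dots> \<le> (\<Sum>p\<in>Poly_Mapping.keys f. cmod (Poly_Mapping.lookup f p) * ((j ^ (2 ^ k) * norm (fst p)) * norm (snd p)))"
      by (intro sum_mono mult_left_mono mult_right_mono Jn) auto
    also have "\<dots> = D * j ^ (2 ^ k)" by (simp add: D_def sum_distrib_left sum_distrib_right mult_ac)
    finally show ?thesis .
  qed
  have b2: "(b k)\<^sup>2 \<le> tensor.nrm f * b (Suc k)" for k
  proof -
    have "(b k)\<^sup>2 = Re (tform f (tmap (\<lambda>x. (J ^^ (2 ^ k)) ((J ^^ (2 ^ k)) x)) f))"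
      by (simp add: b_def tensor.nrm_sq tform_tmap_adj[OF Jk] tmap_tmap)
    also have "(\<lambda>x. (J ^^ (2 ^ k)) ((J ^^ (2 ^ k)) x)) = J ^^ (2 ^ Suc k)"
      by (simp add: funpow_add[symmetric] fun_eq_iff mult_2 flip: comp_apply[of "J ^^ (2 ^ k)"])
    also have "Re (tform f (tmap (J ^^ (2 ^ Suc k)) f)) \<le> tensor.nrm f * b (Suc k)"
      unfolding b_def by (rule order_trans[OF complex_Re_le_cmod]) (simp add: tensor.cauchy_schwarz)
    finally show ?thesis .
  qed
  have b0: "b 0 = tensor.nrm (tmap J f)" by (simp add: b_def)
  show ?thesis
  proof (cases "tensor.nrm f = 0")
    case True
    then show ?thesis using b2[of 0] by (simp add: b0)
  next
    case False
    then have n: "tensor.nrm f > 0" using tensor.nrm_ge0[OF UNIV_I, of f] by linarith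
    define r where "r = b 0 / tensor.nrm f"
    have r0: "r \<ge> 0" using n by (simp add: r_def b0)
    \<comment> \<open>\<open>r\<close> is the ratio |J f| / |f|. Together with \<open>bD\<close>
      this bounds the powers of r / j with exponents 2^k, which is impossible for r > j.\<close>
    have rk: "r ^ (2 ^ k) \<le> b k / tensor.nrm f" for k
    proof (induction k)
      case (Suc k)
      have "r ^ (2 ^ Suc k) = (r ^ (2 ^ k))\<^sup>2" by (simp add: power_mult[symmetric] mult.commute)
      also have "\<dots> \<le> (b k / tensor.nrm f)\<^sup>2" using Suc r0 by (intro power_mono) auto
      also have "\<dots> = (b k)\<^sup>2 / (tensor.nrm f)\<^sup>2" by (simp add: power_divide)
      also have "\<dots> \<le> (tensor.nrm f * b (Suc k)) / (tensor.nrm f)\<^sup>2"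
        by (intro divide_right_mono b2) simp
      also have "\<dots> = b (Suc k) / tensor.nrm f" using n by (simp add: power2_eq_square)
      finally show ?case .
    qed (simp add: r_def)
    have "r \<le> j"
    proof (rule ccontr)
      assume "\<not> r \<le> j"
      then have rj: "r > j" by simp
      have bound: "r ^ (2 ^ k) \<le> (D / tensor.nrm f) * j ^ (2 ^ k)" for k
        using order_trans[OF rk divide_right_mono[OF bD]] n by (simp add: less_imp_le)
      have j0: "j > 0"
      proof (rule ccontr)
        assume "\<not> j > 0"
        then have "j = 0" using j by simp
        then show False using bound[of 0] rj by simp
      qed
      define q where "q = r / j"
      have q1: "q > 1" using rj j0 by (simp add: q_def)
      obtain m where m: "q ^ m > D / tensor.nrm f" using real_arch_pow[OF q1] by blast
      have "q ^ m \<le> q ^ (2 ^ m)" using q1 by (intro power_increasing) (auto simp: less_imp_le)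
      also have "\<dots> \<le> D / tensor.nrm f"
        using bound[of m] j0 by (simp add: q_def power_divide pos_divide_le_eq)
      finally show False using m by simp
    qed
    then show ?thesis using n by (simp add: r_def b0 pos_divide_le_eq)
  qed
qed

lemma tensor_norm_tmap_proj:
  assumes "proj_onto P W"
  shows "tensor.nrm (tmap P f) \<le> tensor.nrm f"
  using tensor_norm_tmap_selfadjoint[OF proj_ontoD(1)[OF assms], of 1 f] proj_onto_norm[OF assms]
  by simp

text \<open>Faithfulness enters here: elementary tensors x \<otimes> h alone recover the norm of
  \<open>x\<close>, because their squared norms are the values of the quadratic form of \<pi>(<x,
  x>).\<close>

theorem norm_le_if_tensor_norm_le:
  assumes inj: "inj \<pi>" and k: "0 \<le> k"
    and le: "\<And>h. tensor.nrm (Poly_Mapping.single (x, h) 1) \<le> k * norm h"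
  shows "norm x \<le> k"
proof -
  have "norm (ip x x) \<le> k\<^sup>2"
  proof (rule rep_norm_le_if_positive[OF inj k ip_positive])
    fix h
    have "(tensor.nrm (Poly_Mapping.single (x, h) 1))\<^sup>2 \<le> (k * norm h)\<^sup>2"
      by (rule power_mono[OF le]) simp
    then show "Re (cinner h (\<pi> (ip x x) h)) \<le> (k * norm h)\<^sup>2" by (simp only: tensor_norm_single_sq)
  qed
  then have "(norm x)\<^sup>2 \<le> k\<^sup>2" by (simp add: norm_sq_ip)
  then show ?thesis using k by (rule power2_le_imp_le)
qed

end

section \<open>The Hausdorff completion as a Hilbert space\<close>

locale semi_inner_UNIV = semi_inner UNIV s for s :: "'v::complex_vector \<Rightarrow> 'v \<Rightarrow> complex"
begin

definition seq_inner :: "(nat \<Rightarrow> 'v) \<Rightarrow> (nat \<Rightarrow> 'v) \<Rightarrow> complex" where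
  "seq_inner z w = lim (\<lambda>n. s (z n) (w n))"

lemma cauchy_seqsD:
  "z \<in> cauchy_seqs s \<Longrightarrow> e > 0 \<Longrightarrow> \<exists>n0. \<forall>m\<ge>n0. \<forall>n\<ge>n0. nrm (z m - z n) < e"
  by (simp add: cauchy_seqs_def)

lemma cauchy_seqs_add:
  assumes z: "z \<in> cauchy_seqs s" and w: "w \<in> cauchy_seqs s"
  shows "z + w \<in> cauchy_seqs s"
  unfolding cauchy_seqs_def
proof (intro CollectI allI impI)
  fix e :: real assume "e > 0"
  then have e: "e / 2 > 0" by simp
  obtain k where k: "\<forall>m\<ge>k. \<forall>n\<ge>k. nrm (z m - z n) < e / 2" using cauchy_seqsD[OF z e] by blast
  obtain l where l: "\<forall>m\<ge>l. \<forall>n\<ge>l. nrm (w m - w n) < e / 2" using cauchy_seqsD[OF w e] by blast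
  have "nrm ((z + w) m - (z + w) n) < e" if "m \<ge> max k l" "n \<ge> max k l" for m n
  proof -
    have "(z + w) m - (z + w) n = (z m - z n) + (w m - w n)" by simp
    then have "nrm ((z + w) m - (z + w) n) \<le> nrm (z m - z n) + nrm (w m - w n)"
      by (simp only: nrm_triangle[OF UNIV_I UNIV_I])
    moreover have "nrm (z m - z n) < e / 2" "nrm (w m - w n) < e / 2" using k l that by auto
    ultimately show ?thesis by linarith
  qed
  then show "\<exists>n0. \<forall>m\<ge>n0. \<forall>n\<ge>n0. nrm ((z + w) m - (z + w) n) < e" by blast
qed

lemma cauchy_seqs_map:
  assumes z: "z \<in> cauchy_seqs s"
    and T: "\<And>u v. nrm (T u - T v) \<le> B * nrm (u - v)"
  shows "(\<lambda>n. T (z n)) \<in> cauchy_seqs s"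
  unfolding cauchy_seqs_def
proof (intro CollectI allI impI)
  fix e :: real assume "e > 0"
  then have e: "e / (\<bar>B\<bar> + 1) > 0" by simp
  obtain k where k: "\<forall>m\<ge>k. \<forall>n\<ge>k. nrm (z m - z n) < e / (\<bar>B\<bar> + 1)"
    using cauchy_seqsD[OF z e] by blast
  have "nrm (T (z m) - T (z n)) < e" if "m \<ge> k" "n \<ge> k" for m n
  proof -
    have "nrm (T (z m) - T (z n)) \<le> B * nrm (z m - z n)" by (rule T)
    also have "\<dots> \<le> (\<bar>B\<bar> + 1) * nrm (z m - z n)" by (intro mult_right_mono) auto
    also have "\<dots> < (\<bar>B\<bar> + 1) * (e / (\<bar>B\<bar> + 1))" using k that by (intro mult_strict_left_mono) auto
    finally show ?thesis by simp
  qed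
  then show "\<exists>n0. \<forall>m\<ge>n0. \<forall>n\<ge>n0. nrm (T (z m) - T (z n)) < e" by blast
qed

lemma cauchy_seqs_scale: "z \<in> cauchy_seqs s \<Longrightarrow> c *\<^sub>C z \<in> cauchy_seqs s"
  using cauchy_seqs_map[of z "\<lambda>u. c *\<^sub>C u" "cmod c"]
  by (simp add: scaleC_fun_def scaleC_diff_right[symmetric] nrm_scale)

lemma cauchy_seqs_const: "(\<lambda>_. v) \<in> cauchy_seqs s"
  by (simp add: cauchy_seqs_def)

lemma cauchy_seqs_bounded:
  assumes z: "z \<in> cauchy_seqs s"
  shows "\<exists>B\<ge>0. \<forall>n. nrm (z n) \<le> B"
proof -
  obtain k where k: "\<forall>m\<ge>k. \<forall>n\<ge>k. nrm (z m - z n) < 1" using cauchy_seqsD[OF z, of 1] by auto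
  define B where "B = (\<Sum>i\<le>k. nrm (z i)) + 1"
  have B: "nrm (z i) + 1 \<le> B" if "i \<le> k" for i
    unfolding B_def using member_le_sum[of i "{..k}" "\<lambda>i. nrm (z i)"] that by simp
  have "nrm (z n) \<le> B" for n
  proof (cases "n \<le> k")
    case True
    then show ?thesis using B[of n] by simp
  next
    case False
    have "nrm (z n) \<le> nrm (z n - z k) + nrm (z k)" using nrm_triangle[of "z n - z k" "z k"] by simp
    also have "\<dots> \<le> 1 + nrm (z k)" using k False by (simp add: less_imp_le)
    also have "\<dots> \<le> B" using B[of k] by simp
    finally show ?thesis .
  qed
  moreover have "0 \<le> B" unfolding B_def by (intro add_nonneg_nonneg sum_nonneg) auto
  ultimately show ?thesis by blast
qed

lemma seq_inner_lim:
  assumes z: "z \<in> cauchy_seqs s" and w: "w \<in> cauchy_seqs s"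
  shows "(\<lambda>n. s (z n) (w n)) \<longlonglongrightarrow> seq_inner z w"
proof -
  obtain A where A: "A \<ge> 0" "\<And>n. nrm (z n) \<le> A" using cauchy_seqs_bounded[OF z] by blast
  obtain B where B: "B \<ge> 0" "\<And>n. nrm (w n) \<le> B" using cauchy_seqs_bounded[OF w] by blast
  have "Cauchy (\<lambda>n. s (z n) (w n))"
    unfolding Cauchy_def dist_norm
  proof (intro allI impI)
    fix e :: real assume e: "e > 0"
    \<comment> \<open>The summands 1 keep the denominators positive when a bound is 0.\<close>
    have eA: "e / (2 * (A + 1)) > 0" and eB: "e / (2 * (B + 1)) > 0" using e A B by auto
    obtain k where k: "\<forall>m\<ge>k. \<forall>n\<ge>k. nrm (z m - z n) < e / (2 * (B + 1))"
      using cauchy_seqsD[OF z eB] by blast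
    obtain l where l: "\<forall>m\<ge>l. \<forall>n\<ge>l. nrm (w m - w n) < e / (2 * (A + 1))"
      using cauchy_seqsD[OF w eA] by blast
    have "cmod (s (z m) (w m) - s (z n) (w n)) < e" if "m \<ge> max k l" "n \<ge> max k l" for m n
    proof -
      have "s (z m) (w m) - s (z n) (w n) = s (z m - z n) (w m) + s (z n) (w m - w n)"
        by (simp add: S_simps)
      then have "cmod (s (z m) (w m) - s (z n) (w n))
          \<le> cmod (s (z m - z n) (w m)) + cmod (s (z n) (w m - w n))"
        by (simp only: norm_triangle_ineq)
      also have "\<dots> \<le> nrm (z m - z n) * nrm (w m) + nrm (z n) * nrm (w m - w n)"
        by (intro add_mono cauchy_schwarz) auto
      also have "\<dots> \<le> nrm (z m - z n) * (B + 1) + (A + 1) * nrm (w m - w n)"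
        using A(2)[of n] B(2)[of m] by (intro add_mono mult_left_mono mult_right_mono) auto
      also have "\<dots> < e / (2 * (B + 1)) * (B + 1) + (A + 1) * (e / (2 * (A + 1)))"
        using k l that A B by (intro add_strict_mono mult_strict_right_mono mult_strict_left_mono) auto
      also have "\<dots> = e / 2 + e / 2"
      proof -
        have "A + 1 \<noteq> 0" "B + 1 \<noteq> 0" using A(1) B(1) by linarith+
        moreover have "e / (2 * x) * x = e / 2" "x * (e / (2 * x)) = e / 2" if "x \<noteq> 0" for x
          using that by simp_all
        ultimately show ?thesis by presburger
      qed
      also have "\<dots> = e" by simp
      finally show ?thesis .
    qed
    then show "\<exists>M. \<forall>m\<ge>M. \<forall>n\<ge>M. cmod (s (z m) (w m) - s (z n) (w n)) < e" by blast
  qed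
  then show ?thesis unfolding seq_inner_def by (simp add: Cauchy_convergent_iff convergent_LIMSEQ_iff)
qed

sublocale seq: semi_inner "cauchy_seqs s" seq_inner
proof
  show "0 \<in> cauchy_seqs s" using cauchy_seqs_const[of 0] by (simp add: zero_fun_def)
next
  fix x y z assume x: "x \<in> cauchy_seqs s" and y: "y \<in> cauchy_seqs s" and z: "z \<in> cauchy_seqs s"
  have "(\<lambda>n. s (x n) ((y + z) n)) \<longlonglongrightarrow> seq_inner x y + seq_inner x z"
    using tendsto_add[OF seq_inner_lim[OF x y] seq_inner_lim[OF x z]] by (simp add: S_simps)
  then show "seq_inner x (y + z) = seq_inner x y + seq_inner x z"
    using LIMSEQ_unique[OF seq_inner_lim[OF x cauchy_seqs_add[OF y z]]] by blast
next
  fix x y c assume x: "x \<in> cauchy_seqs s" and y: "y \<in> cauchy_seqs s"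
  have "(\<lambda>n. s (x n) ((c *\<^sub>C y) n)) \<longlonglongrightarrow> c * seq_inner x y"
    using tendsto_mult_left[OF seq_inner_lim[OF x y], of c] by (simp add: S_simps scaleC_fun_def)
  then show "seq_inner x (c *\<^sub>C y) = c * seq_inner x y"
    using LIMSEQ_unique[OF seq_inner_lim[OF x cauchy_seqs_scale[OF y]]] by blast
next
  fix x y assume x: "x \<in> cauchy_seqs s" and y: "y \<in> cauchy_seqs s"
  have "(\<lambda>n. s (y n) (x n)) \<longlonglongrightarrow> cnj (seq_inner x y)"
    using tendsto_cnj[OF seq_inner_lim[OF x y]] unfolding S_commute[OF UNIV_I UNIV_I, symmetric] .
  then show "seq_inner y x = cnj (seq_inner x y)"
    using LIMSEQ_unique[OF seq_inner_lim[OF y x]] by blast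
next
  fix x assume x: "x \<in> cauchy_seqs s"
  show "0 \<le> Re (seq_inner x x)"
    by (rule LIMSEQ_le_const[OF tendsto_Re[OF seq_inner_lim[OF x x]]]) (simp add: S_nonneg)
qed (simp_all add: cauchy_seqs_add cauchy_seqs_scale)

lemma seq_nrm_lim: "z \<in> cauchy_seqs s \<Longrightarrow> (\<lambda>n. nrm (z n)) \<longlonglongrightarrow> seq.nrm z"
  unfolding seminorm_of_def by (intro tendsto_real_sqrt tendsto_Re seq_inner_lim)

lemma seq_nrm_le:
  assumes "z \<in> cauchy_seqs s" "w \<in> cauchy_seqs s" "\<And>n. nrm (z n) \<le> B * nrm (w n)"
  shows "seq.nrm z \<le> B * seq.nrm w"
  by (rule LIMSEQ_le[OF seq_nrm_lim[OF assms(1)] tendsto_mult_left[OF seq_nrm_lim[OF assms(2)]]])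
     (use assms(3) in auto)

lemma seq_nrm_const: "seq.nrm (\<lambda>_. v) = nrm v"
  using LIMSEQ_unique[OF seq_nrm_lim[OF cauchy_seqs_const[of v]] tendsto_const] .

theorem cauchy_seqs_complete:
  assumes Z: "\<And>n. Z n \<in> cauchy_seqs s"
    and cauchy: "\<forall>e>0. \<exists>n0. \<forall>m\<ge>n0. \<forall>n\<ge>n0. seq.nrm (Z m - Z n) < e"
  shows "\<exists>z\<in>cauchy_seqs s. (\<lambda>n. seq.nrm (Z n - z)) \<longlonglongrightarrow> 0"
proof -
  have "\<exists>N. \<forall>m\<ge>N. \<forall>n\<ge>N. nrm (Z k m - Z k n) < inverse (real (Suc k))" for k
    by (rule cauchy_seqsD[OF Z]) simp
  then obtain N where N: "\<And>k m n. m \<ge> N k \<Longrightarrow> n \<ge> N k \<Longrightarrow> nrm (Z k m - Z k n) < inverse (real (Suc k))"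
    by metis
  \<comment> \<open>A diagonal choice: past \<open>N k\<close> the sequence \<open>Z k\<close>
    varies by less than 1 / (k + 1), so it is that close to the constant sequence with value
    \<open>z k\<close>.\<close>
  define z where "z k = Z k (N k)" for k
  have near: "seq.nrm (Z k - (\<lambda>_. z k)) \<le> inverse (real (Suc k))" for k
  proof (rule LIMSEQ_le_const2)
    show "(\<lambda>n. nrm ((Z k - (\<lambda>_. z k)) n)) \<longlonglongrightarrow> seq.nrm (Z k - (\<lambda>_. z k))"
      by (rule seq_nrm_lim[OF seq.diff_closed[OF Z cauchy_seqs_const]])
    show "\<exists>M. \<forall>n\<ge>M. nrm ((Z k - (\<lambda>_. z k)) n) \<le> inverse (real (Suc k))"
      by (intro exI[of _ "N k"] allI impI) (simp add: z_def less_imp_le[OF N] del: of_nat_Suc)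
  qed
  have zz: "nrm (z k - z l) \<le> inverse (real (Suc k)) + inverse (real (Suc l)) + seq.nrm (Z k - Z l)" for k l
  proof -
    note c = cauchy_seqs_const
    have "nrm (z k - z l) = seq.nrm ((\<lambda>_. z k) - (\<lambda>_. z l))"
      using seq_nrm_const[of "z k - z l"] by (simp add: fun_diff_def)
    also have "\<dots> \<le> seq.nrm ((\<lambda>_. z k) - Z k) + seq.nrm (Z k - (\<lambda>_. z l))"
      by (rule seq.nrm_triangle3[OF c Z c])
    also have "seq.nrm (Z k - (\<lambda>_. z l)) \<le> seq.nrm (Z k - Z l) + seq.nrm (Z l - (\<lambda>_. z l))"
      by (rule seq.nrm_triangle3[OF Z Z c])
    finally show ?thesis using near[of k] near[of l] seq.nrm_commute[OF c Z, of "z k" k] by linarith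
  qed
  have small: "\<exists>M. \<forall>k\<ge>M. inverse (real (Suc k)) < e" if e: "e > 0" for e :: real
  proof -
    obtain M where M: "inverse (real (Suc M)) < e" using reals_Archimedean[OF e] by blast
    have "inverse (real (Suc k)) \<le> inverse (real (Suc M))" if "k \<ge> M" for k
      using that by (simp add: field_simps)
    then show ?thesis using M by (meson le_less_trans)
  qed
  have zc: "\<exists>M. \<forall>k\<ge>M. \<forall>l\<ge>M. nrm (z k - z l) < e" if e: "e > 0" for e
  proof -
    obtain A where A: "\<forall>k\<ge>A. inverse (real (Suc k)) < e / 3" using small[of "e/3"] e by auto
    obtain B where B: "\<forall>m\<ge>B. \<forall>n\<ge>B. seq.nrm (Z m - Z n) < e / 3"
      using cauchy e by (metis zero_less_divide_iff zero_less_numeral)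
    have "nrm (z k - z l) < e" if "k \<ge> max A B" "l \<ge> max A B" for k l
    proof -
      have "inverse (real (Suc k)) < e / 3" "inverse (real (Suc l)) < e / 3" "seq.nrm (Z k - Z l) < e / 3"
        using A B that by auto
      then show ?thesis using zz[of k l] by linarith
    qed
    then show ?thesis by blast
  qed
  then have z: "z \<in> cauchy_seqs s" by (simp add: cauchy_seqs_def)
  have "\<exists>M. \<forall>k\<ge>M. seq.nrm (Z k - z) < e" if e: "e > 0" for e
  proof -
    obtain A where A: "\<forall>k\<ge>A. inverse (real (Suc k)) < e / 2" using small[of "e/2"] e by auto
    obtain B where B: "\<forall>k\<ge>B. \<forall>l\<ge>B. nrm (z k - z l) < e / 2" using zc[of "e/2"] e by auto
    have "seq.nrm (Z k - z) < e" if k: "k \<ge> max A B" for k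
    proof -
      note c = cauchy_seqs_const
      have "seq.nrm ((\<lambda>_. z k) - z) \<le> e / 2"
      proof (rule LIMSEQ_le_const2)
        show "(\<lambda>n. nrm (((\<lambda>_. z k) - z) n)) \<longlonglongrightarrow> seq.nrm ((\<lambda>_. z k) - z)"
          by (rule seq_nrm_lim[OF seq.diff_closed[OF c z]])
        show "\<exists>M. \<forall>n\<ge>M. nrm (((\<lambda>_. z k) - z) n) \<le> e / 2"
          using B k by (auto intro!: exI[of _ B] less_imp_le)
      qed
      moreover have "seq.nrm (Z k - z) \<le> seq.nrm (Z k - (\<lambda>_. z k)) + seq.nrm ((\<lambda>_. z k) - z)"
        by (rule seq.nrm_triangle3[OF Z c z])
      moreover have "inverse (real (Suc k)) < e / 2" using A k by simp
      ultimately show ?thesis using near[of k] by linarith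
    qed
    then show ?thesis by blast
  qed
  then have "(\<lambda>n. seq.nrm (Z n - z)) \<longlonglongrightarrow> 0"
    unfolding LIMSEQ_iff using seq.nrm_ge0[OF seq.diff_closed[OF Z z]] by (simp add: abs_of_nonneg)
  then show ?thesis using z by blast
qed

section \<open>The quotient by null sequences and its operations\<close>

definition cls :: "(nat \<Rightarrow> 'v) \<Rightarrow> (nat \<Rightarrow> 'v) set" where
  "cls z = null_rel s `` {z}"

lemma null_rel_iff:
  "(z, w) \<in> null_rel s \<longleftrightarrow> z \<in> cauchy_seqs s \<and> w \<in> cauchy_seqs s \<and> seq.nrm (z - w) = 0"
proof -
  have "(\<lambda>n. nrm (z n - w n)) \<longlonglongrightarrow> 0 \<longleftrightarrow> seq.nrm (z - w) = 0"
    if "z \<in> cauchy_seqs s" "w \<in> cauchy_seqs s"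
    using seq_nrm_lim[OF seq.diff_closed[OF that]] LIMSEQ_unique by auto
  then show ?thesis by (auto simp: null_rel_def)
qed

lemma equiv_null_rel: "equiv (cauchy_seqs s) (null_rel s)"
proof (rule equivI)
  show "null_rel s \<subseteq> cauchy_seqs s \<times> cauchy_seqs s" by (auto simp: null_rel_def)
  show "refl_on (cauchy_seqs s) (null_rel s)" by (auto simp: refl_on_def null_rel_iff)
  show "sym (null_rel s)" by (auto simp: sym_def null_rel_iff seq.nrm_commute)
  show "trans (null_rel s)"
  proof (rule transI)
    fix x y z assume "(x, y) \<in> null_rel s" "(y, z) \<in> null_rel s"
    then show "(x, z) \<in> null_rel s"
      using seq.nrm_triangle3[of x y z] seq.nrm_ge0[OF seq.diff_closed[of x z]]
      by (auto simp: null_rel_iff)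
  qed
qed

lemma in_cls: "w \<in> cls z \<longleftrightarrow> z \<in> cauchy_seqs s \<and> w \<in> cauchy_seqs s \<and> seq.nrm (z - w) = 0"
  by (simp add: cls_def null_rel_iff)

lemma cls_self: "z \<in> cauchy_seqs s \<Longrightarrow> z \<in> cls z"
  by (simp add: in_cls)

lemma cls_eq_iff:
  "z \<in> cauchy_seqs s \<Longrightarrow> w \<in> cauchy_seqs s \<Longrightarrow> cls z = cls w \<longleftrightarrow> seq.nrm (z - w) = 0"
  unfolding cls_def using eq_equiv_class_iff[OF equiv_null_rel] by (simp add: null_rel_iff)

lemma carrier_completion: "is_carrier (completion s) = cls ` cauchy_seqs s"
  by (auto simp: completion_def quotient_def cls_def)

text \<open>The operations of the completion saturate a set of results over all representatives; it
  is enough that all these results lie in one class.\<close>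

lemma Image_null_rel_cls:
  assumes "A \<noteq> {}" "A \<subseteq> cls z"
  shows "null_rel s `` A = cls z"
proof -
  have "cls a = cls z" if "a \<in> A" for a
  proof -
    have "a \<in> cls z" using assms(2) that by blast
    then have "z \<in> cauchy_seqs s" "a \<in> cauchy_seqs s" "seq.nrm (z - a) = 0" by (simp_all add: in_cls)
    then have "cls z = cls a" by (simp add: cls_eq_iff)
    then show ?thesis ..
  qed
  then show ?thesis using assms(1) unfolding cls_def by blast
qed

lemma add_completion:
  assumes "z \<in> cauchy_seqs s" "w \<in> cauchy_seqs s"
  shows "is_add (completion s) (cls z) (cls w) = cls (z + w)"
proof -
  have "null_rel s `` {\<lambda>n. z' n + w' n | z' w'. z' \<in> cls z \<and> w' \<in> cls w} = cls (z + w)"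
  proof (rule Image_null_rel_cls)
    show "{\<lambda>n. z' n + w' n | z' w'. z' \<in> cls z \<and> w' \<in> cls w} \<noteq> {}" using assms cls_self by blast
    show "{\<lambda>n. z' n + w' n | z' w'. z' \<in> cls z \<and> w' \<in> cls w} \<subseteq> cls (z + w)"
    proof clarify
      fix z' w' assume h: "z' \<in> cls z" "w' \<in> cls w"
      then have c: "z' \<in> cauchy_seqs s" "w' \<in> cauchy_seqs s" by (auto simp: in_cls)
      have eq: "(z + w) - (z' + w') = (z - z') + (w - w')" by simp
      have "seq.nrm ((z + w) - (z' + w')) \<le> seq.nrm (z - z') + seq.nrm (w - w')"
        unfolding eq by (intro seq.nrm_triangle seq.diff_closed assms c)
      also have "\<dots> = 0" using h by (simp add: in_cls)
      finally have "seq.nrm ((z + w) - (z' + w')) = 0"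
        using seq.nrm_ge0[OF seq.diff_closed[OF seq.add_closed[OF assms] seq.add_closed[OF c]]]
        by (rule antisym)
      then have "z' + w' \<in> cls (z + w)" using assms c by (simp add: in_cls seq.add_closed)
      then show "(\<lambda>n. z' n + w' n) \<in> cls (z + w)" by (simp add: plus_fun_def)
    qed
  qed
  then show ?thesis by (simp add: completion_def)
qed

lemma scale_completion:
  assumes "z \<in> cauchy_seqs s"
  shows "is_scale (completion s) c (cls z) = cls (c *\<^sub>C z)"
proof -
  have "null_rel s `` {\<lambda>n. c *\<^sub>C z' n | z'. z' \<in> cls z} = cls (c *\<^sub>C z)"
  proof (rule Image_null_rel_cls)
    show "{\<lambda>n. c *\<^sub>C z' n | z'. z' \<in> cls z} \<noteq> {}" using assms cls_self by blast
    show "{\<lambda>n. c *\<^sub>C z' n | z'. z' \<in> cls z} \<subseteq> cls (c *\<^sub>C z)"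
    proof clarify
      fix z' assume h: "z' \<in> cls z"
      have "seq.nrm (c *\<^sub>C z - c *\<^sub>C z') = 0"
        using h assms by (simp add: in_cls scaleC_diff_right[symmetric] seq.nrm_scale seq.diff_closed)
      then have "c *\<^sub>C z' \<in> cls (c *\<^sub>C z)" using h by (simp add: in_cls seq.scale_closed)
      then show "(\<lambda>n. c *\<^sub>C z' n) \<in> cls (c *\<^sub>C z)" by (simp add: scaleC_fun_def)
    qed
  qed
  then show ?thesis by (simp add: completion_def)
qed

lemma diff_completion:
  assumes "z \<in> cauchy_seqs s" "w \<in> cauchy_seqs s"
  shows "is_diff (completion s) (cls z) (cls w) = cls (z - w)"
  using assms add_completion[of z "- w"]
  by (simp add: is_diff_def scale_completion seq.minus_closed)

lemma inner_completion:
  assumes z: "z \<in> cauchy_seqs s" and w: "w \<in> cauchy_seqs s"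
  shows "is_inner (completion s) (cls z) (cls w) = seq_inner z w"
proof -
  have "(THE l. \<exists>z'\<in>cls z. \<exists>w'\<in>cls w. (\<lambda>n. s (z' n) (w' n)) \<longlonglongrightarrow> l) = seq_inner z w"
  proof (rule the_equality)
    show "\<exists>z'\<in>cls z. \<exists>w'\<in>cls w. (\<lambda>n. s (z' n) (w' n)) \<longlonglongrightarrow> seq_inner z w"
      using seq_inner_lim[OF z w] cls_self z w by blast
    fix l assume "\<exists>z'\<in>cls z. \<exists>w'\<in>cls w. (\<lambda>n. s (z' n) (w' n)) \<longlonglongrightarrow> l"
    then obtain z' w' where h: "z' \<in> cauchy_seqs s" "w' \<in> cauchy_seqs s" "seq.nrm (z - z') = 0"
      "seq.nrm (w - w') = 0" "(\<lambda>n. s (z' n) (w' n)) \<longlonglongrightarrow> l" by (auto simp: in_cls)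
    have "l = seq_inner z' w'" using LIMSEQ_unique[OF h(5) seq_inner_lim[OF h(1,2)]] .
    also have "\<dots> = seq_inner z w"
      using seq.S_eq_if_null(2)[OF z h(1) w h(3)] seq.S_eq_if_null(1)[OF w h(2) h(1) h(4)] by simp
    finally show "l = seq_inner z w" .
  qed
  then show ?thesis by (simp add: completion_def)
qed

lemma norm_completion: "z \<in> cauchy_seqs s \<Longrightarrow> is_norm (completion s) (cls z) = seq.nrm z"
  by (simp add: is_norm_def inner_completion seminorm_of_def)

text \<open>Uniqueness for the definite description: the difference of two candidates is orthogonal
  to both of them, hence null. A representative with the orthogonality property thus determines the
  projection.\<close>

lemma orth_proj_completion:
  assumes V: "V \<subseteq> is_carrier (completion s)" and z: "z \<in> cauchy_seqs s" and v: "v \<in> cauchy_seqs s"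
    and vV: "cls v \<in> V"
    and orth: "\<And>w. w \<in> cauchy_seqs s \<Longrightarrow> cls w \<in> V \<Longrightarrow> seq_inner w (z - v) = 0"
  shows "orth_proj (completion s) V (cls z) = cls v"
  unfolding orth_proj_def
proof (rule the_equality)
  have rep: "\<exists>x. x \<in> cauchy_seqs s \<and> W = cls x" if "W \<in> V" for W
    using V that by (auto simp: carrier_completion)
  show "cls v \<in> V \<and> (\<forall>W\<in>V. is_inner (completion s) W (is_diff (completion s) (cls z) (cls v)) = 0)"
  proof (intro conjI ballI vV)
    fix W assume W: "W \<in> V"
    then obtain w where w: "w \<in> cauchy_seqs s" "W = cls w" using rep by blast
    then show "is_inner (completion s) W (is_diff (completion s) (cls z) (cls v)) = 0"
      using W z v orth[of w] by (simp add: diff_completion inner_completion seq.diff_closed)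
  qed
  fix U assume U: "U \<in> V \<and> (\<forall>W\<in>V. is_inner (completion s) W (is_diff (completion s) (cls z) U) = 0)"
  then obtain u where u: "u \<in> cauchy_seqs s" "U = cls u" using rep by blast
  have uo: "seq_inner w (z - u) = 0" if "w \<in> cauchy_seqs s" "cls w \<in> V" for w
    using U that z u by (auto simp: diff_completion inner_completion seq.diff_closed)
  have "seq_inner w (u - v) = 0" if w: "w \<in> cauchy_seqs s" "cls w \<in> V" for w
  proof -
    have "u - v = (z - v) - (z - u)" by simp
    then have "seq_inner w (u - v) = seq_inner w (z - v) - seq_inner w (z - u)"
      by (simp only: seq.S_diff_right[OF w(1) seq.diff_closed[OF z v] seq.diff_closed[OF z u(1)]])
    then show ?thesis using uo[OF w] orth[OF w] by simp
  qed
  then have "seq_inner (u - v) (u - v) = 0"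
    using U u v vV seq.S_diff_left[OF u(1) v seq.diff_closed[OF u(1) v]] by simp
  then have "seq.nrm (u - v) = 0" by (simp add: seminorm_of_def)
  then show "U = cls v" using u v by (simp add: cls_eq_iff)
qed

end

section \<open>Uniform convergence of alternating projections\<close>

context hilbert_cstar_module
begin

text \<open>The uniform bound gives a pointwise limit \<open>R\<close> whose adjoint is checked
  directly. Its two-sided shape reflects how it will be obtained, by comparing both powers with a
  limit that exists only after localisation.\<close>

lemma complemented_if_alternating_converges:
  assumes P: "proj_onto P M" and Q: "proj_onto Q N" and g: "0 \<le> g" "g < 1"
    and conv: "\<And>n m x. norm (((\<lambda>x. P (Q x)) ^^ n) x - ((\<lambda>x. P (Q x)) ^^ m) x) \<le> (g ^ n + g ^ m) * norm x"
  shows "complemented act ip (M \<inter> N) \<and> closed (M + N)"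
proof -
  define A where "A = (\<lambda>x. P (Q x))"
  note P1 = proj_ontoD(1)[OF P] and Q1 = proj_ontoD(1)[OF Q]
  note Pb = proj_onto_bounded_linear[OF P] and Qb = proj_onto_bounded_linear[OF Q]
  have conv: "norm ((A ^^ n) x - (A ^^ m) x) \<le> (g ^ n + g ^ m) * norm x" for n m x
    unfolding A_def by (rule conv)
  have gn: "(\<lambda>n. g ^ n) \<longlonglongrightarrow> 0" using g by (intro LIMSEQ_power_zero) simp
  have "Cauchy (\<lambda>n. (A ^^ n) x)" for x
  proof (rule metric_CauchyI)
    fix e :: real assume e: "e > 0"
    define d where "d = e / (2 * (norm x + 1))"
    have d: "d > 0" using e by (auto simp: d_def intro!: divide_pos_pos add_nonneg_pos)
    obtain k where k: "\<And>n. n \<ge> k \<Longrightarrow> g ^ n < d"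
      using order_tendstoD(2)[OF gn d] by (auto simp: eventually_sequentially)
    have "dist ((A ^^ m) x) ((A ^^ n) x) < e" if "m \<ge> k" "n \<ge> k" for m n
    proof -
      have "dist ((A ^^ m) x) ((A ^^ n) x) \<le> (g ^ m + g ^ n) * norm x"
        using conv by (simp add: dist_norm)
      also have "\<dots> \<le> (g ^ m + g ^ n) * (norm x + 1)" using g by (intro mult_left_mono) auto
      also have "\<dots> < (d + d) * (norm x + 1)"
        using k that by (intro mult_strict_right_mono add_strict_mono) (auto intro: add_nonneg_pos)
      also have "\<dots> = e"
      proof -
        have "norm x + 1 \<noteq> 0" using norm_ge_zero[of x] by linarith
        moreover have "e / (2 * t) * t = e / 2" if "t \<noteq> 0" for t using that by simp
        ultimately have "d * (norm x + 1) = e / 2" unfolding d_def by blast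
        then show ?thesis by (simp add: distrib_right)
      qed
      finally show ?thesis .
    qed
    then show "\<exists>k. \<forall>m\<ge>k. \<forall>n\<ge>k. dist ((A ^^ m) x) ((A ^^ n) x) < e" by blast
  qed
  then have "\<exists>y. (\<lambda>n. (A ^^ n) x) \<longlonglongrightarrow> y" for x
    using Cauchy_convergent_iff convergent_def by blast
  then obtain R where R: "\<And>x. (\<lambda>n. (A ^^ n) x) \<longlonglongrightarrow> R x" by metis
  have near: "norm ((A ^^ n) x - R x) \<le> g ^ n * norm x" for n x
  proof (rule LIMSEQ_le)
    show "(\<lambda>m. norm ((A ^^ n) x - (A ^^ m) x)) \<longlonglongrightarrow> norm ((A ^^ n) x - R x)"
      by (intro tendsto_intros R)
    show "(\<lambda>m. (g ^ n + g ^ m) * norm x) \<longlonglongrightarrow> g ^ n * norm x"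
      using tendsto_mult_right[OF tendsto_add[OF tendsto_const gn], of "g ^ n" "norm x"] by simp
  qed (use conv in blast)
  have AR: "P (Q (R x)) = R x" for x
  proof -
    have "(\<lambda>n. P (Q ((A ^^ n) x))) \<longlonglongrightarrow> P (Q (R x))"
      by (intro bounded_linear.tendsto[OF Pb] bounded_linear.tendsto[OF Qb] R)
    then have "(\<lambda>n. (A ^^ Suc n) x) \<longlonglongrightarrow> P (Q (R x))" by (simp add: A_def)
    then show ?thesis using LIMSEQ_Suc[OF R] LIMSEQ_unique by blast
  qed
  have PR: "P (R x) = R x" for x
    using proj_ontoD(4)[OF P, of "Q (R x)"] by (simp add: AR)
  \<comment> \<open>P Q R = R and P R = R give <R x, Q R x> = <R x, R x>, so the square of R x - Q R
    x expands to 0.\<close>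
  have QR: "Q (R x) = R x" for x
  proof -
    have "ip (R x) (R x) = ip (P (R x)) (Q (R x))" using AR[of x] by (simp add: adjD[OF P1])
    then have 1: "ip (R x) (Q (R x)) = ip (R x) (R x)" by (simp add: PR)
    then have 2: "ip (Q (R x)) (R x) = ip (R x) (R x)" by (simp add: adjD[OF Q1])
    have "ip (R x - Q (R x)) (R x - Q (R x)) = 0"
      using 1 2 adjD[OF Q1, of "R x" "Q (R x)"] proj_ontoD(4)[OF Q, of "R x"]
      by (simp add: ip_diff_left ip_diff_right)
    then show ?thesis by (simp add: ip_self_eq_zero)
  qed
  have fixA: "P w = w" "Q w = w" if "w \<in> M \<inter> N" for w
    using that proj_ontoD(3)[OF P] proj_ontoD(3)[OF Q] by auto
  have RMN: "R x \<in> M \<inter> N" for x using PR QR proj_ontoD(5)[OF P] proj_ontoD(5)[OF Q] by auto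
  have Rfix: "R w = w" if w: "w \<in> M \<inter> N" for w
  proof -
    have "(A ^^ n) w = w" for n
      by (induction n) (simp_all add: A_def fixA[OF w])
    then show ?thesis using R[of w] LIMSEQ_unique[OF _ tendsto_const] by auto
  qed
  have Rorth: "ip w (R x) = ip w x" if w: "w \<in> M \<inter> N" for w x
  proof -
    have "ip w ((A ^^ n) x) = ip w x" for n
    proof (induction n)
      case (Suc n)
      have "ip w (P (Q ((A ^^ n) x))) = ip w ((A ^^ n) x)"
        using adjD[OF P1, of w "Q ((A ^^ n) x)"] adjD[OF Q1, of w "(A ^^ n) x"]
        by (simp add: fixA[OF w])
      then show ?case using Suc by (simp add: A_def)
    qed simp
    then show ?thesis using tendsto_ip_right[OF R, of w x] LIMSEQ_unique[OF _ tendsto_const] by auto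
  qed
  have RR: "proj_onto R (M \<inter> N)" unfolding proj_onto_def
  proof (intro conjI allI ballI RMN Rfix)
    show "adj R R" unfolding adj_def
    proof (intro allI)
      fix x y
      have "ip (R x) y = ip (R x) (R y)" by (rule Rorth[OF RMN, symmetric])
      moreover have "ip x (R y) = ip (R x) (R y)"
        using Rorth[OF RMN, of y x] by (metis star_ip)
      ultimately show "ip (R x) y = ip x (R y)" by simp
    qed
  qed
  have "closed (M + N)" unfolding closed_sequential_limits
  proof (intro allI impI)
    fix X x assume "(\<forall>k. X k \<in> M + N) \<and> X \<longlonglongrightarrow> x"
    then have X: "\<And>k. X k \<in> M + N" "X \<longlonglongrightarrow> x" by auto
    \<comment> \<open>The splitting is not unique when the submodules intersect; moving the part
      \<open>R n\<close> from the summand in \<open>N\<close> to the one in \<open>M\<close>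
      normalises it.\<close>
    have "\<exists>n. n \<in> N \<and> X k - n \<in> M \<and> R n = 0" for k
    proof -
      obtain m n where mn: "X k = m + n" "m \<in> M" "n \<in> N" using X(1)[of k] by (rule set_plus_elim)
      have R1: "adj R R" by (rule proj_ontoD(1)[OF RR])
      have "Q (n - R n) = n - R n"
        using proj_ontoD(3)[OF Q mn(3)] by (simp add: adj_map_diff[OF Q1] QR)
      moreover have "P (m + R n) = m + R n"
        using proj_ontoD(3)[OF P mn(2)] by (simp add: adj_add[OF P1] PR)
      moreover have "R (n - R n) = 0" by (simp add: adj_map_diff[OF R1] proj_ontoD(4)[OF RR])
      ultimately show ?thesis using proj_ontoD(5)[OF P] proj_ontoD(5)[OF Q]
        by (intro exI[of _ "n - R n"]) (simp add: mn(1))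
    qed
    then obtain n where n: "\<And>k. n k \<in> N" "\<And>k. X k - n k \<in> M" "\<And>k. R (n k) = 0" by metis
    have Xn: "X k - P (X k) = n k - P (n k)" for k
    proof -
      have "P (X k - n k) = X k - n k" by (rule proj_ontoD(3)[OF P n(2)])
      then have "P (X k) = P (n k) + X k - n k" by (simp add: adj_map_diff[OF P1] algebra_simps)
      then show ?thesis by simp
    qed
    \<comment> \<open>On vectors of \<open>N\<close> killed by \<open>R\<close> the first power
      alone shows that \<open>P\<close> shrinks by \<open>g\<close>, so 1 - P is bounded below by 1
      - g; and 1 - P sees only \<open>X\<close>, not its summand in \<open>M\<close>.\<close>
    have est: "(1 - g) * norm (n k - n l) \<le> norm (X k - X l)" for k l
    proof -
      let ?y = "n k - n l"
      have Ry: "R ?y = 0" by (simp add: adj_map_diff[OF proj_ontoD(1)[OF RR]] n(3))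
      have Qy: "Q ?y = ?y" by (simp add: adj_map_diff[OF Q1] proj_ontoD(3)[OF Q n(1)])
      have "norm (P ?y) \<le> g * norm ?y" using near[of 1 ?y] by (simp add: A_def Qy Ry)
      then have "(1 - g) * norm ?y \<le> norm ?y - norm (P ?y)" by (simp add: left_diff_distrib)
      also have "\<dots> \<le> norm (?y - P ?y)" by (rule norm_triangle_ineq2)
      also have "?y - P ?y = (X k - X l) - P (X k - X l)"
      proof -
        have "(X k - X l) - P (X k - X l) = (X k - P (X k)) - (X l - P (X l))"
          by (simp add: adj_map_diff[OF P1])
        also have "\<dots> = ?y - P ?y" unfolding Xn by (simp add: adj_map_diff[OF P1])
        finally show ?thesis ..
      qed
      also have "norm \<dots> \<le> norm (X k - X l)"
        by (rule proj_onto_norm[OF proj_onto_ortho_compl[OF P]])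
      finally show ?thesis .
    qed
    have "Cauchy n"
    proof (rule metric_CauchyI)
      fix e :: real assume "e > 0"
      then have e: "(1 - g) * e > 0" using g by simp
      have "Cauchy X" using X(2) by (rule LIMSEQ_imp_Cauchy)
      then obtain K where K: "\<And>k l. k \<ge> K \<Longrightarrow> l \<ge> K \<Longrightarrow> dist (X k) (X l) < (1 - g) * e"
        using e unfolding Cauchy_def by blast
      have "dist (n k) (n l) < e" if "k \<ge> K" "l \<ge> K" for k l
      proof -
        have "(1 - g) * dist (n k) (n l) < (1 - g) * e"
          using est[of k l] K[OF that] by (simp add: dist_norm)
        then show ?thesis using g by (simp add: mult_less_cancel_left)
      qed
      then show "\<exists>M. \<forall>k\<ge>M. \<forall>l\<ge>M. dist (n k) (n l) < e" by blast
    qed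
    then obtain y where y: "n \<longlonglongrightarrow> y" using Cauchy_convergent_iff convergent_def by blast
    have "y \<in> N" using proj_onto_closed[OF Q] n(1) y by (rule closed_sequentially)
    moreover have "x - y \<in> M"
      using proj_onto_closed[OF P] n(2) tendsto_diff[OF X(2) y] by (rule closed_sequentially)
    ultimately show "x \<in> M + N" using set_plus_intro[of "x - y" M y N] by simp
  qed
  then show ?thesis using RR complemented_iff by blast
qed

end

section \<open>Localisation\<close>

context hilbert_module_rep
begin

sublocale comp: semi_inner_UNIV tform ..

abbreviation CS :: "(nat \<Rightarrow> 'x \<times> 'h \<Rightarrow>\<^sub>0 complex) set" where
  "CS \<equiv> cauchy_seqs tform"

abbreviation snrm :: "(nat \<Rightarrow> 'x \<times> 'h \<Rightarrow>\<^sub>0 complex) \<Rightarrow> real" where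
  "snrm \<equiv> comp.seq.nrm"

definition tseq :: "('x \<Rightarrow> 'x) \<Rightarrow> (nat \<Rightarrow> 'x \<times> 'h \<Rightarrow>\<^sub>0 complex) \<Rightarrow> nat \<Rightarrow> 'x \<times> 'h \<Rightarrow>\<^sub>0 complex" where
  "tseq L z = (\<lambda>n. tmap L (z n))"

lemma tseq_diff: "tseq L (z - w) = tseq L z - tseq L w"
  by (simp add: tseq_def tmap_diff fun_eq_iff)

lemma tseq_scaleC: "tseq L (c *\<^sub>C z) = c *\<^sub>C tseq L z"
  by (simp add: tseq_def tmap_scaleC scaleC_fun_def)

lemma tseq_tseq: "tseq L (tseq L' z) = tseq (\<lambda>x. L (L' x)) z"
  by (simp add: tseq_def tmap_tmap)

text \<open>Pairing with any vector gives 0, because the form depends on a symbol only through its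
  inner products, which are linear in the module vector.\<close>

lemma tmap_diff_map:
  "tensor.nrm (tmap (\<lambda>x. A x - B x) f - (tmap A f - tmap B f)) = 0"
proof -
  let ?d = "tmap (\<lambda>x. A x - B x) f - (tmap A f - tmap B f)"
  have "tform ?d ?d = 0"
    by (subst tensor.S_diff_right) (simp_all add: tensor.S_diff_right tform_tmap_diff)
  then show ?thesis by (simp add: seminorm_of_def)
qed

lemma nrm_tmap_diff_map: "tensor.nrm (tmap (\<lambda>x. A x - B x) f) = tensor.nrm (tmap A f - tmap B f)"
  by (rule tensor.nrm_eq_if_null) (simp_all add: tmap_diff_map)

context
  fixes P :: "'x \<Rightarrow> 'x" and W :: "'x set"
  assumes P: "proj_onto P W"
begin

lemma tseq_closed: "z \<in> CS \<Longrightarrow> tseq P z \<in> CS"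
  unfolding tseq_def
  by (rule comp.cauchy_seqs_map[where B=1]) (simp_all add: tmap_diff[symmetric] tensor_norm_tmap_proj[OF P])

lemma tseq_idem: "tseq P (tseq P z) = tseq P z"
  by (simp add: tseq_tseq proj_ontoD(4)[OF P])

lemma tseq_sym: "comp.seq_inner (tseq P z) w = comp.seq_inner z (tseq P w)"
  by (simp add: comp.seq_inner_def tseq_def tform_tmap_adj[OF proj_ontoD(1)[OF P]])

lemma snrm_tseq: "z \<in> CS \<Longrightarrow> snrm (tseq P z) \<le> snrm z"
  using comp.seq_nrm_le[OF tseq_closed, of z z 1] tensor_norm_tmap_proj[OF P]
  by (simp add: tseq_def)

text \<open>A representative supported on \<open>W\<close> is literally fixed by
  \<open>tseq P\<close>, and conversely \<open>tseq P z\<close> is such a representative. Membership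
  in the localisation thus becomes a null condition.\<close>

lemma cls_in_localised_iff:
  assumes z: "z \<in> CS"
  shows "comp.cls z \<in> localised_submodule ip \<pi> W \<longleftrightarrow> snrm (z - tseq P z) = 0"
proof
  assume "comp.cls z \<in> localised_submodule ip \<pi> W"
  then obtain w where w: "w \<in> comp.cls z" and keys: "\<And>n. Poly_Mapping.keys (w n) \<subseteq> W \<times> UNIV"
    unfolding localised_submodule_def by blast
  have wC: "w \<in> CS" and zw: "snrm (z - w) = 0" using w by (simp_all add: comp.in_cls)
  have "tseq P w = w"
    unfolding tseq_def by (rule ext, rule tmap_fixed, rule proj_ontoD(3)[OF P]) (use keys in force)
  then have eq: "z - tseq P z = (z - w) - tseq P (z - w)" by (simp add: tseq_diff)
  have d: "z - w \<in> CS" using z wC by (rule comp.seq.diff_closed)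
  have "snrm (z - tseq P z) \<le> snrm (z - w) + snrm (tseq P (z - w))"
    unfolding eq by (rule comp.seq.nrm_triangle_diff[OF d tseq_closed[OF d]])
  also have "\<dots> \<le> 0" using snrm_tseq[OF d] zw by simp
  finally show "snrm (z - tseq P z) = 0"
    using comp.seq.nrm_ge0[OF comp.seq.diff_closed[OF z tseq_closed[OF z]]] by simp
next
  assume "snrm (z - tseq P z) = 0"
  then have "tseq P z \<in> comp.cls z" using z tseq_closed[OF z] by (simp add: comp.in_cls)
  moreover have "Poly_Mapping.keys (tseq P z n) \<subseteq> W \<times> UNIV" for n
    using keys_tmap[of P "z n"] proj_ontoD(2)[OF P] by (force simp: tseq_def)
  ultimately show "comp.cls z \<in> localised_submodule ip \<pi> W"
    unfolding localised_submodule_def interior_tensor_def comp.carrier_completion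
    using z by blast
qed

lemma orth_proj_localised:
  assumes z: "z \<in> CS"
  shows "orth_proj (interior_tensor ip \<pi>) (localised_submodule ip \<pi> W) (comp.cls z) = comp.cls (tseq P z)"
  unfolding interior_tensor_def
proof (rule comp.orth_proj_completion[OF _ z tseq_closed[OF z]])
  show "localised_submodule ip \<pi> W \<subseteq> is_carrier (completion tform)"
    by (auto simp: localised_submodule_def interior_tensor_def)
  show "comp.cls (tseq P z) \<in> localised_submodule ip \<pi> W"
    by (simp add: cls_in_localised_iff tseq_closed z tseq_idem)
  fix w assume w: "w \<in> CS" "comp.cls w \<in> localised_submodule ip \<pi> W"
  have zd: "z - tseq P z \<in> CS" by (intro comp.seq.diff_closed z tseq_closed)
  have "comp.seq_inner w (z - tseq P z) = comp.seq_inner (tseq P w) (z - tseq P z)"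
    using comp.seq.S_eq_if_null(2)[OF w(1) tseq_closed[OF w(1)] zd] w cls_in_localised_iff by blast
  also have "\<dots> = comp.seq_inner w 0" by (simp add: tseq_sym tseq_diff tseq_idem)
  also have "\<dots> = 0" using comp.seq.S_scale_right[OF w(1) w(1), of 0] by simp
  finally show "comp.seq_inner w (z - tseq P z) = 0" .
qed

end

section \<open>The localised angle of two complemented submodules\<close>

context
  fixes P Q :: "'x \<Rightarrow> 'x" and M N :: "'x set"
  assumes P: "proj_onto P M" and Q: "proj_onto Q N"
begin

abbreviation (input) angle :: real where "angle \<equiv> friedrichs_angle ip \<pi> M N"

abbreviation (input) locMN :: "(nat \<Rightarrow> 'x \<times> 'h \<Rightarrow>\<^sub>0 complex) set set" where
  "locMN \<equiv> localised_submodule ip \<pi> M \<inter> localised_submodule ip \<pi> N"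

lemma locMN_carrier: "locMN \<subseteq> is_carrier (completion tform)"
  by (auto simp: localised_submodule_def interior_tensor_def)

lemma cls_in_locMN_iff:
  "z \<in> CS \<Longrightarrow> comp.cls z \<in> locMN \<longleftrightarrow> snrm (z - tseq P z) = 0 \<and> snrm (z - tseq Q z) = 0"
  by (simp add: cls_in_localised_iff[OF P] cls_in_localised_iff[OF Q])

text \<open>\<open>locproj z v\<close>: the class of \<open>v\<close> is the projection of the class of \<open>z\<close> onto
  \<open>M\<^sub>\<pi> \<inter> N\<^sub>\<pi>\<close>.\<close>

definition locproj :: "(nat \<Rightarrow> 'x \<times> 'h \<Rightarrow>\<^sub>0 complex) \<Rightarrow> (nat \<Rightarrow> 'x \<times> 'h \<Rightarrow>\<^sub>0 complex) \<Rightarrow> bool" where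
  "locproj z v \<longleftrightarrow> v \<in> CS \<and> comp.cls v \<in> locMN \<and>
     (\<forall>w\<in>CS. comp.cls w \<in> locMN \<longrightarrow> comp.seq_inner w (z - v) = 0)"

lemma angle_term:
  assumes z: "z \<in> CS" and v: "locproj z v"
  shows "is_norm (interior_tensor ip \<pi>) (is_diff (interior_tensor ip \<pi>)
      (orth_proj (interior_tensor ip \<pi>) (localised_submodule ip \<pi> M)
        (orth_proj (interior_tensor ip \<pi>) (localised_submodule ip \<pi> N) (comp.cls z)))
      (orth_proj (interior_tensor ip \<pi>) locMN (comp.cls z))) = snrm (tseq P (tseq Q z) - v)"
proof -
  have "orth_proj (interior_tensor ip \<pi>) locMN (comp.cls z) = comp.cls v"
    unfolding interior_tensor_def
    by (rule comp.orth_proj_completion[OF locMN_carrier z]) (use v in \<open>auto simp: locproj_def\<close>)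
  moreover have "v \<in> CS" using v by (simp add: locproj_def)
  ultimately show ?thesis
    using z by (simp add: orth_proj_localised[OF P] orth_proj_localised[OF Q] tseq_closed[OF P] tseq_closed[OF Q])
      (simp add: interior_tensor_def comp.diff_completion comp.norm_completion comp.seq.diff_closed
        tseq_closed[OF P] tseq_closed[OF Q])
qed

lemma angle_le:
  assumes "\<And>z. z \<in> CS \<Longrightarrow> snrm z \<le> 1 \<Longrightarrow> \<exists>v. locproj z v \<and> snrm (tseq P (tseq Q z) - v) \<le> g"
  shows "angle \<le> g"
  unfolding friedrichs_angle_def Let_def op_norm_def
proof (rule cSUP_least)
  show "{u \<in> is_carrier (interior_tensor ip \<pi>). is_norm (interior_tensor ip \<pi>) u \<le> 1} \<noteq> {}"
  proof -
    have "comp.cls 0 \<in> {u \<in> is_carrier (interior_tensor ip \<pi>). is_norm (interior_tensor ip \<pi>) u \<le> 1}"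
      by (simp add: interior_tensor_def comp.carrier_completion comp.norm_completion comp.seq.zero_closed)
    then show ?thesis by blast
  qed
  fix u assume "u \<in> {u \<in> is_carrier (interior_tensor ip \<pi>). is_norm (interior_tensor ip \<pi>) u \<le> 1}"
  then obtain z where z: "z \<in> CS" "u = comp.cls z" "snrm z \<le> 1"
    by (auto simp: interior_tensor_def comp.carrier_completion comp.norm_completion)
  then obtain v where v: "locproj z v" "snrm (tseq P (tseq Q z) - v) \<le> g" using assms by blast
  show "is_norm (interior_tensor ip \<pi>) (is_diff (interior_tensor ip \<pi>)
      (orth_proj (interior_tensor ip \<pi>) (localised_submodule ip \<pi> M)
        (orth_proj (interior_tensor ip \<pi>) (localised_submodule ip \<pi> N) u))
      (orth_proj (interior_tensor ip \<pi>) locMN u)) \<le> g"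
    using v(2) unfolding z(2) angle_term[OF z(1) v(1)] .
qed

lemma locproj_norm:
  assumes z: "z \<in> CS" and v: "locproj z v"
  shows "snrm v \<le> snrm z"
proof -
  have vC: "v \<in> CS" and "comp.seq_inner v (z - v) = 0" using v by (auto simp: locproj_def)
  then have "comp.seq_inner v v = comp.seq_inner v z"
    using z by (simp add: comp.seq.S_diff_right)
  then have "(snrm v)\<^sup>2 = Re (comp.seq_inner v z)" using vC by (simp add: comp.seq.nrm_sq)
  also have "\<dots> \<le> snrm v * snrm z"
    using comp.seq.cauchy_schwarz[OF vC z] complex_Re_le_cmod order_trans by blast
  finally have "snrm v * snrm v \<le> snrm v * snrm z" by (simp add: power2_eq_square)
  then show ?thesis using comp.seq.nrm_ge0[OF vC] comp.seq.nrm_ge0[OF z]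
    by (cases "snrm v = 0") (auto simp: mult_le_cancel_left)
qed

text \<open>Being fixed up to null sequences by a contraction is a closed linear condition, so the
  projection theorem applies to the two conditions together. No relation to
  \<open>M \<inter> N\<close> is used.\<close>

lemma locproj_exists:
  assumes z: "z \<in> CS"
  shows "\<exists>v. locproj z v"
proof -
  let ?V = "{z \<in> CS. comp.cls z \<in> locMN}"
  have pr_scale: "snrm (c *\<^sub>C y - tseq L (c *\<^sub>C y)) = 0"
    if "proj_onto L W" "y \<in> CS" "snrm (y - tseq L y) = 0" for L W c y
    using that by (simp add: tseq_scaleC scaleC_diff_right[symmetric] comp.seq.nrm_scale
        comp.seq.diff_closed tseq_closed)
  have pr_add: "snrm ((x + y) - tseq L (x + y)) = 0"
    if L: "proj_onto L W" and h: "x \<in> CS" "y \<in> CS" "snrm (x - tseq L x) = 0" "snrm (y - tseq L y) = 0"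
    for L W x y
  proof -
    note d = comp.seq.diff_closed[OF h(1) tseq_closed[OF L h(1)]] comp.seq.diff_closed[OF h(2) tseq_closed[OF L h(2)]]
    have eq: "(x + y) - tseq L (x + y) = (x - tseq L x) + (y - tseq L y)"
      using tseq_diff[of L "x + y" y] by (simp add: algebra_simps)
    have "snrm ((x + y) - tseq L (x + y)) \<le> snrm (x - tseq L x) + snrm (y - tseq L y)"
      unfolding eq by (rule comp.seq.nrm_triangle[OF d])
    then show "snrm ((x + y) - tseq L (x + y)) = 0"
      using h comp.seq.nrm_ge0[OF comp.seq.diff_closed[OF comp.seq.add_closed[OF h(1,2)]
            tseq_closed[OF L comp.seq.add_closed[OF h(1,2)]]]] by simp
  qed
  have pr_lim: "snrm (z - tseq L z) = 0"
    if L: "proj_onto L W" and Z: "\<And>n. Z n \<in> CS" "\<And>n. snrm (Z n - tseq L (Z n)) = 0" and z: "z \<in> CS"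
      and lim: "(\<lambda>n. snrm (Z n - z)) \<longlonglongrightarrow> 0"
    for L W Z z
  proof -
    have "snrm (z - tseq L z) \<le> 2 * snrm (Z n - z)" for n
    proof -
      note Zn = Z[of n]
      have "snrm (z - tseq L z) \<le> snrm (z - Z n) + snrm (Z n - tseq L z)"
        by (rule comp.seq.nrm_triangle3[OF z Zn(1) tseq_closed[OF L z]])
      also have "snrm (Z n - tseq L z) \<le> snrm (Z n - tseq L (Z n)) + snrm (tseq L (Z n) - tseq L z)"
        by (rule comp.seq.nrm_triangle3[OF Zn(1) tseq_closed[OF L Zn(1)] tseq_closed[OF L z]])
      also have "snrm (tseq L (Z n) - tseq L z) \<le> snrm (Z n - z)"
        unfolding tseq_diff[symmetric] by (rule snrm_tseq[OF L comp.seq.diff_closed[OF Zn(1) z]])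
      finally show ?thesis using Zn(2) comp.seq.nrm_commute[OF z Zn(1)] by linarith
    qed
    then have "snrm (z - tseq L z) \<le> 2 * 0"
      by (intro LIMSEQ_le_const[OF tendsto_mult_left[OF lim]]) auto
    then show ?thesis
      using comp.seq.nrm_ge0[OF comp.seq.diff_closed[OF z tseq_closed[OF L z]]] by simp
  qed
  have "\<exists>v\<in>?V. \<forall>w\<in>?V. comp.seq_inner w (z - v) = 0"
  proof (rule comp.seq.projection_exists[OF _ _ _ _ _ _ z])
    show "\<exists>z\<in>CS. (\<lambda>n. snrm (Z n - z)) \<longlonglongrightarrow> 0"
      if "\<And>n. Z n \<in> CS" "\<forall>e>0. \<exists>n0. \<forall>m\<ge>n0. \<forall>n\<ge>n0. snrm (Z m - Z n) < e" for Z
      by (rule comp.cauchy_seqs_complete[OF that])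
    show "0 \<in> ?V"
      using tseq_diff[of P 0 0] tseq_diff[of Q 0 0]
      by (simp add: cls_in_locMN_iff comp.seq.zero_closed del: Int_iff)
    have V: "y \<in> ?V \<longleftrightarrow> y \<in> CS \<and> snrm (y - tseq P y) = 0 \<and> snrm (y - tseq Q y) = 0" for y
      using cls_in_locMN_iff[of y] by blast
    show "x + y \<in> ?V" if "x \<in> ?V" "y \<in> ?V" for x y
      using that pr_add[OF P, of x y] pr_add[OF Q, of x y] comp.seq.add_closed[of x y]
      unfolding V by blast
    show "c *\<^sub>C y \<in> ?V" if "y \<in> ?V" for c y
      using that pr_scale[OF P, of y c] pr_scale[OF Q, of y c] comp.seq.scale_closed[of y c]
      unfolding V by blast
    show "y \<in> ?V" if Z: "\<And>n. Z n \<in> ?V" and y: "y \<in> CS" and lim: "(\<lambda>n. snrm (Z n - y)) \<longlonglongrightarrow> 0" for Z y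
    proof -
      have "\<And>n. Z n \<in> CS" "\<And>n. snrm (Z n - tseq P (Z n)) = 0" "\<And>n. snrm (Z n - tseq Q (Z n)) = 0"
        using Z unfolding V by blast+
      then show ?thesis using pr_lim[OF P _ _ y lim] pr_lim[OF Q _ _ y lim] y unfolding V by blast
    qed
  qed auto
  then show ?thesis unfolding locproj_def by blast
qed

lemma snrm_PQ: "z \<in> CS \<Longrightarrow> snrm (tseq P (tseq Q z)) \<le> snrm z"
  using snrm_tseq[OF P tseq_closed[OF Q]] snrm_tseq[OF Q] order_trans by blast

lemma PQ_closed: "z \<in> CS \<Longrightarrow> tseq P (tseq Q z) \<in> CS"
  by (intro tseq_closed[OF P] tseq_closed[OF Q])

lemma locproj_scale:
  assumes z: "z \<in> CS" and v: "locproj z v"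
  shows "locproj (c *\<^sub>C z) (c *\<^sub>C v)"
proof -
  have vC: "v \<in> CS" and vV: "comp.cls v \<in> locMN" using v by (auto simp: locproj_def)
  have "snrm (c *\<^sub>C v - tseq L (c *\<^sub>C v)) = 0"
    if "proj_onto L W" "snrm (v - tseq L v) = 0" for L W
    using that vC by (simp add: tseq_scaleC scaleC_diff_right[symmetric] comp.seq.nrm_scale
        comp.seq.diff_closed tseq_closed)
  then have "comp.cls (c *\<^sub>C v) \<in> locMN"
    using vV vC P Q by (auto simp: cls_in_locMN_iff comp.seq.scale_closed simp del: Int_iff)
  moreover have "comp.seq_inner w (c *\<^sub>C z - c *\<^sub>C v) = 0" if "w \<in> CS" "comp.cls w \<in> locMN" for w
    using v that z vC unfolding scaleC_diff_right[symmetric] locproj_def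
    by (simp add: comp.seq.S_scale_right comp.seq.diff_closed)
  ultimately show ?thesis using vC by (simp add: locproj_def comp.seq.scale_closed)
qed

lemma locproj_norm_PQ_diff:
  assumes z: "z \<in> CS" and v: "locproj z v"
  shows "snrm (tseq P (tseq Q z) - v) \<le> 2 * snrm z"
proof -
  have vC: "v \<in> CS" using v by (auto simp: locproj_def)
  show ?thesis
    using comp.seq.nrm_triangle_diff[OF PQ_closed[OF z] vC] snrm_PQ[OF z] locproj_norm[OF z v] by simp
qed

text \<open>A supremum of reals bounds its members only when the set is bounded above; the crude
  bound 2 from two contractions provides this.\<close>

lemma angle_bound_unit:
  assumes z: "z \<in> CS" "snrm z \<le> 1" and v: "locproj z v"
  shows "snrm (tseq P (tseq Q z) - v) \<le> angle"
proof -
  let ?K = "interior_tensor ip \<pi>"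
  let ?f = "\<lambda>u. is_norm ?K (is_diff ?K
      (orth_proj ?K (localised_submodule ip \<pi> M) (orth_proj ?K (localised_submodule ip \<pi> N) u))
      (orth_proj ?K locMN u))"
  let ?U = "{u \<in> is_carrier ?K. is_norm ?K u \<le> 1}"
  have "?f u \<le> 2" if u: "u \<in> ?U" for u
  proof -
    obtain z where z: "z \<in> CS" "u = comp.cls z" "snrm z \<le> 1"
      using u by (auto simp: interior_tensor_def comp.carrier_completion comp.norm_completion)
    obtain v where v: "locproj z v" using locproj_exists[OF z(1)] by blast
    show ?thesis unfolding z(2) angle_term[OF z(1) v]
      using locproj_norm_PQ_diff[OF z(1) v] z(3) by simp
  qed
  then have bdd: "bdd_above (?f ` ?U)" by (intro bdd_aboveI2[of _ _ 2])
  have "comp.cls z \<in> ?U"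
    using z by (simp add: interior_tensor_def comp.carrier_completion comp.norm_completion)
  from cSUP_upper[OF this bdd] have "?f (comp.cls z) \<le> angle"
    unfolding friedrichs_angle_def Let_def op_norm_def .
  then show ?thesis unfolding angle_term[OF z(1) v] .
qed

lemma angle_nonneg: "0 \<le> angle"
proof -
  have z: "0 \<in> CS" by (rule comp.seq.zero_closed)
  obtain v where v: "locproj 0 v" using locproj_exists[OF z] by blast
  then have "v \<in> CS" by (simp add: locproj_def)
  then have "0 \<le> snrm (tseq P (tseq Q 0) - v)"
    by (intro comp.seq.nrm_ge0 comp.seq.diff_closed PQ_closed z)
  also have "\<dots> \<le> angle" by (rule angle_bound_unit[OF z _ v]) simp
  finally show ?thesis .
qed

lemma angle_bound:
  assumes z: "z \<in> CS" and v: "locproj z v"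
  shows "snrm (tseq P (tseq Q z) - v) \<le> angle * snrm z"
proof (cases "snrm z = 0")
  case True
  then show ?thesis using locproj_norm_PQ_diff[OF z v] by simp
next
  case False
  have vC: "v \<in> CS" using v by (auto simp: locproj_def)
  have a: "snrm z > 0" using comp.seq.nrm_ge0[OF z] False by linarith
  define c where "c = complex_of_real (1 / snrm z)"
  have cm: "cmod c = 1 / snrm z" using a by (simp add: c_def norm_divide)
  have "snrm (c *\<^sub>C z) \<le> 1" using a by (simp add: comp.seq.nrm_scale[OF z] cm)
  then have "snrm (tseq P (tseq Q (c *\<^sub>C z)) - c *\<^sub>C v) \<le> angle"
    by (intro angle_bound_unit locproj_scale z v comp.seq.scale_closed)
  then have "snrm (c *\<^sub>C (tseq P (tseq Q z) - v)) \<le> angle"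
    by (simp add: tseq_scaleC scaleC_diff_right)
  then have "snrm (tseq P (tseq Q z) - v) / snrm z \<le> angle"
    by (simp add: comp.seq.nrm_scale[OF comp.seq.diff_closed[OF PQ_closed[OF z] vC]] cm)
  then show ?thesis using a by (simp add: pos_divide_le_eq)
qed

lemma inner_PQ:
  assumes u: "u \<in> CS" "comp.cls u \<in> locMN" and y: "y \<in> CS"
  shows "comp.seq_inner u (tseq P (tseq Q y)) = comp.seq_inner u y"
proof -
  have n: "snrm (u - tseq P u) = 0" "snrm (u - tseq Q u) = 0"
    using u by (auto simp: cls_in_locMN_iff simp del: Int_iff)
  note Qy = tseq_closed[OF Q y]
  have "comp.seq_inner u (tseq P (tseq Q y)) = comp.seq_inner (tseq P u) (tseq Q y)"
    by (rule tseq_sym[OF P, symmetric])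
  also have "\<dots> = comp.seq_inner u (tseq Q y)"
    by (rule comp.seq.S_eq_if_null(2)[OF u(1) tseq_closed[OF P u(1)] Qy n(1), symmetric])
  also have "\<dots> = comp.seq_inner (tseq Q u) y" by (rule tseq_sym[OF Q, symmetric])
  also have "\<dots> = comp.seq_inner u y"
    by (rule comp.seq.S_eq_if_null(2)[OF u(1) tseq_closed[OF Q u(1)] y n(2), symmetric])
  finally show ?thesis .
qed

lemma snrm_PQ_fixed:
  assumes u: "u \<in> CS" "comp.cls u \<in> locMN"
  shows "snrm (tseq P (tseq Q u) - u) = 0"
proof -
  have n: "snrm (u - tseq P u) = 0" "snrm (u - tseq Q u) = 0"
    using u by (auto simp: cls_in_locMN_iff simp del: Int_iff)
  note Pu = tseq_closed[OF P u(1)] and Qu = tseq_closed[OF Q u(1)]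
  have "snrm (tseq P (tseq Q u) - u) \<le> snrm (tseq P (tseq Q u) - tseq P u) + snrm (tseq P u - u)"
    by (rule comp.seq.nrm_triangle3[OF PQ_closed[OF u(1)] Pu u(1)])
  also have "\<dots> \<le> snrm (tseq Q u - u) + snrm (tseq P u - u)"
    unfolding tseq_diff[symmetric] by (intro add_right_mono snrm_tseq[OF P] comp.seq.diff_closed Qu u)
  also have "\<dots> = 0"
    using n comp.seq.nrm_commute[OF Qu u(1)] comp.seq.nrm_commute[OF Pu u(1)] by simp
  finally show ?thesis
    using comp.seq.nrm_ge0[OF comp.seq.diff_closed[OF PQ_closed[OF u(1)] u(1)]] by simp
qed

text \<open>The deviation from \<open>v\<close> stays orthogonal to the localised intersection, so
  its own projection there is 0 and each further application of P Q contracts it by the angle. For n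
  = 0 it is at most the norm of \<open>z\<close>.\<close>

lemma angle_bound_power:
  assumes z: "z \<in> CS" and v: "locproj z v"
  shows "((\<lambda>y. tseq P (tseq Q y)) ^^ n) z \<in> CS \<and>
    snrm (((\<lambda>y. tseq P (tseq Q y)) ^^ n) z - v) \<le> angle ^ n * snrm z"
proof -
  define B where "B y = tseq P (tseq Q y)" for y
  have vC: "v \<in> CS" and vV: "comp.cls v \<in> locMN"
    and orth: "\<And>w. w \<in> CS \<Longrightarrow> comp.cls w \<in> locMN \<Longrightarrow> comp.seq_inner w (z - v) = 0"
    using v by (auto simp: locproj_def)
  have cl: "(B ^^ n) z \<in> CS" for n by (induction n) (simp_all add: z B_def PQ_closed)
  have "snrm ((B ^^ n) z - v) \<le> angle ^ n * snrm z"
  proof (induction n)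
    case 0
    have d: "z - v \<in> CS" using z vC by (rule comp.seq.diff_closed)
    have "(snrm (z - v))\<^sup>2 = Re (comp.seq_inner z (z - v))"
      using orth[OF vC vV] by (simp add: comp.seq.nrm_sq[OF d] comp.seq.S_diff_left[OF z vC d])
    also have "\<dots> \<le> snrm z * snrm (z - v)"
      using comp.seq.cauchy_schwarz[OF z d] complex_Re_le_cmod order_trans by blast
    finally have "snrm (z - v) * snrm (z - v) \<le> snrm z * snrm (z - v)" by (simp add: power2_eq_square)
    then have "snrm (z - v) \<le> snrm z"
      using comp.seq.nrm_ge0[OF d] comp.seq.nrm_ge0[OF z]
      by (cases "snrm (z - v) = 0") (auto simp: mult_le_cancel_right)
    then show ?case unfolding funpow_0 power_0 mult_1 .
  next
    case (Suc n)
    let ?w = "(B ^^ n) z - v"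
    have w: "?w \<in> CS" by (rule comp.seq.diff_closed[OF cl vC])
    \<comment> \<open>P Q preserves the inner product with vectors of the intersection, so
      orthogonality of z - v persists for all powers.\<close>
    have "comp.seq_inner u ?w = 0" if u: "u \<in> CS" "comp.cls u \<in> locMN" for u
    proof -
      have "comp.seq_inner u ((B ^^ n) z) = comp.seq_inner u z" for n
        by (induction n) (simp_all add: B_def inner_PQ[OF u cl[unfolded B_def]])
      then show ?thesis using orth[OF u] u by (simp add: comp.seq.S_diff_right cl z vC)
    qed
    moreover have "comp.cls 0 \<in> locMN"
      using tseq_diff[of P 0 0] tseq_diff[of Q 0 0]
      by (simp add: cls_in_locMN_iff comp.seq.zero_closed del: Int_iff)
    ultimately have "locproj ?w 0" by (simp add: locproj_def comp.seq.zero_closed)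
    from angle_bound[OF w this] have Bw: "snrm (B ?w) \<le> angle * snrm ?w" by (simp add: B_def)
    have eq: "(B ^^ Suc n) z - v = B ?w + (B v - v)" by (simp add: B_def tseq_diff)
    have "snrm ((B ^^ Suc n) z - v) \<le> snrm (B ?w) + snrm (B v - v)"
      unfolding eq
      by (intro comp.seq.nrm_triangle comp.seq.diff_closed vC)
         (simp_all only: B_def PQ_closed vC w)
    also have "\<dots> \<le> angle * snrm ?w" using Bw snrm_PQ_fixed[OF vC vV] by (simp add: B_def)
    also have "\<dots> \<le> angle * (angle ^ n * snrm z)" by (intro mult_left_mono Suc angle_nonneg)
    finally show ?case unfolding power_Suc mult.assoc .
  qed
  then show ?thesis using cl by (simp add: B_def[abs_def])
qed

text \<open>The intermediate point \<open>v\<close> depends on \<open>h\<close> and need not come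
  from \<open>X\<close>. After the triangle inequality it has disappeared, and the remaining bound
  on elementary tensors transfers to \<open>X\<close>.\<close>

theorem complemented_closed_if_angle_less_one:
  assumes inj: "inj \<pi>" and less: "angle < 1"
  shows "complemented act ip (M \<inter> N) \<and> closed (M + N)"
proof (rule complemented_if_alternating_converges[OF P Q angle_nonneg less])
  fix n m x
  define A where "A = (\<lambda>x. P (Q x))"
  define B where "B = (\<lambda>y. tseq P (tseq Q y))"
  let ?k = "angle ^ n + angle ^ m"
  have k: "0 \<le> ?k" using angle_nonneg by simp
  have "norm ((A ^^ n) x - (A ^^ m) x) \<le> ?k * norm x"
  proof (rule norm_le_if_tensor_norm_le[OF inj])
    show "0 \<le> ?k * norm x" using k by simp
    fix h :: 'h
    let ?f = "Poly_Mapping.single (x, h) (1::complex)"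
    let ?z = "\<lambda>_::nat. ?f"
    have z: "?z \<in> CS" by (rule comp.cauchy_seqs_const)
    obtain v where v: "locproj ?z v" using locproj_exists[OF z] by blast
    then have vC: "v \<in> CS" by (simp add: locproj_def)
    have bd: "(B ^^ l) ?z \<in> CS" "snrm ((B ^^ l) ?z - v) \<le> angle ^ l * tensor.nrm ?f" for l
      using angle_bound_power[OF z v, of l] by (simp_all add: B_def comp.seq_nrm_const)
    \<comment> \<open>On constant sequences the localised product acts through the powers on
      \<open>X\<close>, so no limit is involved on this side.\<close>
    have Bl: "(B ^^ l) ?z = (\<lambda>_. tmap (A ^^ l) ?f)" for l
    proof (induction l)
      case 0
      then show ?case by (simp add: tmap_fixed)
    next
      case (Suc l)
      then show ?case by (simp add: B_def tseq_def tmap_tmap A_def)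
    qed
    have "tensor.nrm (Poly_Mapping.single ((A ^^ n) x - (A ^^ m) x, h) (1::complex))
        = tensor.nrm (tmap (A ^^ n) ?f - tmap (A ^^ m) ?f)"
      using nrm_tmap_diff_map[of "A ^^ n" "A ^^ m" ?f] by (simp add: tmap_single)
    also have "\<dots> = snrm ((B ^^ n) ?z - (B ^^ m) ?z)"
      using comp.seq_nrm_const[of "tmap (A ^^ n) ?f - tmap (A ^^ m) ?f"]
      by (simp add: Bl fun_diff_def)
    also have "\<dots> \<le> snrm ((B ^^ n) ?z - v) + snrm (v - (B ^^ m) ?z)"
      by (rule comp.seq.nrm_triangle3[OF bd(1) vC bd(1)])
    also have "\<dots> \<le> angle ^ n * tensor.nrm ?f + angle ^ m * tensor.nrm ?f"
      unfolding comp.seq.nrm_commute[OF vC bd(1)] by (intro add_mono bd(2))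
    also have "\<dots> = ?k * tensor.nrm ?f" by (simp add: distrib_right)
    also have "\<dots> \<le> ?k * (norm x * norm h)" by (intro mult_left_mono tensor_norm_single k)
    finally show "tensor.nrm (Poly_Mapping.single ((A ^^ n) x - (A ^^ m) x, h) 1) \<le> ?k * norm x * norm h"
      by (simp add: mult.assoc)
  qed
  then show "norm (((\<lambda>x. P (Q x)) ^^ n) x - ((\<lambda>x. P (Q x)) ^^ m) x) \<le> ?k * norm x"
    by (simp add: A_def)
qed

text \<open>\<open>|Q f - R f|\<^sup>2 = \<langle>T f, J T f\<rangle> \<le> j |T f|\<^sup>2\<close> with \<open>T = (1 - P) Q\<close>, and
  \<open>|T f|\<^sup>2 = |Q f - R f|\<^sup>2 - |P Q f - R f|\<^sup>2\<close> by Pythagoras.\<close>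

lemma closed_sum_tensor_estimates:
  assumes R: "proj_onto R (M \<inter> N)" and J: "adj J J" "\<And>x. norm (J x) \<le> j * norm x" and j: "1 \<le> j"
    and QR: "\<And>x. Q x - R x = Q (J (Q x - P (Q x))) - Q (P (J (Q x - P (Q x))))"
  shows "(tensor.nrm (tmap Q f - tmap R f))\<^sup>2 \<le> j * (tensor.nrm (tmap Q f - tmap P (tmap Q f)))\<^sup>2"
    and "(tensor.nrm (tmap P (tmap Q f) - tmap R f))\<^sup>2 \<le> (1 - 1 / j) * (tensor.nrm f)\<^sup>2"
proof -
  note P1 = proj_ontoD(1)[OF P] and Q1 = proj_ontoD(1)[OF Q] and R1 = proj_ontoD(1)[OF R]
  have RM: "P (R x) = R x" and RN: "Q (R x) = R x" for x
    using proj_ontoD(2)[OF R, of x] proj_ontoD(3)[OF P] proj_ontoD(3)[OF Q] by auto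
  have RQ: "R (Q x) = R x" for x
    using adj_unique[OF adj_comp[OF Q1 R1], of R] R1 by (simp add: RN)
  define T where "T x = Q x - P (Q x)" for x
  define T' where "T' x = Q x - Q (P x)" for x
  define E where "E x = Q x - R x" for x
  have TT: "adj T T'"
    using adj_diff[OF Q1 adj_comp[OF P1 Q1]] by (simp add: T_def[abs_def] T'_def[abs_def])
  have E1: "adj E E" using adj_diff[OF Q1 R1] by (simp add: E_def[abs_def])
  have EE: "E (E x) = E x" for x
    by (simp add: E_def adj_map_diff[OF Q1] adj_map_diff[OF R1] RN RQ proj_ontoD(4)[OF Q] proj_ontoD(4)[OF R])
  have ET: "E x = T' (J (T x))" for x by (simp add: E_def QR T_def T'_def)
  let ?y = "tmap Q f - tmap R f"
  have y: "tensor.nrm ?y = tensor.nrm (tmap E f)"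
    using nrm_tmap_diff_map[of Q R f] by (simp add: E_def[abs_def])
  have t: "tensor.nrm (tmap Q f - tmap P (tmap Q f)) = tensor.nrm (tmap T f)"
    using nrm_tmap_diff_map[of Q "\<lambda>x. P (Q x)" f] by (simp add: T_def[abs_def] tmap_tmap)
  have Esq: "(tensor.nrm (tmap E f))\<^sup>2 = Re (tform f (tmap E f))"
    by (simp add: tensor.nrm_sq tform_tmap_adj[OF E1] tmap_tmap EE)
  have "tmap E f = tmap T' (tmap J (tmap T f))"
    by (simp add: tmap_tmap ET[abs_def])
  then have "(tensor.nrm (tmap E f))\<^sup>2 = Re (tform f (tmap T' (tmap J (tmap T f))))"
    using Esq by simp
  also have "\<dots> \<le> tensor.nrm (tmap T f) * tensor.nrm (tmap J (tmap T f))"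
    unfolding tform_tmap_adj[OF TT, symmetric]
    by (rule order_trans[OF complex_Re_le_cmod tensor.cauchy_schwarz]) simp_all
  also have "\<dots> \<le> tensor.nrm (tmap T f) * (j * tensor.nrm (tmap T f))"
    using j by (intro mult_left_mono tensor_norm_tmap_selfadjoint[OF J]) simp_all
  finally show 1: "(tensor.nrm ?y)\<^sup>2 \<le> j * (tensor.nrm (tmap Q f - tmap P (tmap Q f)))\<^sup>2"
    unfolding y t by (simp add: power2_eq_square mult_ac)
  have py: "tmap P ?y = tmap P (tmap Q f) - tmap R f"
    by (simp add: tmap_diff) (simp add: tmap_tmap RM)
  have "(tensor.nrm u)\<^sup>2 = (tensor.nrm (tmap P u))\<^sup>2 + (tensor.nrm (u - tmap P u))\<^sup>2" for u
    by (simp add: tensor.nrm_sq tensor.S_simps tform_tmap_adj[OF P1] tmap_tmap proj_ontoD(4)[OF P])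
  note pyth = this[of ?y]
  have "tensor.nrm ?y \<le> tensor.nrm f"
  proof -
    have "tensor.nrm (tmap E f) * tensor.nrm (tmap E f) \<le> tensor.nrm f * tensor.nrm (tmap E f)"
      unfolding power2_eq_square[symmetric] Esq
      by (rule order_trans[OF complex_Re_le_cmod tensor.cauchy_schwarz]) simp_all
    then show ?thesis unfolding y
      using tensor.nrm_ge0[OF UNIV_I, of "tmap E f"] tensor.nrm_ge0[OF UNIV_I, of f]
      by (cases "tensor.nrm (tmap E f) = 0") (auto simp: mult_le_cancel_right)
  qed
  then have yf: "(tensor.nrm ?y)\<^sup>2 \<le> (tensor.nrm f)\<^sup>2" by (intro power_mono) simp_all
  have q: "?y - tmap P ?y = tmap Q f - tmap P (tmap Q f)" unfolding py by simp
  \<comment> \<open>A proportion 1 / j of the squared norm is lost to the component removed by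
    \<open>P\<close>; the remaining proportion is 1 - 1 / j.\<close>
  have "(tensor.nrm ?y)\<^sup>2 / j \<le> (tensor.nrm (?y - tmap P ?y))\<^sup>2"
    unfolding q using 1 j by (simp add: pos_divide_le_eq mult.commute)
  then have "(tensor.nrm (tmap P ?y))\<^sup>2 \<le> (1 - 1 / j) * (tensor.nrm ?y)\<^sup>2"
    unfolding left_diff_distrib using pyth by simp
  also have "\<dots> \<le> (1 - 1 / j) * (tensor.nrm f)\<^sup>2"
    using yf j by (intro mult_left_mono) simp_all
  finally show "(tensor.nrm (tmap P (tmap Q f) - tmap R f))\<^sup>2 \<le> (1 - 1 / j) * (tensor.nrm f)\<^sup>2"
    unfolding py .
qed

text \<open>The two estimates have separate tasks: the first shows that the localised intersection
  is the localisation of \<open>M \<inter> N\<close>, so that \<open>R\<close> computes the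
  projection onto it; the second bounds the resulting operator.\<close>

theorem angle_less_one_if_closed:
  assumes cl: "closed (M + N)"
  shows "angle < 1"
proof -
  obtain R J j0 where R: "proj_onto R (M \<inter> N)" and J: "adj J J" "\<forall>x. norm (J x) \<le> j0 * norm x"
    and QR: "\<forall>x. Q x - R x = Q (J (Q x - P (Q x))) - Q (P (J (Q x - P (Q x))))"
    using closed_sum_consequences(1)[OF P Q cl] by blast
  \<comment> \<open>Raising the bound to at least 1 makes 1 - 1 / j nonnegative, so that
    \<open>g\<close> is a genuine square root below 1.\<close>
  define j where "j = max 1 j0"
  have j: "1 \<le> j" by (simp add: j_def)
  have Jj: "norm (J x) \<le> j * norm x" for x
    by (rule order_trans[OF spec[OF J(2)]]) (simp add: j_def mult_right_mono)
  note est = closed_sum_tensor_estimates[OF R J(1) Jj j spec[OF QR]]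
  have RM: "P (R x) = R x" and RN: "Q (R x) = R x" for x
    using proj_ontoD(2)[OF R, of x] proj_ontoD(3)[OF P] proj_ontoD(3)[OF Q] by auto
  define g where "g = sqrt (1 - 1 / j)"
  have g1: "g < 1" using j by (simp add: g_def)
  have est1: "tensor.nrm (tmap Q f - tmap R f) \<le> sqrt j * tensor.nrm (tmap Q f - tmap P (tmap Q f))" for f
    using real_sqrt_le_mono[OF est(1)[of f]] by (simp add: real_sqrt_mult)
  have est2: "tensor.nrm (tmap P (tmap Q f) - tmap R f) \<le> g * tensor.nrm f" for f
    using real_sqrt_le_mono[OF est(2)[of f]] by (simp add: real_sqrt_mult g_def)
  note Pc = tseq_closed[OF P] and Qc = tseq_closed[OF Q] and Rc = tseq_closed[OF R]
  note dc = comp.seq.diff_closed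
  have "locproj z (tseq R z) \<and> snrm (tseq P (tseq Q z) - tseq R z) \<le> g"
    if z: "z \<in> CS" "snrm z \<le> 1" for z
  proof
    have "snrm (tseq P (tseq Q z) - tseq R z) \<le> g * snrm z"
      by (rule comp.seq_nrm_le[OF dc[OF PQ_closed[OF z(1)] Rc[OF z(1)]] z(1)])
         (use est2 in \<open>simp add: tseq_def\<close>)
    also have "\<dots> \<le> g" using z(2) j by (intro mult_left_le) (simp_all add: g_def)
    finally show "snrm (tseq P (tseq Q z) - tseq R z) \<le> g" .
    show "locproj z (tseq R z)" unfolding locproj_def
    proof (intro conjI ballI impI)
      show "tseq R z \<in> CS" by (rule Rc[OF z(1)])
      show "comp.cls (tseq R z) \<in> locMN"
        using Rc[OF z(1)] by (simp add: cls_in_locMN_iff tseq_tseq RM RN del: Int_iff)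
      fix w assume w: "w \<in> CS" "comp.cls w \<in> locMN"
      note PQw = PQ_closed[OF w(1)]
      have n: "snrm (w - tseq Q w) = 0" using w by (auto simp: cls_in_locMN_iff simp del: Int_iff)
      \<comment> \<open>For \<open>w\<close> in the localised intersection the right-hand side is
        null, so \<open>Q\<close> and \<open>R\<close> agree on \<open>w\<close> up to null
        sequences, and \<open>w\<close> is fixed by \<open>R\<close>.\<close>
      have Q1: "snrm (tseq Q w - tseq R w) \<le> sqrt j * snrm (tseq Q w - tseq P (tseq Q w))"
        by (rule comp.seq_nrm_le[OF dc[OF Qc Rc] dc[OF Qc PQw], OF w(1) w(1) w(1)])
           (use est1 in \<open>simp add: tseq_def\<close>)
      have "snrm (tseq Q w - tseq P (tseq Q w)) \<le> snrm (tseq Q w - w) + snrm (w - tseq P (tseq Q w))"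
        by (rule comp.seq.nrm_triangle3[OF Qc[OF w(1)] w(1) PQw])
      also have "\<dots> = 0"
        using n snrm_PQ_fixed[OF w] comp.seq.nrm_commute[OF Qc w(1), OF w(1)]
          comp.seq.nrm_commute[OF PQw w(1)] by simp
      finally have "sqrt j * snrm (tseq Q w - tseq P (tseq Q w)) \<le> 0"
        using j by (simp add: mult_le_0_iff)
      then have QRw: "snrm (tseq Q w - tseq R w) \<le> 0" using Q1 by linarith
      have "snrm (w - tseq R w) \<le> snrm (w - tseq Q w) + snrm (tseq Q w - tseq R w)"
        by (rule comp.seq.nrm_triangle3[OF w(1) Qc[OF w(1)] Rc[OF w(1)]])
      then have "snrm (w - tseq R w) = 0"
        using n QRw comp.seq.nrm_ge0[OF dc[OF w(1) Rc[OF w(1)]]] by linarith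
      then have "comp.seq_inner w z = comp.seq_inner (tseq R w) z"
        by (intro comp.seq.S_eq_if_null(2)[OF w(1) Rc[OF w(1)] z(1)])
      then show "comp.seq_inner w (z - tseq R z) = 0"
        using w(1) z(1) by (simp add: comp.seq.S_diff_right Rc tseq_sym[OF R])
    qed
  qed
  then have "angle \<le> g" by (intro angle_le) blast
  then show ?thesis using g1 by simp
qed

end

end

theorem corollary3p13:
  fixes act :: "'x::{complex_normed_vector, banach} \<Rightarrow> 'b::cstar_algebra \<Rightarrow> 'x"
    and ip :: "'x \<Rightarrow> 'x \<Rightarrow> 'b"
    and M N :: "'x set"
  assumes "hilbert_cstar_module act ip"
    and "complemented act ip M"
    and "complemented act ip N"
  shows "(\<forall>\<pi> :: 'b \<Rightarrow> 'h::chilbert_space \<Rightarrow> 'h. faithful_representation \<pi> \<longrightarrow>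
            (friedrichs_angle ip \<pi> M N < 1 \<longleftrightarrow>
             complemented act ip (M \<inter> N) \<and> closed (M + N)))
       \<and> (complemented act ip (M \<inter> N) \<and> closed (M + N) \<longleftrightarrow>
          complemented act ip (ortho_compl ip M \<inter> ortho_compl ip N) \<and>
          closed (ortho_compl ip M + ortho_compl ip N))"
proof (intro conjI allI impI)
  interpret hilbert_cstar_module act ip by (rule assms(1))
  show "complemented act ip (M \<inter> N) \<and> closed (M + N) \<longleftrightarrow>
      complemented act ip (ortho_compl ip M \<inter> ortho_compl ip N) \<and>
      closed (ortho_compl ip M + ortho_compl ip N)"
    by (rule closed_sum_iff_ortho_compl[OF assms(2,3)])
  fix \<pi> :: "'b \<Rightarrow> 'h \<Rightarrow> 'h" assume "faithful_representation \<pi>"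
  then have rep: "representation \<pi>" and inj: "inj \<pi>" by (auto simp: faithful_representation_def)
  interpret hilbert_module_rep act ip \<pi> by unfold_locales (rule rep)
  obtain P Q where P: "proj_onto P M" and Q: "proj_onto Q N"
    using assms(2,3) by (auto simp: complemented_iff)
  show "friedrichs_angle ip \<pi> M N < 1 \<longleftrightarrow> complemented act ip (M \<inter> N) \<and> closed (M + N)"
    using complemented_closed_if_angle_less_one[OF P Q inj] angle_less_one_if_closed[OF P Q] by blast
qed

end
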